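(* Let $N\ge2$ and $s\in(0,1)$. The set of all eigenvalues of the weighted spherical mixed Dirichlet–Neumann problem (E) described in the context is $$\{(j+s)(j+N-s):\ j\in\mathbb{N}\},$$ so that the eigenvalues of (E), listed in increasing order, are $\mu_k=(k+s)(k+N-s)$, $k\in\mathbb{N}$.
   Context: $\mathbb{N}=\{0,1,2,\dots\}$. Spherical problem (E). Let $\mathbb{S}^N_+=\{(\theta_1,\dots,\theta_{N+1})\in\mathbb{S}^N:\theta_{N+1}>0\}$ and let $H^1(\mathbb{S}^N_+,\theta_{N+1}^{1-2s}dS)$ be the completion of $C^\infty(\overline{\mathbb{S}^N_+})$ with respect to the norm $\big(\int_{\mathbb{S}^N_+}\theta_{N+1}^{1-2s}(|\nabla_{\mathbb{S}^N}\psi|^2+\psi^2)\,dS\big)^{1/2}$. Let $\mathcal H_0$ be the closure of $C_c^\infty(\overline{\mathbb{S}^N_+}\setminus S_1^+)$ in this space, where $S_1^+=\{(\theta',\theta_N,0)\in\mathbb{S}^N:\theta_N\ge0\}$. A number $\mu\in\mathbb{R}$ is an eigenvalue of (E), with eigenfunction $\psi$, if there exists $\psi\in\mathcal H_0\setminus\{0\}$ such that $$\int_{\mathbb{S}^N_+}\theta_{N+1}^{1-2s}\nabla_{\mathbb{S}^N}\psi\cdot\nabla_{\mathbb{S}^N}\phi\,dS=\mu\int_{\mathbb{S}^N_+}\theta_{N+1}^{1-2s}\psi\phi\,dS\quad\text{for all }\phi\in\mathcal H_0 .$$ This is the weak form of $-\mathrm{div}_{\mathbb{S}^N}(\theta_{N+1}^{1-2s}\nabla_{\mathbb{S}^N}\psi)=\mu\,\theta_{N+1}^{1-2s}\psi$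 in $\mathbb{S}^N_+$, with $\psi=0$ on $\mathbb{S}^{N-1}\cap\{\theta_N\ge0\}$ and $\lim_{\theta_{N+1}\to0^+}\theta_{N+1}^{1-2s}\nabla_{\mathbb{S}^N}\psi\cdot\nu=0$ on $\mathbb{S}^{N-1}\cap\{\theta_N<0\}$, where $\nu=(0,\dots,0,-1)$. *)

theory Defs
  imports "HOL-Analysis.Analysis"
begin

subsection \<open>Smooth functions on open sets\<close>

text \<open>\<open>Ck_on k U f\<close> for open \<open>U\<close>: the iterated directional derivatives of \<open>f\<close> up to order \<open>k\<close>
  exist and are continuous on \<open>U\<close>.\<close>

primrec Ck_on :: "nat \<Rightarrow> 'a::euclidean_space set \<Rightarrow> ('a \<Rightarrow> real) \<Rightarrow> bool" where
  "Ck_on 0 U f = continuous_on U f"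
| "Ck_on (Suc k) U f =
     ((\<forall>x\<in>U. f differentiable (at x)) \<and> (\<forall>v. Ck_on k U (\<lambda>x. frechet_derivative f (at x) v)))"

definition smooth_on :: "'a::euclidean_space set \<Rightarrow> ('a \<Rightarrow> real) \<Rightarrow> bool" where
  "smooth_on U f \<longleftrightarrow> (\<forall>k. Ck_on k U f)"


subsection \<open>Surface measure and gradient on the unit sphere\<close>

text \<open>The surface measure \<open>dS\<close> of the unit sphere of a \<open>d\<close>-dimensional space is \<open>d\<close> times the
  image of Lebesgue measure on the unit ball under the radial projection. It is a measure on the
  Borel sets of the ambient space, concentrated on the sphere (the origin is mapped to itself, but
  is a null set).\<close>

definition sphere_measure :: "'a::euclidean_space measure" where
  "sphere_measure =
     scale_measure (of_nat DIM('a))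
       (distr (restrict_space lborel (ball 0 1)) borel (\<lambda>x. x /\<^sub>R norm x))"

text \<open>The Riemannian gradient on the sphere is the ambient gradient of the extension that is
  constant along rays. At a point \<open>\<theta>\<close> of the unit sphere it is orthogonal to \<open>\<theta>\<close> and depends only
  on the values of \<open>f\<close> on the sphere near \<open>\<theta>\<close>.\<close>

definition sphere_grad :: "('a::euclidean_space \<Rightarrow> real) \<Rightarrow> 'a \<Rightarrow> 'a" where
  "sphere_grad f \<theta> = (THE g. GDERIV (\<lambda>x. f (x /\<^sub>R norm x)) \<theta> :> g)"


subsection \<open>The half-sphere\<close>

text \<open>With \<open>CARD('m) = N - 1\<close>, points of the \<open>N + 1\<close>-dimensional Euclidean space are written
  \<open>(\<theta>', \<theta>\<^sub>N, \<theta>\<^sub>N\<^sub>+\<^sub>1)\<close>; the norm of the product type is the Euclidean one.\<close>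

type_synonym 'm pt = "(real ^ 'm) \<times> real \<times> real"

definition hemi :: "'m::finite pt set" where
  "hemi = {\<theta> \<in> sphere 0 1. snd (snd \<theta>) > 0}"

definition closed_hemi :: "'m::finite pt set" where
  "closed_hemi = {\<theta> \<in> sphere 0 1. snd (snd \<theta>) \<ge> 0}"

definition S1_plus :: "'m::finite pt set" where
  "S1_plus = {\<theta> \<in> sphere 0 1. fst (snd \<theta>) \<ge> 0 \<and> snd (snd \<theta>) = 0}"

definition weighted_measure :: "real \<Rightarrow> 'm::finite pt measure" where
  "weighted_measure s =
     density (restrict_space sphere_measure hemi) (\<lambda>\<theta>. ennreal (snd (snd \<theta>) powr (1 - 2 * s)))"

text \<open>Only the values of a function on \<open>closed_hemi\<close> are relevant.\<close>

definition smooth_closed_hemi :: "('m::finite pt \<Rightarrow> real) set" where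
  "smooth_closed_hemi =
     {\<phi>. \<exists>U F. open U \<and> closed_hemi \<subseteq> U \<and> smooth_on U F \<and> (\<forall>\<theta>\<in>closed_hemi. \<phi> \<theta> = F \<theta>)}"

definition test_functions :: "('m::finite pt \<Rightarrow> real) set" where
  "test_functions =
     {\<phi> \<in> smooth_closed_hemi.
        \<exists>K. compact K \<and> K \<subseteq> closed_hemi - S1_plus \<and> (\<forall>\<theta>\<in>closed_hemi - K. \<phi> \<theta> = 0)}"


subsection \<open>The weighted Sobolev spaces\<close>

text \<open>The map \<open>\<phi> \<mapsto> (\<phi>, \<nabla>\<phi>)\<close> embeds the smooth functions isometrically into the
  product of the scalar and vector-valued weighted \<open>L\<^sup>2\<close> spaces, which is complete. The completion
  is therefore realised as the closure of the image: its elements are represented by pairs of a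
  function and its (weak) gradient, up to equality almost everywhere. Two representatives denote
  the same element iff their squared distance vanishes.\<close>

type_synonym 'm jet = "('m pt \<Rightarrow> real) \<times> ('m pt \<Rightarrow> 'm pt)"

definition jet :: "('m::finite pt \<Rightarrow> real) \<Rightarrow> 'm jet" where
  "jet \<phi> = (\<phi>, sphere_grad \<phi>)"

definition sq_dist :: "real \<Rightarrow> 'm::finite jet \<Rightarrow> 'm jet \<Rightarrow> ennreal" where
  "sq_dist s p q =
     (\<integral>\<^sup>+ \<theta>. ennreal ((norm (snd p \<theta> - snd q \<theta>))\<^sup>2 + (fst p \<theta> - fst q \<theta>)\<^sup>2) \<partial>weighted_measure s)"

definition H1 :: "real \<Rightarrow> 'm::finite jet set" where
  "H1 s =
     {p. fst p \<in> borel_measurable (weighted_measure s) \<and>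
         snd p \<in> borel_measurable (weighted_measure s) \<and>
         (\<forall>\<epsilon>>0. \<exists>\<phi>\<in>smooth_closed_hemi. sq_dist s p (jet \<phi>) < \<epsilon>)}"

definition H0 :: "real \<Rightarrow> 'm::finite jet set" where
  "H0 s = {p \<in> H1 s. \<forall>\<epsilon>>0. \<exists>\<phi>\<in>test_functions. sq_dist s p (jet \<phi>) < \<epsilon>}"


subsection \<open>Eigenvalues\<close>

definition eigenfunction :: "real \<Rightarrow> real \<Rightarrow> 'm::finite jet \<Rightarrow> bool" where
  "eigenfunction s \<mu> \<psi> \<longleftrightarrow>
     \<psi> \<in> H0 s \<and> sq_dist s \<psi> (\<lambda>_. 0, \<lambda>_. 0) \<noteq> 0 \<and>
     (\<forall>\<phi>\<in>H0 s.
        (LINT \<theta>|weighted_measure s. snd \<psi> \<theta> \<bullet> snd \<phi> \<theta>) =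
        \<mu> * (LINT \<theta>|weighted_measure s. fst \<psi> \<theta> * fst \<phi> \<theta>))"

definition eigenvalues :: "'m::finite itself \<Rightarrow> real \<Rightarrow> real set" where
  "eigenvalues _ s = {\<mu>. \<exists>\<psi> :: 'm jet. eigenfunction s \<mu> \<psi>}"

end

theory Submission
  imports Defs "HOL-Real_Asymp.Real_Asymp"
begin

text \<open>Write \<open>t = x\<^sub>N\<close>, \<open>y = x\<^sub>N\<^sub>+\<^sub>1\<close>, \<open>r\<^sup>2 = t\<^sup>2 + y\<^sup>2\<close>, \<open>w = r - t\<close> and \<open>v = r + t\<close>. In these parabolic coordinates
  the operator \<open>\<Delta> + (1 - 2 s) y\<^sup>-\<^sup>1 \<partial>\<^sub>y\<close> maps \<open>w\<^sup>a v\<^sup>b\<close> to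
  \<open>(2 / r) (a (a - s) w\<^sup>a\<^sup>-\<^sup>1 v\<^sup>b + b (b - s) w\<^sup>a v\<^sup>b\<^sup>-\<^sup>1)\<close>, so for each \<open>j\<close> it annihilates a function \<open>h\<^sub>j\<close>
  of degree \<open>j + s\<close> that is \<open>w\<^sup>s\<close> times a polynomial in \<open>w, v\<close>, vanishes on the Dirichlet part and satisfies
  the Neumann condition. Its restriction to the sphere is an eigenfunction with eigenvalue \<open>(j + s) (j + N - s)\<close>.

  Conversely, the spherical operator maps \<open>h\<^sub>j (a \<bullet> x')\<^sup>n\<close> to \<open>(j + n + s) (j + n + N - s)\<close> times itself minus
  \<open>n (n - 1) |a|\<^sup>2 h\<^sub>j (a \<bullet> x')\<^sup>n\<^sup>-\<^sup>2\<close>. Hence an eigenfunction for any other value is orthogonal to all of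
  these, by induction on \<open>n\<close>. They are total: expanding \<open>exp (a \<bullet> x')\<close> and using Stone-Weierstrass in \<open>x'\<close>
  one may replace \<open>(a \<bullet> x')\<^sup>n\<close> by any continuous function of \<open>x'\<close>, in particular by powers of
  \<open>r = \<surd>(1 - |x'|\<^sup>2)\<close>; since the coefficient of \<open>t\<^sup>j\<close> in \<open>h\<^sub>j / w\<^sup>s\<close> is nonzero, the closed span contains
  all \<open>w\<^sup>s t\<^sup>j g(x')\<close>, and Stone-Weierstrass applies once more.\<close>

subsection \<open>Smooth cutoffs\<close>

text \<open>No spectral theory enters: both inclusions rest on one weak identity,
  \<open>efun_weak_equation\<close>. The difficulty is its justification at the boundary, where
  weight and gradients are singular. Since surface measure is a radial image of Lebesgue measure on
  the ball, integration by parts is done in the ball, for fields with compact support in the open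
  half-ball, where it reduces to translation invariance. Two limits remain. At y = 0 the flux is
  controlled by writing the y-derivative of f as y q with q continuous up to the Neumann part: a
  cutoff in y then contributes only y \<open>cutoff'\<close>(y) times a bounded factor and the
  weight, and y \<open>cutoff'\<close>(y) is bounded and tends to 0. At w = 0, where w^s is not
  smooth, a cutoff in w contributes at most the density w^(2s-1)/r, which is also the order of the
  energy density of w^s itself. Its integrability against the weight, for every s in (0,1), thus
  yields both finite energy and membership in \<open>H0\<close>.\<close>

definition flat :: "nat \<Rightarrow> real \<Rightarrow> real" where
  "flat i u = (if u > 0 then exp (- (1 / u)) / u ^ i else 0)"

lemma flat_nonpos [simp]: "u \<le> 0 \<Longrightarrow> flat i u = 0"
  by (simp add: flat_def)

lemma flat_nonneg: "0 \<le> flat i u"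
  by (simp add: flat_def)

lemma flat_0_le_1: "flat 0 u \<le> 1"
  by (simp add: flat_def)

lemma tendsto_flat_0: "(flat i \<longlongrightarrow> 0) (at 0)"
proof -
  have "((\<lambda>z::real. z ^ i / exp z) \<longlongrightarrow> 0) at_top"
    by (rule tendsto_power_div_exp_0)
  then have "((\<lambda>u. inverse u ^ i / exp (inverse u)) \<longlongrightarrow> 0) (at_right (0::real))"
    by (rule filterlim_compose[OF _ filterlim_inverse_at_top_right])
  moreover have "\<forall>\<^sub>F u in at_right 0. inverse u ^ i / exp (inverse u) = flat i u"
    unfolding eventually_at_filter by (rule always_eventually)
      (simp add: flat_def exp_minus field_simps)
  ultimately have right: "(flat i \<longlongrightarrow> 0) (at_right 0)"
    using tendsto_cong by force
  have "\<forall>\<^sub>F u in at_left 0. flat i u = 0"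
    unfolding eventually_at_filter by (rule always_eventually) auto
  then have "(flat i \<longlongrightarrow> 0) (at_left 0)"
    by (rule tendsto_eventually)
  with right show ?thesis
    by (simp add: filterlim_split_at)
qed

lemma DERIV_inverse_power:
  assumes "(u::real) \<noteq> 0"
  shows "((\<lambda>u. inverse u ^ i) has_real_derivative - (real i * inverse u ^ Suc i)) (at u)"
proof (induction i)
  case (Suc i)
  show ?case
    unfolding power_Suc
    by (rule DERIV_cong[OF DERIV_mult[OF DERIV_inverse[OF assms] Suc]])
      (simp add: algebra_simps numeral_2_eq_2)
qed simp

text \<open>Differentiation stays inside the family, which is the reason for carrying the index
  \<open>i\<close>: \<open>flat 0\<close> is the classical smooth function exp(-1/u), and all its
  derivatives are combinations of the \<open>flat i\<close>.\<close>

lemma flat_DERIV: "(flat i has_real_derivative flat (i + 2) u - real i * flat (i + 1) u) (at u)"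
proof -
  consider "u > 0" | "u < 0" | "u = 0" by linarith
  then show ?thesis
  proof cases
    case 1
    have e: "((\<lambda>u. exp (- (1 / u))) has_real_derivative exp (- (1 / u)) * inverse u ^ 2) (at u)"
      using 1 by (auto intro!: derivative_eq_intros simp: field_simps power2_eq_square)
    have "((\<lambda>u. exp (- (1 / u)) * inverse u ^ i) has_real_derivative
        exp (- (1 / u)) * inverse u ^ (i + 2) - real i * (exp (- (1 / u)) * inverse u ^ (i + 1))) (at u)"
      by (rule DERIV_cong[OF DERIV_mult[OF e DERIV_inverse_power]])
        (use 1 in \<open>simp_all add: algebra_simps power_add power2_eq_square\<close>)
    then have "((\<lambda>u. exp (- (1 / u)) * inverse u ^ i) has_real_derivative
        flat (i + 2) u - real i * flat (i + 1) u) (at u)"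
      using 1 by (simp add: flat_def field_simps)
    then show ?thesis
      by (rule has_field_derivative_transform_within_open[where S = "{0<..}"])
        (use 1 in \<open>auto simp: flat_def field_simps\<close>)
  next
    case 2
    have "((\<lambda>_. 0) has_real_derivative 0) (at u)" by simp
    then have "(flat i has_real_derivative 0) (at u)"
      by (rule has_field_derivative_transform_within_open[where S = "{..<0}"]) (use 2 in auto)
    then show ?thesis using 2 by simp
  next
    case 3
    \<comment> \<open>At the origin the difference quotient is itself a member of the family, so its
      limit is already known.\<close>
    have "(\<lambda>h. (flat i h - flat i 0) / (h - 0)) = flat (i + 1)"
      by (auto simp: flat_def fun_eq_iff)
    then have "(flat i has_real_derivative 0) (at 0)"
      unfolding has_field_derivative_iff using tendsto_flat_0[of "i + 1"] by simp
    then show ?thesis using 3 by simp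
  qed
qed

lemma continuous_flat: "continuous_on A (flat i)"
  by (meson DERIV_isCont continuous_at_imp_continuous_on flat_DERIV)

text \<open>The cutoff uses u = n x - 1, so u + 1 = n x is exactly the factor that meets
  \<open>flat 2\<close> in x \<open>cutoff'\<close>(x). With z = 1/u the product becomes (z + z^2)
  exp(-z), and the quadratic Taylor bound for exp gives 2.\<close>

lemma flat_2_bound: "(u + 1) * flat 2 u \<le> 2"
proof (cases "u > 0")
  case True
  define z where "z = 1 / u"
  have z: "z > 0" using True by (simp add: z_def)
  have "1 + z + z\<^sup>2 / 2 \<le> exp z"
    using exp_lower_Taylor_quadratic[of z] z by simp
  then have "z + z\<^sup>2 \<le> 2 * exp z" using z by simp
  then have "(z + z\<^sup>2) * exp (- z) \<le> 2 * exp z * exp (- z)"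
    by (intro mult_right_mono) auto
  then have "(z + z\<^sup>2) * exp (- z) \<le> 2"
    by (simp add: exp_minus_inverse mult.assoc)
  moreover have "(u + 1) * flat 2 u = (z + z\<^sup>2) * exp (- z)"
    using True by (simp add: flat_def z_def field_simps power2_eq_square)
  ultimately show ?thesis by simp
qed simp

text \<open>A smooth function that is zero for n x \<le> 1 and tends to 1 for each x > 0. It stays
  below 1 instead of reaching a plateau; all limits are taken by dominated convergence.\<close>

definition cutoff :: "nat \<Rightarrow> real \<Rightarrow> real" where
  "cutoff n x = flat 0 (real n * x - 1)"

definition cutoff' :: "nat \<Rightarrow> real \<Rightarrow> real" where
  "cutoff' n x = real n * flat 2 (real n * x - 1)"

lemma cutoff_DERIV: "(cutoff n has_real_derivative cutoff' n x) (at x)"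
proof -
  have "((\<lambda>x. flat 0 (real n * x - 1)) has_real_derivative
      (flat (0 + 2) (real n * x - 1) - real 0 * flat (0 + 1) (real n * x - 1)) * real n) (at x)"
    by (rule DERIV_chain'[of _ _ _ _ "flat 0", OF _ flat_DERIV]) (auto intro!: derivative_eq_intros)
  then show ?thesis by (simp add: cutoff_def[abs_def] cutoff'_def mult.commute numeral_2_eq_2)
qed

lemma cutoff_nonneg: "0 \<le> cutoff n x" and cutoff_le_1: "cutoff n x \<le> 1"
  by (simp_all add: cutoff_def flat_nonneg flat_0_le_1)

lemma cutoff_eq_0: "real n * x \<le> 1 \<Longrightarrow> cutoff n x = 0"
  and cutoff'_eq_0: "real n * x \<le> 1 \<Longrightarrow> cutoff' n x = 0"
  by (simp_all add: cutoff_def cutoff'_def)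

text \<open>The bound is independent of n. A term that contains the derivative of the cutoff
  together with a factor of order x is therefore dominated; this is applied with x = y in Green's
  formula and with x = w near the Dirichlet set.\<close>

lemma cutoff'_bound: "\<bar>x * cutoff' n x\<bar> \<le> 2"
proof (cases "real n * x \<le> 1")
  case False
  then have "x * real n > 0" by (simp add: mult.commute)
  then have "\<bar>x * cutoff' n x\<bar> = (real n * x - 1 + 1) * flat 2 (real n * x - 1)"
    by (simp add: cutoff'_def flat_nonneg abs_mult mult_ac zero_less_mult_iff)
  also have "\<dots> \<le> 2" by (rule flat_2_bound)
  finally show ?thesis .
qed (simp add: cutoff'_eq_0)

lemma continuous_cut [continuous_intros]:
  "continuous_on A f \<Longrightarrow> continuous_on A (\<lambda>x. cutoff n (f x))"
  "continuous_on A f \<Longrightarrow> continuous_on A (\<lambda>x. cutoff' n (f x))"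
  unfolding cutoff_def cutoff'_def
  by (auto intro!: continuous_intros continuous_on_compose2[OF continuous_flat[of UNIV]])

lemma cutoff_tendsto:
  assumes "x > 0" shows "(\<lambda>n. cutoff n x) \<longlonglongrightarrow> 1"
proof -
  have lim: "filterlim (\<lambda>n. real n * x - 1) at_top sequentially"
    using assms by real_asymp
  have "((\<lambda>u. exp (- (1 / u))) \<longlongrightarrow> (1::real)) at_top" by real_asymp
  moreover have "\<forall>\<^sub>F u in at_top. exp (- (1 / u)) = flat 0 u"
    by (rule eventually_mono[OF eventually_gt_at_top[of 0]]) (simp add: flat_def)
  ultimately have "(flat 0 \<longlongrightarrow> 1) at_top" using tendsto_cong by force
  from filterlim_compose[OF this lim] show ?thesis by (simp add: cutoff_def)
qed

lemma cutoff'_tendsto: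
  assumes "x > 0" shows "(\<lambda>n. cutoff' n x) \<longlonglongrightarrow> 0"
proof -
  have "(\<lambda>n. real n * (exp (- (1 / (real n * x - 1))) / (real n * x - 1) ^ 2)) \<longlonglongrightarrow> 0"
    using assms by real_asymp
  moreover have "\<forall>\<^sub>F n in sequentially.
      real n * (exp (- (1 / (real n * x - 1))) / (real n * x - 1) ^ 2) = cutoff' n x"
  proof -
    have "filterlim (\<lambda>n. real n * x - 1) at_top sequentially"
      using assms by real_asymp
    then have "\<forall>\<^sub>F n in sequentially. real n * x - 1 > 0"
      unfolding filterlim_at_top_dense by (rule spec)
    then show ?thesis by eventually_elim (simp add: flat_def cutoff'_def)
  qed
  ultimately show ?thesis using tendsto_cong by force
qed

subsection \<open>Smoothness\<close>

lemma Ck_on_cong: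
  assumes "open U" "\<And>x. x \<in> U \<Longrightarrow> f x = g x" "Ck_on k U f"
  shows "Ck_on k U g"
  using assms(2,3)
proof (induction k arbitrary: f g)
  case 0
  then show ?case using continuous_on_cong[of U U f g] by simp
next
  case (Suc k)
  have D: "(g has_derivative frechet_derivative f (at x)) (at x)" if "x \<in> U" for x
  proof -
    have "(f has_derivative frechet_derivative f (at x)) (at x)"
      using Suc.prems(2) that frechet_derivative_works by auto
    then show ?thesis
      by (rule has_derivative_transform_within_open[OF _ assms(1) that]) (simp add: Suc.prems)
  qed
  then have "frechet_derivative f (at x) = frechet_derivative g (at x)" if "x \<in> U" for x
    using frechet_derivative_at that by blast
  then show ?case
    using Suc.prems(2) D Suc.IH[of "\<lambda>x. frechet_derivative f (at x) v" "\<lambda>x. frechet_derivative g (at x) v" for v]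
    by (auto simp: differentiable_def)
qed

lemma Ck_on_Un:
  assumes "open U" "open V" "Ck_on k U f" "Ck_on k V f"
  shows "Ck_on k (U \<union> V) f"
  using assms(3,4)
proof (induction k arbitrary: f)
  case 0
  then show ?case using continuous_on_open_Un[OF assms(1,2)] by simp
qed auto

lemma Ck_on_zero: "Ck_on k U (\<lambda>_. 0)"
proof (induction k)
  case (Suc k)
  have "frechet_derivative (\<lambda>_. 0::real) (at x) = (\<lambda>_. 0)" for x :: 'a
    by (rule frechet_derivative_at[symmetric]) simp
  then show ?case using Suc by simp
qed simp

text \<open>If directional derivatives never leave the class \<open>S\<close>, every iterated
  derivative is again in \<open>S\<close>, and members of \<open>S\<close> are continuous because
  they are differentiable. Higher derivatives need not be computed.\<close>

lemma Ck_on_derivative_closed: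
  fixes S :: "('a::euclidean_space \<Rightarrow> real) set"
  assumes "open U"
    and D: "\<And>f. f \<in> S \<Longrightarrow> \<exists>D. (\<forall>v. (\<lambda>x. D x v) \<in> S) \<and> (\<forall>x\<in>U. (f has_derivative D x) (at x))"
    and "f \<in> S"
  shows "Ck_on k U f"
  using assms(3)
proof (induction k arbitrary: f)
  case 0
  then show ?case using D[OF 0]
    by (auto intro!: continuous_at_imp_continuous_on dest: has_derivative_continuous)
next
  case (Suc k)
  from D[OF Suc.prems] obtain D where D: "\<And>v. (\<lambda>x. D x v) \<in> S" "\<And>x. x \<in> U \<Longrightarrow> (f has_derivative D x) (at x)"
    by blast
  have "Ck_on k U (\<lambda>x. frechet_derivative f (at x) v)" for v
    by (rule Ck_on_cong[OF assms(1) _ Suc.IH[OF D(1)[of v]]])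
      (use D(2) frechet_derivative_at in metis)
  then show ?case using D(2) by (auto simp: differentiable_def)
qed

text \<open>It vanishes exactly where y = 0 and t \<ge> 0, the cone over \<open>S1_plus\<close>.
  Cutting off in \<open>wfun\<close> therefore removes a neighbourhood of the Dirichlet part but
  leaves the Neumann part inside \<open>wfun x > 0\<close>.\<close>

definition wfun :: "'m::finite pt \<Rightarrow> real" where
  "wfun x = norm (snd x) - fst (snd x)"

text \<open>This class is closed under directional derivatives on \<open>{w > 0}\<close>, so its members are smooth there.\<close>

inductive sm :: "real \<Rightarrow> ('m::finite pt \<Rightarrow> real) \<Rightarrow> bool" for n where
  sm_const: "sm n (\<lambda>x. c)"
| sm_inner: "sm n (\<lambda>x. x \<bullet> b)"
| sm_rpow: "sm n (\<lambda>x. norm (snd x) powr p)"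
| sm_wpow: "sm n (\<lambda>x. wfun x powr p)"
| sm_flat: "sm n (\<lambda>x. flat i (n * wfun x - 1))"
| sm_add: "sm n f \<Longrightarrow> sm n g \<Longrightarrow> sm n (\<lambda>x. f x + g x)"
| sm_mult: "sm n f \<Longrightarrow> sm n g \<Longrightarrow> sm n (\<lambda>x. f x * g x)"

lemma open_wfun_pos: "open {x. wfun x > a}"
  unfolding wfun_def by (intro open_Collect_less continuous_intros)

lemma continuous_wfun [continuous_intros]:
  "continuous_on A f \<Longrightarrow> continuous_on A (\<lambda>x. wfun (f x))"
  unfolding wfun_def by (intro continuous_intros)

lemma wfun_pos_snd: "wfun x > 0 \<Longrightarrow> snd x \<noteq> 0"
  by (auto simp: wfun_def)

lemma rr_has_derivative:
  fixes x :: "'a::real_inner \<times> 'b::real_inner"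
  assumes "snd x \<noteq> 0"
  shows "((\<lambda>x. norm (snd x)) has_derivative (\<lambda>h. (snd x \<bullet> snd h) / norm (snd x))) (at x)"
proof -
  have "((\<lambda>x::'a \<times> 'b. norm (snd x)) has_derivative (\<lambda>h. snd h \<bullet> sgn (snd x))) (at x)"
    by (rule has_derivative_compose[OF has_derivative_snd[OF has_derivative_ident] has_derivative_norm[OF assms]])
  then show ?thesis by (simp add: sgn_div_norm inner_commute divide_inverse mult.commute)
qed

lemma wfun_has_derivative:
  assumes "snd x \<noteq> 0"
  shows "(wfun has_derivative (\<lambda>h. (snd x \<bullet> snd h) / norm (snd x) - fst (snd h))) (at x)"
  unfolding wfun_def[abs_def]
  by (rule has_derivative_diff[OF rr_has_derivative[OF assms]]) (auto intro!: derivative_eq_intros)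

lemma sm_minus: "sm n f \<Longrightarrow> sm n (\<lambda>x. - f x)"
  using sm_mult[OF sm_const[of n "-1"]] by simp

lemma sm_power: "sm n f \<Longrightarrow> sm n (\<lambda>x. f x ^ k)"
  by (induction k) (auto intro: sm_const sm_mult)

lemma sm_sum: "(\<And>i. i \<in> I \<Longrightarrow> sm n (f i)) \<Longrightarrow> sm n (\<lambda>x. \<Sum>i\<in>I. f i x)"
  by (induction I rule: infinite_finite_induct) (auto intro: sm_const sm_add)

lemma sm_fst_snd: "sm n (\<lambda>x. fst (snd x))"
proof -
  have "(\<lambda>x::'a pt. fst (snd x)) = (\<lambda>x. x \<bullet> (0, 1, 0))" by (auto simp: inner_prod_def)
  then show ?thesis by (metis sm_inner)
qed

lemma sm_dr: "sm n (\<lambda>x. (snd x \<bullet> snd v) * norm (snd x) powr - 1)"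
proof -
  have "(\<lambda>x::'a pt. snd x \<bullet> snd v) = (\<lambda>x. x \<bullet> (0, snd v))" by (auto simp: inner_prod_def)
  then have "sm n (\<lambda>x::'a pt. snd x \<bullet> snd v)" by (metis sm_inner)
  then show ?thesis by (rule sm_mult[OF _ sm_rpow])
qed

lemma sm_dw: "sm n (\<lambda>x. (snd x \<bullet> snd v) * norm (snd x) powr - 1 - fst (snd v))"
  using sm_add[OF sm_dr sm_const[of n "- fst (snd v)" ]] by simp

text \<open>Each generator differentiates into sums and products of generators: the gradient of r
  contributes r^(-1), real powers lose one in the exponent, and the index \<open>i\<close> of
  \<open>sm_flat\<close> absorbs the new \<open>flat\<close> terms.\<close>

lemma sm_derivative:
  assumes "sm n f"
  shows "\<exists>D. (\<forall>v. sm n (\<lambda>x. D x v)) \<and> (\<forall>x\<in>{x. wfun x > 0}. (f has_derivative D x) (at x))"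
  using assms
proof induction
  case (sm_const c)
  show ?case by (rule exI[of _ "\<lambda>_ _. 0"]) (auto intro: sm.sm_const)
next
  case (sm_inner b)
  show ?case by (rule exI[of _ "\<lambda>_ v. v \<bullet> b"]) (auto intro!: sm.sm_const derivative_eq_intros)
next
  case (sm_rpow p)
  let ?D = "\<lambda>x v. p * (norm (snd x) powr (p - 1) * ((snd x \<bullet> snd v) * norm (snd x) powr - 1))"
  have "((\<lambda>x. norm (snd x) powr p) has_derivative ?D x) (at x)" if "wfun x > 0" for x :: "'a pt"
    using wfun_pos_snd[OF that]
    by (auto intro!: derivative_eq_intros rr_has_derivative simp: fun_eq_iff powr_minus powr_diff field_simps)
  then show ?case
    by (intro exI[of _ ?D] conjI allI sm.sm_mult sm.sm_const sm.sm_rpow sm_dr) auto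
next
  case (sm_wpow p)
  let ?D = "\<lambda>x v. p * (wfun x powr (p - 1) * ((snd x \<bullet> snd v) * norm (snd x) powr - 1 - fst (snd v)))"
  have "((\<lambda>x. wfun x powr p) has_derivative ?D x) (at x)" if "wfun x > 0" for x :: "'a pt"
    using that wfun_pos_snd[OF that]
    by (auto intro!: derivative_eq_intros wfun_has_derivative simp: fun_eq_iff powr_minus powr_diff field_simps)
  then show ?case
    by (intro exI[of _ ?D] conjI allI sm.sm_mult sm.sm_const sm.sm_wpow sm_dw) auto
next
  case (sm_flat i)
  let ?D = "\<lambda>x v. (flat (i + 2) (n * wfun x - 1) + - (real i * flat (i + 1) (n * wfun x - 1))) *
    (n * ((snd x \<bullet> snd v) * norm (snd x) powr - 1 - fst (snd v)))"
  have "((\<lambda>x. flat i (n * wfun x - 1)) has_derivative ?D x) (at x)" if "wfun x > 0" for x :: "'a pt"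
  proof -
    have a: "((\<lambda>x. n * wfun x - 1) has_derivative 
        (\<lambda>v. n * ((snd x \<bullet> snd v) / norm (snd x) - fst (snd v)))) (at x)"
      using wfun_pos_snd[OF that] by (auto intro!: derivative_eq_intros wfun_has_derivative)
    have "((\<lambda>x. flat i (n * wfun x - 1)) has_derivative 
        (\<lambda>v. (flat (i + 2) (n * wfun x - 1) - real i * flat (i + 1) (n * wfun x - 1)) *
          (n * ((snd x \<bullet> snd v) / norm (snd x) - fst (snd v))))) (at x)"
      by (rule has_derivative_compose[OF a flat_DERIV[unfolded has_field_derivative_def]])
    then show ?thesis by (simp add: powr_minus divide_inverse)
  qed
  then show ?case
    by (intro exI[of _ ?D] conjI allI sm.sm_mult sm.sm_const sm.sm_add sm_minus sm.sm_flat sm_dw) auto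
next
  case (sm_add f g)
  from sm_add.IH(1) obtain D where
    D: "(\<forall>v. sm n (\<lambda>x. D x v)) \<and> (\<forall>x\<in>{x. wfun x > 0}. (f has_derivative D x) (at x))" ..
  from sm_add.IH(2) obtain E where
    E: "(\<forall>v. sm n (\<lambda>x. E x v)) \<and> (\<forall>x\<in>{x. wfun x > 0}. (g has_derivative E x) (at x))" ..
  note DE = D[THEN conjunct1, rule_format] E[THEN conjunct1, rule_format]
    D[THEN conjunct2, rule_format] E[THEN conjunct2, rule_format]
  show ?case
    by (rule exI[of _ "\<lambda>x v. D x v + E x v"]) 
      (intro conjI allI ballI sm.sm_add has_derivative_add DE)
next
  case (sm_mult f g)
  from sm_mult.IH(1) obtain D where
    D: "(\<forall>v. sm n (\<lambda>x. D x v)) \<and> (\<forall>x\<in>{x. wfun x > 0}. (f has_derivative D x) (at x))" ..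
  from sm_mult.IH(2) obtain E where
    E: "(\<forall>v. sm n (\<lambda>x. E x v)) \<and> (\<forall>x\<in>{x. wfun x > 0}. (g has_derivative E x) (at x))" ..
  note DE = D[THEN conjunct1, rule_format] E[THEN conjunct1, rule_format]
    D[THEN conjunct2, rule_format] E[THEN conjunct2, rule_format]
  show ?case
    by (rule exI[of _ "\<lambda>x v. f x * E x v + D x v * g x"]) 
      (intro conjI allI ballI sm.sm_add sm.sm_mult sm_mult.hyps has_derivative_mult DE)
qed

lemma sm_smooth: "sm n f \<Longrightarrow> smooth_on {x. wfun x > 0} f"
  unfolding smooth_on_def
  by (intro allI Ck_on_derivative_closed[where S = "{f. sm n f}"] open_wfun_pos)
    (simp_all only: mem_Collect_eq[of _ "sm n"] sm_derivative)

text \<open>The product is smooth on \<open>wfun x > 0\<close> because it is in the closed class,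
  and it is zero on \<open>wfun x < 1 / n\<close>. These two open sets cover the space, so the
  singularity of \<open>f\<close> on the Dirichlet cone is never seen.\<close>

lemma smooth_cutoff:
  assumes "sm (real n) f" "n > 0"
  shows "smooth_on UNIV (\<lambda>x. cutoff n (wfun x) * f x)"
proof -
  have "sm (real n) (\<lambda>x. cutoff n (wfun x) * f x)"
    unfolding cutoff_def by (intro sm_mult sm_flat assms)
  then have 1: "Ck_on k {x. wfun x > 0} (\<lambda>x. cutoff n (wfun x) * f x)" for k
    using sm_smooth smooth_on_def by blast
  have op: "open {x::'a pt. wfun x < 1 / real n}"
    unfolding wfun_def by (intro open_Collect_less continuous_intros)
  have 2: "Ck_on k {x. wfun x < 1 / real n} (\<lambda>x. cutoff n (wfun x) * f x)" for k
    by (rule Ck_on_cong[OF op _ Ck_on_zero]) (use assms(2) in \<open>auto simp: cutoff_eq_0 field_simps\<close>)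
  have "{x. wfun x > 0} \<union> {x::'a pt. wfun x < 1 / real n} = UNIV"
  proof -
    have "wfun x > 0 \<or> wfun x < 1 / real n" for x :: "'a pt"
      using assms(2) by (smt (verit) divide_pos_pos of_nat_0_less_iff)
    then show ?thesis by auto
  qed
  then show ?thesis
    using Ck_on_Un[OF open_wfun_pos op 1 2] by (auto simp: smooth_on_def)
qed

section \<open>Integrals of directional derivatives over Euclidean space\<close>

lemma lborel_integral_translation:
  fixes f :: "'a::euclidean_space \<Rightarrow> real"
  assumes [measurable]: "f \<in> borel_measurable borel"
  shows "(\<integral>x. f (c + x) \<partial>lborel) = (\<integral>x. f x \<partial>lborel)"
    and "integrable lborel (\<lambda>x. f (c + x)) \<longleftrightarrow> integrable lborel f"
proof -
  have "(\<integral>x. f x \<partial>distr lborel borel ((+) c)) = (\<integral>x. f (c + x) \<partial>lborel)"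
    by (rule integral_distr) auto
  then show "(\<integral>x. f (c + x) \<partial>lborel) = (\<integral>x. f x \<partial>lborel)"
    by (simp add: lborel_distr_plus)
  have "integrable (distr lborel borel ((+) c)) f \<longleftrightarrow> integrable lborel (\<lambda>x. f (c + x))"
    by (rule integrable_distr_eq) auto
  then show "integrable lborel (\<lambda>x. f (c + x)) \<longleftrightarrow> integrable lborel f"
    by (simp add: lborel_distr_plus)
qed

text \<open>The difference quotients of \<open>h\<close> integrate to zero because Lebesgue measure is translation
  invariant, and they converge boundedly to the directional derivative.\<close>

lemma integral_directional_derivative_zero:
  fixes h :: "'a::euclidean_space \<Rightarrow> real"
  assumes "open U" "compact K" "K \<subseteq> U" and h0: "\<And>x. x \<notin> K \<Longrightarrow> h x = 0"
    and D: "\<And>x. x \<in> U \<Longrightarrow> (h has_derivative D x) (at x)"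
    and cont: "continuous_on U (\<lambda>x. D x b)"
  shows "(\<integral>x. indicator U x * D x b \<partial>lborel) = 0" "integrable lborel (\<lambda>x. indicator U x * D x b)"
proof -
  define d where "d x = indicator U x * D x b" for x
  have opK: "open (- K)" using assms(2) compact_imp_closed by blast
  have K0: "(h has_derivative (\<lambda>_. 0)) (at x)" if "x \<notin> K" for x
  proof -
    have "((\<lambda>_. 0::real) has_derivative (\<lambda>_. 0)) (at x)" by simp
    then show ?thesis
      by (rule has_derivative_transform_within_open[OF _ opK]) (use that h0 in auto)
  qed
  have d0: "d x = 0" if "x \<notin> K" for x
    using has_derivative_unique[OF K0[OF that] D] by (cases "x \<in> U") (auto simp: d_def fun_eq_iff)
  have diffb: "h differentiable (at x)" for x
    using K0[of x] D[of x] assms(3) by (cases "x \<in> K") (auto simp: differentiable_def)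
  have hd: "((\<lambda>t. h (x + t *\<^sub>R b)) has_real_derivative d (x + t *\<^sub>R b)) (at t)" for x t
  proof -
    obtain E where E: "(h has_derivative E) (at (x + t *\<^sub>R b))" "E b = d (x + t *\<^sub>R b)"
      using K0[of "x + t *\<^sub>R b"] D[of "x + t *\<^sub>R b"] d0[of "x + t *\<^sub>R b"] assms(3)
      by (cases "x + t *\<^sub>R b \<in> K") (auto simp: d_def)
    have a: "((\<lambda>t. x + t *\<^sub>R b) has_derivative (\<lambda>s. s *\<^sub>R b)) (at t)"
      by (auto intro!: derivative_eq_intros)
    have "((\<lambda>t. h (x + t *\<^sub>R b)) has_derivative (\<lambda>s. E (s *\<^sub>R b))) (at t)"
      by (rule has_derivative_compose[OF a E(1)])
    moreover have "linear E" using E(1) has_derivative_linear by blast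
    then have "(\<lambda>s. E (s *\<^sub>R b)) = (\<lambda>s. d (x + t *\<^sub>R b) * s)"
      using E(2) by (auto simp: linear_cmul)
    ultimately show ?thesis unfolding has_field_derivative_def by simp
  qed
  have conth: "continuous_on UNIV h"
    using diffb by (simp add: continuous_at_imp_continuous_on differentiable_imp_continuous_within)
  then have [measurable]: "h \<in> borel_measurable borel" by (rule borel_measurable_continuous_onI)
  obtain C where C: "\<And>x. \<bar>d x\<bar> \<le> C" "C \<ge> 0"
  proof -
    have "continuous_on K d"
      by (rule continuous_on_eq[OF continuous_on_subset[OF cont assms(3)]])
        (use assms(3) in \<open>auto simp: d_def\<close>)
    then have "bounded (d ` K)" using assms(2) compact_continuous_image compact_imp_bounded by blast
    then obtain C where "\<forall>x\<in>K. \<bar>d x\<bar> \<le> C" by (auto simp: bounded_iff)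
    then have "\<bar>d x\<bar> \<le> max C 0" for x using d0[of x] by (cases "x \<in> K") auto
    then show ?thesis using that[of "max C 0"] by simp
  qed
  obtain R where R: "K \<subseteq> cball 0 R"
    using compact_imp_bounded[OF assms(2)] by (auto simp: bounded_iff subset_iff)
  define q where "q n x = (h (x + (1 / real (Suc n)) *\<^sub>R b) - h x) * real (Suc n)" for n x
  have [measurable]: "q n \<in> borel_measurable borel" for n unfolding q_def by measurable
  have inth: "integrable lborel h"
  proof -
    have "integrable lborel (\<lambda>x. indicator K x *\<^sub>R h x)"
      by (rule borel_integrable_compact[OF assms(2)]) (use conth continuous_on_subset in blast)
    moreover have "(\<lambda>x. indicator K x *\<^sub>R h x) = h" using h0 by (auto simp: indicator_def fun_eq_iff of_bool_def)
    ultimately show ?thesis by simp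
  qed
  have intq: "(\<integral>x. q n x \<partial>lborel) = 0" for n
  proof -
    have "integrable lborel (\<lambda>x. h (x + (1 / real (Suc n)) *\<^sub>R b))"
      using inth lborel_integral_translation(2)[of h "(1 / real (Suc n)) *\<^sub>R b"] by (simp add: add.commute)
    moreover have "(\<integral>x. h (x + (1 / real (Suc n)) *\<^sub>R b) \<partial>lborel) = (\<integral>x. h x \<partial>lborel)"
      using lborel_integral_translation(1)[of h "(1 / real (Suc n)) *\<^sub>R b"] by (simp add: add.commute)
    ultimately show ?thesis unfolding q_def using inth by simp
  qed
  \<comment> \<open>The mean value theorem bounds the quotients by the supremum of the derivative.
    The radius is enlarged by \<open>norm b\<close> so that the ball contains every point whose
    translate by \<open>b / (n + 1)\<close> falls into \<open>K\<close>.\<close>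
  have qb: "\<bar>q n x\<bar> \<le> C * indicator (cball 0 (R + norm b)) x" for n x
  proof (cases "x \<in> cball 0 (R + norm b)")
    case True
    have "\<exists>t. 0 < t \<and> t < 1 / real (Suc n) \<and>
       h (x + (1 / real (Suc n)) *\<^sub>R b) - h (x + 0 *\<^sub>R b) = (1 / real (Suc n) - 0) * d (x + t *\<^sub>R b)"
      by (rule MVT2) (use hd in auto)
    then obtain t where "q n x = d (x + t *\<^sub>R b)" by (auto simp: q_def)
    then show ?thesis using C True by simp
  next
    case False
    then have far: "norm x > R + norm b" by simp
    have "norm ((1 / real (Suc n)) *\<^sub>R b) \<le> norm b"
      by (simp add: divide_le_eq mult_le_cancel_left1)
    then have "norm (x + (1 / real (Suc n)) *\<^sub>R b) > R"
      using far norm_diff_ineq[of x "(1 / real (Suc n)) *\<^sub>R b"] by linarith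
    moreover have "norm x > R" using far norm_ge_zero[of b] by linarith
    ultimately have "h (x + (1 / real (Suc n)) *\<^sub>R b) = 0" "h x = 0"
      using R by (auto intro!: h0)
    then show ?thesis using C by (simp add: q_def)
  qed
  have lim: "(\<lambda>n. q n x) \<longlonglongrightarrow> d x" for x
  proof -
    have "((\<lambda>t. (h (x + t *\<^sub>R b) - h (x + 0 *\<^sub>R b)) / (t - 0)) \<longlongrightarrow> d (x + 0 *\<^sub>R b)) (at 0)"
      using hd[of x 0] unfolding has_field_derivative_iff by simp
    moreover have "filterlim (\<lambda>n. 1 / real (Suc n)) (at 0) sequentially"
      unfolding filterlim_at using LIMSEQ_inverse_real_of_nat by (simp add: inverse_eq_divide)
    ultimately have "(\<lambda>n. (h (x + (1 / real (Suc n)) *\<^sub>R b) - h (x + 0 *\<^sub>R b)) / (1 / real (Suc n) - 0)) \<longlonglongrightarrow> d (x + 0 *\<^sub>R b)"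
      by (rule filterlim_compose)
    then show ?thesis by (simp add: q_def field_simps)
  qed
  have [measurable]: "d \<in> borel_measurable lborel"
    by (rule borel_measurable_LIMSEQ_real[OF lim]) measurable
  have "integrable lborel (indicat_real (cball (0::'a) (R + norm b)))"
    by (intro integrable_real_indicator emeasure_bounded_finite) simp_all
  then have "integrable lborel (\<lambda>x::'a. C * indicator (cball 0 (R + norm b)) x)"
    by (rule integrable_mult_right)
  from this have "(\<lambda>n. \<integral>x. q n x \<partial>lborel) \<longlonglongrightarrow> (\<integral>x. d x \<partial>lborel)"
    by (rule integral_dominated_convergence[rotated 2]) (use lim qb in auto)
  then have "(\<lambda>n. 0::real) \<longlonglongrightarrow> (\<integral>x. d x \<partial>lborel)" by (simp only: intq)
  then have "(\<integral>x. d x \<partial>lborel) = 0" using LIMSEQ_unique tendsto_const by blast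
  then show "(\<integral>x. indicator U x * D x b \<partial>lborel) = 0" by (simp only: d_def)
  have "\<bar>d x\<bar> \<le> C * indicator (cball 0 (R + norm b)) x" for x
  proof (cases "x \<in> K")
    case True
    then have "norm x \<le> R" using R by (auto simp: subset_iff)
    then have "x \<in> cball 0 (R + norm b)" by (simp add: add_increasing2)
    then show ?thesis using C by simp
  qed (use C d0 in auto)
  then have "integrable lborel d"
    by (intro Bochner_Integration.integrable_bound[OF \<open>integrable lborel (\<lambda>x::'a. C * indicator (cball 0 (R + norm b)) x)\<close>])
      (auto intro!: AE_I2 order_trans[OF _ abs_ge_self] simp del: abs_mult)
  then show "integrable lborel (\<lambda>x. indicator U x * D x b)" unfolding d_def[abs_def] .
qed

subsection \<open>The weighted measure in the ball\<close>

definition half_ball :: "'m::finite pt set" where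
  "half_ball = {x. norm x < 1 \<and> snd (snd x) > 0}"

text \<open>The factor \<open>DIM('m pt)\<close> comes from \<open>sphere_measure\<close>; the rest
  is the extension of y^(1-2s) from the sphere by homogeneity of degree zero.\<close>

definition ball_weight :: "real \<Rightarrow> 'm::finite pt \<Rightarrow> real" where
  "ball_weight s x = real DIM('m pt) * (snd (snd x) / norm x) powr (1 - 2 * s)"

lemma measurable_snd_snd [measurable]:
  fixes f :: "'a \<Rightarrow> 'm::finite pt"
  assumes "f \<in> borel_measurable M"
  shows "(\<lambda>x. snd (snd (f x))) \<in> borel_measurable M" "(\<lambda>x. fst (snd (f x))) \<in> borel_measurable M"
    "(\<lambda>x. snd (f x)) \<in> borel_measurable M" "(\<lambda>x. fst (f x)) \<in> borel_measurable M"
  by (rule borel_measurable_continuous_on[OF _ assms]; intro continuous_intros)+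

lemma sets_half_ball [measurable]: "half_ball \<in> sets borel"
  unfolding half_ball_def
  by (intro borel_open open_Collect_conj open_Collect_less continuous_intros)

lemma hemi_borel [measurable]: "hemi \<in> sets borel"
proof -
  have "hemi = sphere 0 1 \<inter> {x::'a pt. snd (snd x) > 0}" by (auto simp: hemi_def)
  moreover have "open {x::'a pt. snd (snd x) > 0}"
    by (intro open_Collect_less continuous_intros)
  ultimately show ?thesis by (metis sets.Int borel_closed borel_open closed_sphere)
qed

lemma ball_weight_measurable [measurable]: "ball_weight s \<in> borel_measurable borel"
  unfolding ball_weight_def[abs_def] by measurable

lemma ball_weight_nonneg: "0 \<le> ball_weight s x"
  by (simp add: ball_weight_def)

lemma space_weighted [simp]: "space (weighted_measure s) = hemi"
  by (simp add: weighted_measure_def space_restrict_space sphere_measure_def space_scale_measure)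

lemma sets_weighted: "sets (weighted_measure s) = sets (restrict_space borel hemi)"
proof -
  have "sets (sphere_measure :: 'a pt measure) = sets borel" by (simp add: sphere_measure_def)
  then show ?thesis by (simp add: weighted_measure_def cong: sets_restrict_space_cong)
qed

lemma measurable_weighted: "f \<in> borel_measurable (weighted_measure s) \<longleftrightarrow> f \<in> borel_measurable (restrict_space borel hemi)"
  by (rule measurable_cong_sets[THEN eq_reflection, THEN meta_eq_to_obj_eq, THEN eqset_imp_iff]) (simp_all add: sets_weighted)

lemma radial_measurable [measurable]: "(\<lambda>x::'a::euclidean_space. x /\<^sub>R norm x) \<in> borel_measurable borel"
  by measurable

lemma radial_hemi: "snd (snd x) > 0 \<Longrightarrow> x /\<^sub>R norm x \<in> hemi"
  by (cases "x = 0") (auto simp: hemi_def zero_less_mult_iff)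

lemma radial_snd: "snd (snd (x /\<^sub>R norm x)) = snd (snd x) / norm x"
  by (simp add: divide_inverse mult.commute)

lemma radial_measurable_half_ball:
  "(\<lambda>x. x /\<^sub>R norm x) \<in> restrict_space lborel half_ball \<rightarrow>\<^sub>M weighted_measure s"
proof -
  have "(\<lambda>x. x /\<^sub>R norm x) \<in> restrict_space lborel half_ball \<rightarrow>\<^sub>M restrict_space borel hemi"
  proof (rule measurable_restrict_space2)
    show "(\<lambda>x. x /\<^sub>R norm x) \<in> space (restrict_space lborel half_ball) \<rightarrow> hemi"
      by (auto simp: space_restrict_space half_ball_def intro: radial_hemi)
    show "(\<lambda>x. x /\<^sub>R norm x) \<in> borel_measurable (restrict_space lborel half_ball)"
      by (rule measurable_restrict_space1) simp
  qed
  then show ?thesis using measurable_cong_sets[OF refl sets_weighted] by blast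
qed

text \<open>This is the bridge from the sphere to Lebesgue measure: a density on an image measure is
  the image of the density pulled back along the projection, and x / |x| lies in the open
  half-sphere exactly when y > 0.\<close>

lemma weighted_measure_eq:
  "weighted_measure s =
    distr (density (restrict_space lborel half_ball) (\<lambda>x. ennreal (ball_weight s x))) (weighted_measure s)
      (\<lambda>x::'m::finite pt. x /\<^sub>R norm x)"
proof (rule measure_eqI)
  fix A :: "'m pt set" assume A: "A \<in> sets (weighted_measure s)"
  then have Ah: "A \<subseteq> hemi" using sets.sets_into_space by force
  have Ab [measurable]: "A \<in> sets borel"
    using A by (auto simp: sets_weighted sets_restrict_space_iff)
  let ?w = "\<lambda>\<theta>::'m pt. ennreal (snd (snd \<theta>) powr (1 - 2 * s))"
  let ?S = "sphere_measure :: 'm pt measure"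
  have sS: "sets ?S = sets borel" by (simp add: sphere_measure_def)
  have wS: "?w \<in> borel_measurable (restrict_space ?S hemi)"
    by (rule measurable_restrict_space1) (simp add: measurable_cong_sets[OF sS refl])
  define F where "F \<theta> = ?w \<theta> * indicator A \<theta>" for \<theta>
  have wA: "F \<in> borel_measurable borel" unfolding F_def by measurable
  have gm: "(\<lambda>x. F (x /\<^sub>R norm x) * indicator (ball 0 1) x) \<in> borel_measurable lborel"
    using measurable_compose[OF radial_measurable wA] by (auto intro!: borel_measurable_times_ennreal borel_measurable_indicator)
  have A': "A \<in> sets (restrict_space ?S hemi)"
    using A unfolding weighted_measure_def by simp
  have hS: "hemi \<inter> space ?S \<in> sets ?S" using sS by (simp add: sphere_measure_def space_scale_measure)
  have "emeasure (weighted_measure s) A = (\<integral>\<^sup>+\<theta>. F \<theta> \<partial>restrict_space ?S hemi)"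
    unfolding weighted_measure_def F_def by (rule emeasure_density[OF wS A'])
  also have "\<dots> = (\<integral>\<^sup>+\<theta>. F \<theta> * indicator hemi \<theta> \<partial>?S)"
    by (rule nn_integral_restrict_space[OF hS])
  also have "\<dots> = (\<integral>\<^sup>+\<theta>. F \<theta> \<partial>?S)"
    by (rule nn_integral_cong) (use Ah in \<open>auto simp: indicator_def F_def\<close>)
  also have "\<dots> = of_nat DIM('m pt) * (\<integral>\<^sup>+\<theta>. F \<theta>
      \<partial>distr (restrict_space lborel (ball 0 1)) borel (\<lambda>x. x /\<^sub>R norm x))"
    unfolding sphere_measure_def by (rule nn_integral_scale_measure) (use wA in simp)
  also have "(\<integral>\<^sup>+\<theta>. F \<theta> \<partial>distr (restrict_space lborel (ball 0 1)) borel (\<lambda>x. x /\<^sub>R norm x)) =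
      (\<integral>\<^sup>+x. F (x /\<^sub>R norm x) \<partial>restrict_space lborel (ball 0 1))"
    by (rule nn_integral_distr) (use wA in \<open>simp_all add: measurable_restrict_space1\<close>)
  also have "\<dots> = (\<integral>\<^sup>+x. F (x /\<^sub>R norm x) * indicator (ball 0 1) x \<partial>lborel)"
    by (rule nn_integral_restrict_space) auto
  also have "of_nat DIM('m pt) * \<dots> = (\<integral>\<^sup>+x. of_nat DIM('m pt) * (F (x /\<^sub>R norm x) * indicator (ball 0 1) x) \<partial>lborel)"
    by (rule nn_integral_cmult[symmetric, OF gm])
  also have "\<dots> = (\<integral>\<^sup>+x. (ennreal (ball_weight s x) * indicator A (x /\<^sub>R norm x)) * indicator half_ball x \<partial>lborel)"
  proof (rule nn_integral_cong)
    fix x :: "'m pt"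
    have "ennreal (ball_weight s x) = of_nat DIM('m pt) * ?w (x /\<^sub>R norm x)"
      unfolding ball_weight_def radial_snd by (simp add: ennreal_mult ennreal_of_nat_eq_real_of_nat)
    moreover have "x /\<^sub>R norm x \<in> A \<Longrightarrow> snd (snd x) > 0"
    proof -
      assume "x /\<^sub>R norm x \<in> A"
      then have "snd (snd x) / norm x > 0" using Ah radial_snd[of x] by (auto simp: hemi_def)
      then show ?thesis using norm_ge_zero[of x] by (simp add: zero_less_divide_iff)
    qed
    ultimately show "of_nat DIM('m pt) * (F (x /\<^sub>R norm x) * indicator (ball 0 1) x) =
        (ennreal (ball_weight s x) * indicator A (x /\<^sub>R norm x)) * indicator half_ball x"
      by (auto simp: indicator_def half_ball_def F_def)
  qed
  also have "\<dots> = (\<integral>\<^sup>+x. ennreal (ball_weight s x) * indicator A (x /\<^sub>R norm x) \<partial>restrict_space lborel half_ball)"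
    by (subst nn_integral_restrict_space) auto
  also have "\<dots> = (\<integral>\<^sup>+x. indicator A (x /\<^sub>R norm x) \<partial>density (restrict_space lborel half_ball) (\<lambda>x. ennreal (ball_weight s x)))"
    by (subst nn_integral_density) (auto intro!: measurable_restrict_space1)
  also have "\<dots> = (\<integral>\<^sup>+\<theta>. indicator A \<theta> \<partial>distr (density (restrict_space lborel half_ball) (\<lambda>x. ennreal (ball_weight s x)))
      (weighted_measure s) (\<lambda>x. x /\<^sub>R norm x))"
    by (subst nn_integral_distr)
      (use A radial_measurable_half_ball measurable_density_eq1 in \<open>auto intro!: borel_measurable_indicator\<close>)
  also have "\<dots> = emeasure (distr (density (restrict_space lborel half_ball) (\<lambda>x. ennreal (ball_weight s x)))
      (weighted_measure s) (\<lambda>x. x /\<^sub>R norm x)) A"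
    by (rule nn_integral_indicator) (use A in simp)
  finally show "emeasure (weighted_measure s) A = \<dots>" .
qed simp

lemma radial_measurable_density:
  "(\<lambda>x. x /\<^sub>R norm x) \<in> density (restrict_space lborel half_ball) (\<lambda>x. ennreal (ball_weight s x)) \<rightarrow>\<^sub>M weighted_measure s"
  using radial_measurable_half_ball by (simp add: measurable_def)

lemma nn_integral_weighted:
  assumes f: "f \<in> borel_measurable (weighted_measure s)"
  shows "(\<integral>\<^sup>+\<theta>. f \<theta> \<partial>weighted_measure s) =
    (\<integral>\<^sup>+x. ennreal (ball_weight s x) * f (x /\<^sub>R norm x) * indicator half_ball x \<partial>lborel)"
proof -
  have m: "(\<lambda>x. f (x /\<^sub>R norm x)) \<in> borel_measurable (restrict_space lborel half_ball)"
    by (rule measurable_compose[OF radial_measurable_half_ball f])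
  have "(\<integral>\<^sup>+\<theta>. f \<theta> \<partial>weighted_measure s) =
    (\<integral>\<^sup>+x. f (x /\<^sub>R norm x) \<partial>density (restrict_space lborel half_ball) (\<lambda>x. ennreal (ball_weight s x)))"
    by (subst weighted_measure_eq, subst nn_integral_distr[OF radial_measurable_density]) (simp_all add: f)
  also have "\<dots> = (\<integral>\<^sup>+x. ennreal (ball_weight s x) * f (x /\<^sub>R norm x) \<partial>restrict_space lborel half_ball)"
    by (rule nn_integral_density) (auto intro!: measurable_restrict_space1 m)
  also have "\<dots> = (\<integral>\<^sup>+x. ennreal (ball_weight s x) * f (x /\<^sub>R norm x) * indicator half_ball x \<partial>lborel)"
    by (subst nn_integral_restrict_space) auto
  finally show ?thesis .
qed

lemma integral_weighted:
  fixes f :: "'m::finite pt \<Rightarrow> real"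
  assumes f: "f \<in> borel_measurable (weighted_measure s)"
  shows "(\<integral>\<theta>. f \<theta> \<partial>weighted_measure s) =
      (\<integral>x. indicator half_ball x * (ball_weight s x * f (x /\<^sub>R norm x)) \<partial>lborel)" (is ?A)
    and "integrable (weighted_measure s) f \<longleftrightarrow>
      integrable lborel (\<lambda>x. indicator half_ball x * (ball_weight s x * f (x /\<^sub>R norm x)))" (is ?B)
proof -
  have m: "(\<lambda>x. f (x /\<^sub>R norm x)) \<in> borel_measurable (restrict_space lborel half_ball)"
    by (rule measurable_compose[OF radial_measurable_half_ball f])
  have b: "ball_weight s \<in> borel_measurable (restrict_space lborel half_ball)"
    by (auto intro!: measurable_restrict_space1)
  have "(\<integral>\<theta>. f \<theta> \<partial>weighted_measure s) =
    (\<integral>x. f (x /\<^sub>R norm x) \<partial>density (restrict_space lborel half_ball) (\<lambda>x. ennreal (ball_weight s x)))"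
    by (subst weighted_measure_eq, subst integral_distr[OF radial_measurable_density]) (simp_all add: f)
  also have "\<dots> = (\<integral>x. ball_weight s x *\<^sub>R f (x /\<^sub>R norm x) \<partial>restrict_space lborel half_ball)"
    by (rule integral_density[OF m b]) (simp add: ball_weight_nonneg)
  also have "\<dots> = (\<integral>x. indicator half_ball x *\<^sub>R (ball_weight s x *\<^sub>R f (x /\<^sub>R norm x)) \<partial>lborel)"
    by (rule integral_restrict_space) auto
  finally show ?A by simp
  have "integrable (weighted_measure s) f \<longleftrightarrow>
    integrable (density (restrict_space lborel half_ball) (\<lambda>x. ennreal (ball_weight s x))) (\<lambda>x. f (x /\<^sub>R norm x))"
    by (subst weighted_measure_eq, subst integrable_distr_eq[OF radial_measurable_density]) (simp_all add: f)
  also have "\<dots> \<longleftrightarrow> integrable (restrict_space lborel half_ball) (\<lambda>x. ball_weight s x *\<^sub>R f (x /\<^sub>R norm x))"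
    by (rule integrable_density[OF m b]) (simp add: ball_weight_nonneg)
  also have "\<dots> \<longleftrightarrow> integrable lborel (\<lambda>x. indicator half_ball x *\<^sub>R (ball_weight s x *\<^sub>R f (x /\<^sub>R norm x)))"
    by (rule integrable_restrict_space) auto
  finally show ?B by simp
qed

subsection \<open>Integrability of the singular weights\<close>

text \<open>Since \<open>0 powr - p\<close> is 0 in HOL, the value at the origin is set by hand; a
  single point does not change the integral. The absolute value serves the variable t, which takes
  both signs.\<close>

definition sing :: "real \<Rightarrow> real \<Rightarrow> ennreal" where
  "sing p t = (if t = 0 then \<infinity> else ennreal (\<bar>t\<bar> powr - p)) * indicator {-1..1} t"

lemma sing_measurable [measurable]: "sing p \<in> borel_measurable borel"
  unfolding sing_def[abs_def] by measurable

lemma nn_integral_sing: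
  assumes "p < 1" shows "(\<integral>\<^sup>+t. sing p t \<partial>lborel) < \<infinity>"
proof -
  let ?k = "\<lambda>t. ennreal (t powr - p) * indicator {0..1} t"
  have k: "(\<integral>\<^sup>+t. ?k t \<partial>lborel) = ennreal (1 powr (- p + 1) / (- p + 1))"
    by (rule nn_integral_has_integral_lebesgue'[OF _ has_integral_powr_from_0]) (use assms in auto)
  have k': "(\<integral>\<^sup>+t. ?k t \<partial>lborel) = (\<integral>\<^sup>+t. ?k (- t) \<partial>lborel)"
    using nn_integral_real_affine[of ?k "-1" 0] by simp
  have "AE t in lborel. t \<noteq> (0::real)" by (rule AE_lborel_singleton)
  then have "AE t in lborel. sing p t \<le> ?k t + ?k (- t)"
    by eventually_elim (auto simp: sing_def indicator_def abs_real_def)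
  then have "(\<integral>\<^sup>+t. sing p t \<partial>lborel) \<le> (\<integral>\<^sup>+t. ?k t + ?k (- t) \<partial>lborel)"
    by (rule nn_integral_mono_AE)
  also have "\<dots> = (\<integral>\<^sup>+t. ?k t \<partial>lborel) + (\<integral>\<^sup>+t. ?k (- t) \<partial>lborel)"
    by (rule nn_integral_add) auto
  also have "\<dots> < \<infinity>" using k by (simp add: k'[symmetric])
  finally show ?thesis .
qed

lemma fst_snd_borel:
  "(fst :: 'a::second_countable_topology \<times> 'b::second_countable_topology \<Rightarrow> 'a) \<in> borel_measurable borel"
  "(snd :: 'a \<times> 'b \<Rightarrow> 'b) \<in> borel_measurable borel"
  by (intro borel_measurable_continuous_onI continuous_intros)+

lemma sing_pair_measurable: "(\<lambda>z. sing q (fst z) * sing p (snd z)) \<in> borel_measurable borel"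
  by (intro borel_measurable_times_ennreal measurable_compose[OF fst_snd_borel(1) sing_measurable]
     measurable_compose[OF fst_snd_borel(2) sing_measurable])

lemma sing_triple_measurable:
  "(\<lambda>x. indicator (cball 0 1) (fst x) * (sing q (fst (snd x)) * sing p (snd (snd x)))) 
    \<in> borel_measurable (borel :: 'm::finite pt measure)"
  by (intro borel_measurable_times_ennreal measurable_compose[OF fst_snd_borel(1) borel_measurable_indicator]
    measurable_compose[OF fst_snd_borel(2) sing_pair_measurable] 
     measurable_compose[OF measurable_compose[OF fst_snd_borel(2) fst_snd_borel(1)] sing_measurable]
     measurable_compose[OF measurable_compose[OF fst_snd_borel(2) fst_snd_borel(2)] sing_measurable]) simp

lemma nn_integral_sing_product:
  assumes "p < 1" "q < 1"
  shows "(\<integral>\<^sup>+x. indicator (cball 0 1) (fst x) * (sing q (fst (snd x)) * sing p (snd (snd x)))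
    \<partial>(lborel :: 'm::finite pt measure)) < \<infinity>"
proof -
  let ?g = "\<lambda>z. sing q (fst z) * sing p (snd z)"
  have g [measurable]: "?g \<in> borel_measurable (lborel \<Otimes>\<^sub>M lborel)" by measurable
  have "(\<integral>\<^sup>+z. ?g z \<partial>(lborel \<Otimes>\<^sub>M lborel)) = (\<integral>\<^sup>+t. \<integral>\<^sup>+y. sing q t * sing p y \<partial>lborel \<partial>lborel)"
    by (subst lborel.nn_integral_fst[symmetric]) auto
  also have "\<dots> = (\<integral>\<^sup>+t. sing q t \<partial>lborel) * (\<integral>\<^sup>+y. sing p y \<partial>lborel)"
    by (simp add: nn_integral_cmult nn_integral_multc)
  finally have G: "(\<integral>\<^sup>+z. ?g z \<partial>lborel) < \<infinity>"
    using nn_integral_sing[OF assms(1)] nn_integral_sing[OF assms(2)]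
    by (simp add: lborel_prod ennreal_mult_less_top less_top)
  let ?c = "\<lambda>u::real^'m. indicator (cball 0 1) u :: ennreal"
  have gl: "?g \<in> borel_measurable lborel" using sing_pair_measurable by simp
  have cl: "(\<lambda>x. ?c (fst x) * ?g (snd x)) \<in> borel_measurable borel" by (rule sing_triple_measurable)
  have "(\<integral>\<^sup>+x. ?c (fst x) * ?g (snd x) \<partial>(lborel \<Otimes>\<^sub>M lborel)) = (\<integral>\<^sup>+u. \<integral>\<^sup>+z. ?c u * ?g z \<partial>lborel \<partial>lborel)"
    by (subst lborel.nn_integral_fst[symmetric]) (use cl in \<open>simp_all add: lborel_prod\<close>)
  also have "\<dots> = (\<integral>\<^sup>+u. ?c u * (\<integral>\<^sup>+z. ?g z \<partial>lborel) \<partial>lborel)"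
    by (intro nn_integral_cong nn_integral_cmult gl)
  also have "\<dots> = (\<integral>\<^sup>+u. ?c u \<partial>lborel) * (\<integral>\<^sup>+z. ?g z \<partial>lborel)"
    by (rule nn_integral_multc) (simp add: borel_measurable_indicator)
  also have "\<dots> < \<infinity>"
    using G emeasure_bounded_finite[of "cball (0::real^'m) 1"] by (simp add: ennreal_mult_less_top less_top)
  finally show ?thesis by (simp add: lborel_prod)
qed

text \<open>The weight \<open>y\<^sup>1\<^sup>-\<^sup>2\<^sup>s w\<^sup>2\<^sup>s\<^sup>-\<^sup>1 / r\<close>, with \<open>y\<^sup>2 = w (r + t)\<close>, is at most a product of two
  integrable powers since \<open>r \<ge> \<surd>(y |t|)\<close>.\<close>

lemma wfun_product: "wfun x * (norm (snd x) + fst (snd x)) = (snd (snd x))\<^sup>2"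
proof -
  have "(norm (snd x))\<^sup>2 = (fst (snd x))\<^sup>2 + (snd (snd x))\<^sup>2"
    by (simp add: norm_prod_def power2_eq_square real_sqrt_mult)
  then show ?thesis by (simp add: wfun_def algebra_simps power2_eq_square)
qed

lemma abs_fst_snd_le: "\<bar>fst (snd x)\<bar> \<le> norm (snd x)" for x :: "'m::finite pt"
  using norm_fst_le[of "fst (snd x)" "snd (snd x)"] by simp

lemma abs_snd_snd_le: "\<bar>snd (snd x)\<bar> \<le> norm (snd x)" for x :: "'m::finite pt"
  using norm_snd_le[of "snd (snd x)" "fst (snd x)"] by simp

lemma norm_components_le: "norm (fst x) \<le> norm x" "norm (snd x) \<le> norm x" for x :: "'m::finite pt"
  using norm_fst_le[of "fst x" "snd x"] norm_snd_le[of "snd x" "fst x"] by simp_all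

lemma wfun_nonneg: "0 \<le> wfun x" and wfun_le: "wfun x \<le> 2 * norm (snd x)"
  using abs_fst_snd_le[of x] by (auto simp: wfun_def abs_le_iff)

lemma wfun_pos: 
  assumes "snd (snd x) \<noteq> 0" shows "0 < wfun x"
  using wfun_product[of x] wfun_nonneg[of x] assms by (metis less_eq_real_def mult_zero_left zero_eq_power2)

text \<open>The sign of 2s - 1 decides the estimate. If it is nonnegative, w \<le> 2 r is used
  directly; otherwise w is rewritten as y^2 / v and v \<le> 2 r is used. What remains of r is a
  product of two equal negative powers, one compared with |t| and the other with y. The resulting
  exponents of |t| and y are -(1-s) and -s, in one order or the other, hence above -1.\<close>

lemma singular_bound:
  fixes r t y w v s :: real
  assumes y: "y > 0" and t: "t \<noteq> 0" and r: "r > 0" "\<bar>t\<bar> \<le> r" "y \<le> r"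
    and w: "0 < w" "w \<le> 2 * r" and v: "0 < v" "v \<le> 2 * r" "w * v = y\<^sup>2"
    and s: "0 < s" "s < 1"
  shows "y powr (1 - 2 * s) * (w powr (2 * s - 1) / r) \<le>
    (if s \<ge> 1 / 2 then 2 powr (2 * s - 1) * (\<bar>t\<bar> powr - (1 - s) * y powr - s)
     else 2 powr (1 - 2 * s) * (\<bar>t\<bar> powr - s * y powr - (1 - s)))"
proof (cases "s \<ge> 1 / 2")
  case True
  have "w powr (2 * s - 1) \<le> (2 * r) powr (2 * s - 1)"
    using w True by (intro powr_mono2) auto
  also have "\<dots> = 2 powr (2 * s - 1) * r powr (2 * s - 1)"
    using r by (simp add: powr_mult)
  finally have "w powr (2 * s - 1) / r \<le> 2 powr (2 * s - 1) * (r powr (2 * s - 1) / r)"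
    using r by (simp add: field_simps)
  also have "r powr (2 * s - 1) / r = r powr - (1 - s) * r powr - (1 - s)"
    using r powr_diff[of r "2 * s - 1" 1] by (simp add: powr_add[symmetric])
  also have "\<dots> \<le> \<bar>t\<bar> powr - (1 - s) * y powr - (1 - s)"
    using r y t s by (intro mult_mono powr_mono2') auto
  finally have "w powr (2 * s - 1) / r \<le> 2 powr (2 * s - 1) * (\<bar>t\<bar> powr - (1 - s) * y powr - (1 - s))"
    by simp
  then have "y powr (1 - 2 * s) * (w powr (2 * s - 1) / r) \<le>
     y powr (1 - 2 * s) * (2 powr (2 * s - 1) * (\<bar>t\<bar> powr - (1 - s) * y powr - (1 - s)))"
    by (intro mult_left_mono) auto
  also have "\<dots> = 2 powr (2 * s - 1) * (\<bar>t\<bar> powr - (1 - s) * (y powr (1 - 2 * s) * y powr - (1 - s)))"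
    by (simp add: mult_ac)
  also have "y powr (1 - 2 * s) * y powr - (1 - s) = y powr - s"
    using y by (simp add: powr_add[symmetric])
  finally show ?thesis using True by simp
next
  case False
  have "w = y\<^sup>2 / v" using v by (simp add: field_simps)
  then have "w powr (2 * s - 1) = (y\<^sup>2) powr (2 * s - 1) / v powr (2 * s - 1)"
    using y v by (simp add: powr_divide)
  also have "\<dots> = y powr (4 * s - 2) * v powr (1 - 2 * s)"
  proof -
    have "(y\<^sup>2) powr (2 * s - 1) = y powr (2 * (2 * s - 1))"
    proof -
      have "y\<^sup>2 = y powr 2" using y by simp
      then show ?thesis by (simp only: powr_powr)
    qed
    moreover have "v powr (1 - 2 * s) = 1 / v powr (2 * s - 1)"
      by (metis minus_diff_eq powr_minus_divide)
    ultimately show ?thesis by (simp add: algebra_simps)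
  qed
  also have "\<dots> \<le> y powr (4 * s - 2) * (2 * r) powr (1 - 2 * s)"
    using v False by (intro mult_left_mono powr_mono2) auto
  also have "\<dots> = y powr (4 * s - 2) * (2 powr (1 - 2 * s) * r powr (1 - 2 * s))"
    using r by (simp add: powr_mult)
  finally have "w powr (2 * s - 1) / r \<le> 2 powr (1 - 2 * s) * y powr (4 * s - 2) * (r powr (1 - 2 * s) / r)"
    using r by (simp add: field_simps)
  also have "r powr (1 - 2 * s) / r = r powr - s * r powr - s"
    using r powr_diff[of r "1 - 2 * s" 1] by (simp add: powr_add[symmetric])
  also have "2 powr (1 - 2 * s) * y powr (4 * s - 2) * (r powr - s * r powr - s) \<le>
    2 powr (1 - 2 * s) * y powr (4 * s - 2) * (\<bar>t\<bar> powr - s * y powr - s)"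
    using r y t s by (intro mult_left_mono mult_mono powr_mono2') auto
  finally have "y powr (1 - 2 * s) * (w powr (2 * s - 1) / r) \<le>
     y powr (1 - 2 * s) * (2 powr (1 - 2 * s) * y powr (4 * s - 2) * (\<bar>t\<bar> powr - s * y powr - s))"
    by (intro mult_left_mono) auto
  also have "\<dots> = 2 powr (1 - 2 * s) * (\<bar>t\<bar> powr - s * (y powr (1 - 2 * s) * y powr (4 * s - 2) * y powr - s))"
    by (simp add: mult_ac)
  also have "y powr (1 - 2 * s) * y powr (4 * s - 2) * y powr - s = y powr - (1 - s)"
    using y by (simp add: powr_add[symmetric])
  finally show ?thesis using False by simp
qed

lemma half_ball_integral_finite:
  fixes f :: "'m::finite pt \<Rightarrow> real"
  assumes "p < 1" "q < 1" "C \<ge> 0"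
    and f: "\<And>x. x \<in> half_ball \<Longrightarrow> fst (snd x) \<noteq> 0 \<Longrightarrow>
      f x \<le> C * (\<bar>fst (snd x)\<bar> powr - q * (snd (snd x)) powr - p)"
  shows "(\<integral>\<^sup>+x. ennreal (f x) * indicator half_ball x \<partial>lborel) < \<infinity>"
proof -
  let ?b = "\<lambda>x. indicator (cball 0 1) (fst x) * (sing q (fst (snd x)) * sing p (snd (snd x)))"
  have b [measurable]: "?b \<in> borel_measurable (borel :: 'm pt measure)" by (rule sing_triple_measurable)
  \<comment> \<open>The hypothesis says nothing on the hyperplane t = 0; an infinite term is allowed
    there because the hyperplane is a null set.\<close>
  have "ennreal (f x) * indicator half_ball x \<le> ennreal C * ?b x + (if fst (snd x) = 0 then \<infinity> else 0)"
    for x :: "'m pt"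
  proof (cases "x \<in> half_ball \<and> fst (snd x) \<noteq> 0")
    case True
    then have "norm (fst x) \<le> 1" "\<bar>fst (snd x)\<bar> \<le> 1" "\<bar>snd (snd x)\<bar> \<le> 1" "snd (snd x) > 0"
      using norm_components_le[of x] abs_fst_snd_le[of x] abs_snd_snd_le[of x] 
      by (auto simp: half_ball_def)
    then have "?b x = ennreal (\<bar>fst (snd x)\<bar> powr - q * (snd (snd x)) powr - p)"
      using True by (auto simp: sing_def ennreal_mult abs_le_iff)
    then show ?thesis
      using f[of x] True assms(3) by (auto simp: ennreal_mult[symmetric] intro!: ennreal_leI)
  qed (auto simp: indicator_def)
  then have "(\<integral>\<^sup>+x. ennreal (f x) * indicator half_ball x \<partial>lborel) \<le>
     (\<integral>\<^sup>+x. ennreal C * ?b x + (if fst (snd x) = 0 then \<infinity> else 0) \<partial>(lborel :: 'm pt measure))"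
    by (intro nn_integral_mono) auto
  also have "\<dots> = (\<integral>\<^sup>+x. ennreal C * ?b x \<partial>(lborel :: 'm pt measure))"
  proof (rule nn_integral_cong_AE)
    have "negligible {x::'m pt. (0, 1, 0) \<bullet> x = 0}"
      by (rule negligible_hyperplane) (auto simp: zero_prod_def)
    then have "{x::'m pt. (0, 1, 0) \<bullet> x = 0} \<in> null_sets lebesgue"
      by (simp add: negligible_iff_null_sets)
    moreover have "{x::'m pt. (0, 1, 0) \<bullet> x = 0} \<in> sets lborel"
      by (simp add: closed_hyperplane)
    ultimately have "AE x in lborel. (x::'m pt) \<notin> {x. (0, 1, 0) \<bullet> x = 0}"
      by (intro AE_not_in) (simp add: null_sets_completion_iff)
    then show "AE x::'m pt in lborel. ennreal C * ?b x + (if fst (snd x) = 0 then \<infinity> else 0) = ennreal C * ?b x"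
      by eventually_elim (auto simp: inner_prod_def)
  qed
  also have "\<dots> = ennreal C * (\<integral>\<^sup>+x. ?b x \<partial>(lborel :: 'm pt measure))"
    by (rule nn_integral_cmult) simp
  also have "\<dots> < \<infinity>"
    using nn_integral_sing_product[OF assms(1,2), where 'm = 'm]
    by (simp add: ennreal_mult_less_top less_top)
  finally show ?thesis .
qed

lemma norm_radial_pos: "x \<in> half_ball \<Longrightarrow> norm x > 0" for x :: "'m::finite pt"
  by (auto simp: half_ball_def)

text \<open>For s \<le> 1/2 the weight is bounded, as y \<le> |x|. For s > 1/2 it is at most
  y^(1-2s) in the unit ball, and 1 - 2s > -1.\<close>

lemma finite_weighted_measure:
  assumes "0 < s" "s < 1"
  shows "emeasure (weighted_measure s) (space (weighted_measure s :: 'm::finite pt measure)) < \<infinity>"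
proof -
  let ?M = "weighted_measure s :: 'm pt measure"
  have "emeasure ?M (space ?M) = (\<integral>\<^sup>+\<theta>. 1 \<partial>?M)" by simp
  also have "\<dots> = (\<integral>\<^sup>+x. ennreal (ball_weight s x) * 1 * indicator half_ball x \<partial>(lborel :: 'm pt measure))"
    by (rule nn_integral_weighted) simp
  also have "\<dots> = (\<integral>\<^sup>+x. ennreal (ball_weight s x) * indicator half_ball x \<partial>(lborel::'m pt measure))"
    by simp
  also have "\<dots> < \<infinity>"
  proof (rule half_ball_integral_finite[of "max 0 (2 * s - 1)" 0 "real DIM('m pt)"])
    fix x :: "'m pt" assume x: "x \<in> half_ball" "fst (snd x) \<noteq> 0"
    define y where "y = snd (snd x)"
    define n where "n = norm x"
    have yn: "0 < y" "0 < n" "n \<le> 1" "y \<le> n"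
      using x norm_radial_pos[of x] abs_snd_snd_le[of x] norm_components_le[of x]
      by (auto simp: y_def n_def half_ball_def)
    have "(y / n) powr (1 - 2 * s) \<le> y powr - max 0 (2 * s - 1)"
    proof (cases "2 * s \<le> 1")
      case True
      then show ?thesis using yn by (simp add: powr_le1 max_def)
    next
      case False
      have "(y / n) powr (1 - 2 * s) \<le> y powr (1 - 2 * s)"
        using False yn by (intro powr_mono2') (auto simp: field_simps)
      then show ?thesis using False by (simp add: max_def)
    qed
    then show "ball_weight s x \<le> real DIM('m pt) * (\<bar>fst (snd x)\<bar> powr - 0 * snd (snd x) powr - max 0 (2 * s - 1))"
      using x(2) by (simp add: ball_weight_def y_def n_def mult_left_mono)
  qed (use assms in auto)
  finally show ?thesis .
qed

lemma scale_coords: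
  fixes x :: "'m::finite pt"
  shows "norm (snd (c *\<^sub>R x)) = \<bar>c\<bar> * norm (snd x)"
    and "c \<ge> 0 \<Longrightarrow> wfun (c *\<^sub>R x) = c * wfun x"
  by (simp_all add: wfun_def algebra_simps)

text \<open>Because |grad w|^2 = 2 w / r, the integrand is, up to a constant, the squared gradient
  of w^s. Its finiteness is what places the explicit solutions in the energy space.\<close>

lemma singular_energy_finite:
  assumes s: "0 < s" "s < 1"
  shows "(\<integral>\<^sup>+\<theta>. ennreal (wfun \<theta> powr (2 * s - 1) / norm (snd \<theta>)) \<partial>(weighted_measure s :: 'm::finite pt measure)) < \<infinity>"
proof -
  let ?M = "weighted_measure s :: 'm pt measure"
  have [measurable]: "wfun \<in> borel_measurable (borel :: 'm pt measure)"
    unfolding wfun_def[abs_def] by measurable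
  have m: "(\<lambda>\<theta>. ennreal (wfun \<theta> powr (2 * s - 1) / norm (snd \<theta>))) \<in> borel_measurable ?M"
    unfolding measurable_weighted by (rule measurable_restrict_space1) measurable
  have "(\<integral>\<^sup>+\<theta>. ennreal (wfun \<theta> powr (2 * s - 1) / norm (snd \<theta>)) \<partial>?M) =
    (\<integral>\<^sup>+x. ennreal (ball_weight s x) * ennreal (wfun (x /\<^sub>R norm x) powr (2 * s - 1) / norm (snd (x /\<^sub>R norm x))) *
       indicator half_ball x \<partial>(lborel :: 'm pt measure))"
    by (rule nn_integral_weighted[OF m])
  also have "\<dots> = (\<integral>\<^sup>+x. ennreal (ball_weight s x * (wfun (x /\<^sub>R norm x) powr (2 * s - 1) / norm (snd (x /\<^sub>R norm x)))) *
       indicator half_ball x \<partial>(lborel :: 'm pt measure))"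
    by (intro nn_integral_cong arg_cong2[where f = "(*)"] refl ennreal_mult[symmetric]) (auto simp: ball_weight_nonneg)
  also have "\<dots> < \<infinity>"
  proof (rule half_ball_integral_finite[of "if s \<ge> 1/2 then s else 1 - s" "if s \<ge> 1/2 then 1 - s else s"
        "real DIM('m pt) * (2 powr \<bar>2 * s - 1\<bar>)"])
    fix x :: "'m pt" assume x: "x \<in> half_ball" "fst (snd x) \<noteq> 0"
    define y where "y = snd (snd x)"
    define n where "n = norm x"
    define r where "r = norm (snd x)"
    define t where "t = fst (snd x)"
    define w where "w = wfun x"
    have yn: "0 < y" "0 < n" "n \<le> 1" "y \<le> n" "t \<noteq> 0" "\<bar>t\<bar> \<le> r" "0 < r" "y \<le> r" "w > 0" "w \<le> 2 * r"
        "w * (r + t) = y\<^sup>2"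
      using x norm_radial_pos[of x] abs_snd_snd_le[of x] norm_components_le[of x] abs_fst_snd_le[of x] wfun_pos[of x]
        wfun_le[of x] wfun_product[of x]
      by (auto simp: y_def n_def t_def r_def w_def half_ball_def)
    have v: "r + t > 0" 
      using yn by (metis zero_less_mult_pos zero_less_power)
    have "ball_weight s x * (wfun (x /\<^sub>R norm x) powr (2 * s - 1) / norm (snd (x /\<^sub>R norm x))) =
       real DIM('m pt) * ((y / n) powr (1 - 2 * s) * ((w / n) powr (2 * s - 1) / (r / n)))"
      using yn by (simp add: ball_weight_def scale_coords y_def n_def r_def w_def divide_inverse mult.commute)
    \<comment> \<open>By homogeneity the powers of |x| from the weight and from w cancel; only the
      factor |x| \<le> 1 from r / |x| is left.\<close>
    also have "(y / n) powr (1 - 2 * s) * ((w / n) powr (2 * s - 1) / (r / n)) =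
        y powr (1 - 2 * s) * (w powr (2 * s - 1) / r) * (n / (n powr (1 - 2 * s) * n powr (2 * s - 1)))"
      using yn by (simp add: powr_divide field_simps)
    also have "n powr (1 - 2 * s) * n powr (2 * s - 1) = 1"
      using yn by (simp add: powr_add[symmetric])
    also have "y powr (1 - 2 * s) * (w powr (2 * s - 1) / r) * (n / 1) \<le> y powr (1 - 2 * s) * (w powr (2 * s - 1) / r)"
      by (rule mult_left_le) (use yn in auto)
    also have "\<dots> \<le> (if s \<ge> 1 / 2 then 2 powr (2 * s - 1) * (\<bar>t\<bar> powr - (1 - s) * y powr - s)
       else 2 powr (1 - 2 * s) * (\<bar>t\<bar> powr - s * y powr - (1 - s)))"
      by (rule singular_bound[where v = "r + t"]) (use yn v s in auto)
    also have "\<dots> = 2 powr \<bar>2 * s - 1\<bar> * (\<bar>t\<bar> powr - (if s \<ge> 1/2 then 1 - s else s) * y powr - (if s \<ge> 1/2 then s else 1 - s))"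
      by (auto simp: abs_real_def)
    finally show "ball_weight s x * (wfun (x /\<^sub>R norm x) powr (2 * s - 1) / norm (snd (x /\<^sub>R norm x))) \<le>
      real DIM('m pt) * 2 powr \<bar>2 * s - 1\<bar> * (\<bar>fst (snd x)\<bar> powr - (if s \<ge> 1/2 then 1 - s else s) *
        snd (snd x) powr - (if s \<ge> 1/2 then s else 1 - s))"
      by (simp add: mult_left_mono y_def t_def mult.assoc)
  qed (use s in auto)
  finally show ?thesis .
qed

subsection \<open>The weighted Laplacian\<close>

text \<open>\<open>has_wlap s f g q l\<close>: on the open set \<open>{w > 0}\<close>, which contains the half-space \<open>y > 0\<close>
  and the Neumann part \<open>y = 0, t < 0\<close> of its boundary, \<open>f\<close> is twice continuously differentiable
  with gradient \<open>g\<close>, \<open>\<partial>\<^sub>y f = y q\<close>, and \<open>l = \<Delta> f + (1 - 2 s) \<partial>\<^sub>y f / y\<close>.\<close>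

definition has_wlap :: "real \<Rightarrow> ('m::finite pt \<Rightarrow> real) \<Rightarrow> ('m pt \<Rightarrow> 'm pt) \<Rightarrow> ('m pt \<Rightarrow> real) \<Rightarrow> ('m pt \<Rightarrow> real) \<Rightarrow> bool"
  where "has_wlap s f g q l \<longleftrightarrow>
    (\<forall>x. wfun x > 0 \<longrightarrow> (f has_derivative (\<lambda>h. g x \<bullet> h)) (at x)) \<and>
    (\<forall>x. wfun x > 0 \<longrightarrow> snd (snd (g x)) = snd (snd x) * q x) \<and>
    continuous_on {x. wfun x > 0} q \<and>
    (\<exists>G. (\<forall>x. wfun x > 0 \<longrightarrow> (g has_derivative G x) (at x)) \<and>
         (\<forall>b. continuous_on {x. wfun x > 0} (\<lambda>x. G x b)) \<and>
         (\<forall>x. wfun x > 0 \<longrightarrow> l x = (\<Sum>b\<in>Basis. G x b \<bullet> b) + (1 - 2 * s) * q x))"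

lemma has_wlapE:
  assumes "has_wlap s f g q l"
  obtains G where "\<And>x. wfun x > 0 \<Longrightarrow> (f has_derivative (\<lambda>h. g x \<bullet> h)) (at x)"
    "\<And>x. wfun x > 0 \<Longrightarrow> snd (snd (g x)) = snd (snd x) * q x" "continuous_on {x. wfun x > 0} q"
    "\<And>x. wfun x > 0 \<Longrightarrow> (g has_derivative G x) (at x)"
    "\<And>b. continuous_on {x. wfun x > 0} (\<lambda>x. G x b)"
    "\<And>x. wfun x > 0 \<Longrightarrow> l x = (\<Sum>b\<in>Basis. G x b \<bullet> b) + (1 - 2 * s) * q x"
  using assms unfolding has_wlap_def by blast

lemma has_wlapI:
  assumes "\<And>x. wfun x > 0 \<Longrightarrow> (f has_derivative (\<lambda>h. g x \<bullet> h)) (at x)"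
    "\<And>x. wfun x > 0 \<Longrightarrow> snd (snd (g x)) = snd (snd x) * q x" "continuous_on {x. wfun x > 0} q"
    "\<And>x. wfun x > 0 \<Longrightarrow> (g has_derivative G x) (at x)"
    "\<And>b. continuous_on {x. wfun x > 0} (\<lambda>x. G x b)"
    "\<And>x. wfun x > 0 \<Longrightarrow> l x = (\<Sum>b\<in>Basis. G x b \<bullet> b) + (1 - 2 * s) * q x"
  shows "has_wlap s f g q l"
  using assms unfolding has_wlap_def by blast

lemma has_wlap_derivative:
  "has_wlap s f g q l \<Longrightarrow> wfun x > 0 \<Longrightarrow> (f has_derivative (\<lambda>h. g x \<bullet> h)) (at x)"
  unfolding has_wlap_def by blast

lemma has_wlap_continuous:
  assumes "has_wlap s f g q l"
  shows "continuous_on {x. wfun x > 0} f" "continuous_on {x. wfun x > 0} g" "continuous_on {x. wfun x > 0} q"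
proof -
  from assms obtain G where G: "\<And>x. wfun x > 0 \<Longrightarrow> (f has_derivative (\<lambda>h. g x \<bullet> h)) (at x)"
    "\<And>x. wfun x > 0 \<Longrightarrow> (g has_derivative G x) (at x)" "continuous_on {x. wfun x > 0} q"
    by (rule has_wlapE) blast
  show "continuous_on {x. wfun x > 0} f"
    by (intro continuous_at_imp_continuous_on ballI, rule has_derivative_continuous, rule G(1), simp)
  show "continuous_on {x. wfun x > 0} g"
    by (intro continuous_at_imp_continuous_on ballI, rule has_derivative_continuous, rule G(2), simp)
  show "continuous_on {x. wfun x > 0} q" by (rule G(3))
qed

lemma has_wlap_cong:
  assumes "has_wlap s f g q l"
    and eq: "\<And>x. wfun x > 0 \<Longrightarrow> f' x = f x" "\<And>x. wfun x > 0 \<Longrightarrow> g' x = g x"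
      "\<And>x. wfun x > 0 \<Longrightarrow> q' x = q x" "\<And>x. wfun x > 0 \<Longrightarrow> l' x = l x"
  shows "has_wlap s f' g' q' l'"
proof -
  from assms(1) obtain G where G: "\<And>x. wfun x > 0 \<Longrightarrow> (f has_derivative (\<lambda>h. g x \<bullet> h)) (at x)"
    "\<And>x. wfun x > 0 \<Longrightarrow> snd (snd (g x)) = snd (snd x) * q x" "continuous_on {x. wfun x > 0} q"
    "\<And>x. wfun x > 0 \<Longrightarrow> (g has_derivative G x) (at x)"
    "\<And>b. continuous_on {x. wfun x > 0} (\<lambda>x. G x b)"
    "\<And>x. wfun x > 0 \<Longrightarrow> l x = (\<Sum>b\<in>Basis. G x b \<bullet> b) + (1 - 2 * s) * q x"
    by (rule has_wlapE) blast
  show ?thesis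
  proof (rule has_wlapI[where G = G])
    fix x :: "'a pt" assume x: "wfun x > 0"
    show "(f' has_derivative (\<lambda>h. g' x \<bullet> h)) (at x)"
      using has_derivative_transform_within_open[OF G(1)[OF x] open_wfun_pos[of 0]] x eq by auto
    show "(g' has_derivative G x) (at x)"
      using has_derivative_transform_within_open[OF G(4)[OF x] open_wfun_pos[of 0]] x eq by auto
    show "snd (snd (g' x)) = snd (snd x) * q' x" "l' x = (\<Sum>b\<in>Basis. G x b \<bullet> b) + (1 - 2 * s) * q' x"
      using x eq G by auto
  next
    show "continuous_on {x. wfun x > 0} q'" by (rule continuous_on_eq[OF G(3)]) (use eq in auto)
  qed (rule G)
qed

lemma has_wlap_const: "has_wlap s (\<lambda>_. c) (\<lambda>_. 0) (\<lambda>_. 0) (\<lambda>_. 0)"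
  by (rule has_wlapI[where G = "\<lambda>_ _. 0"]) auto

lemma has_wlap_inner:
  assumes "snd (snd a) = 0"
  shows "has_wlap s (\<lambda>x. x \<bullet> a) (\<lambda>_. a) (\<lambda>_. 0) (\<lambda>_. 0)"
  by (rule has_wlapI[where G = "\<lambda>_ _. 0"])
    (use assms in \<open>auto intro!: derivative_eq_intros simp: inner_commute\<close>)

lemma has_wlap_add:
  assumes "has_wlap s f1 g1 q1 l1" "has_wlap s f2 g2 q2 l2"
  shows "has_wlap s (\<lambda>x. f1 x + f2 x) (\<lambda>x. g1 x + g2 x) (\<lambda>x. q1 x + q2 x) (\<lambda>x. l1 x + l2 x)"
proof -
  from assms(1) obtain G1 where G1: "\<And>x. wfun x > 0 \<Longrightarrow> (f1 has_derivative (\<lambda>h. g1 x \<bullet> h)) (at x)"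
    "\<And>x. wfun x > 0 \<Longrightarrow> snd (snd (g1 x)) = snd (snd x) * q1 x" "continuous_on {x. wfun x > 0} q1"
    "\<And>x. wfun x > 0 \<Longrightarrow> (g1 has_derivative G1 x) (at x)"
    "\<And>b. continuous_on {x. wfun x > 0} (\<lambda>x. G1 x b)"
    "\<And>x. wfun x > 0 \<Longrightarrow> l1 x = (\<Sum>b\<in>Basis. G1 x b \<bullet> b) + (1 - 2 * s) * q1 x"
    by (rule has_wlapE) blast
  from assms(2) obtain G2 where G2: "\<And>x. wfun x > 0 \<Longrightarrow> (f2 has_derivative (\<lambda>h. g2 x \<bullet> h)) (at x)"
    "\<And>x. wfun x > 0 \<Longrightarrow> snd (snd (g2 x)) = snd (snd x) * q2 x" "continuous_on {x. wfun x > 0} q2"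
    "\<And>x. wfun x > 0 \<Longrightarrow> (g2 has_derivative G2 x) (at x)"
    "\<And>b. continuous_on {x. wfun x > 0} (\<lambda>x. G2 x b)"
    "\<And>x. wfun x > 0 \<Longrightarrow> l2 x = (\<Sum>b\<in>Basis. G2 x b \<bullet> b) + (1 - 2 * s) * q2 x"
    by (rule has_wlapE) blast
  show ?thesis
    by (rule has_wlapI[where G = "\<lambda>x b. G1 x b + G2 x b"])
      (auto simp: G1(1-2,4) G2(1-2,4) G1(6) G2(6) inner_add_left sum.distrib algebra_simps
         intro!: continuous_intros G1(3,5) G2(3,5) has_derivative_add)
qed

lemma has_wlap_mult:
  assumes "has_wlap s f1 g1 q1 l1" "has_wlap s f2 g2 q2 l2"
  shows "has_wlap s (\<lambda>x. f1 x * f2 x) (\<lambda>x. f1 x *\<^sub>R g2 x + f2 x *\<^sub>R g1 x) (\<lambda>x. f1 x * q2 x + f2 x * q1 x)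
    (\<lambda>x. f1 x * l2 x + f2 x * l1 x + 2 * (g1 x \<bullet> g2 x))"
proof -
  from assms(1) obtain G1 where G1: "\<And>x. wfun x > 0 \<Longrightarrow> (f1 has_derivative (\<lambda>h. g1 x \<bullet> h)) (at x)"
    "\<And>x. wfun x > 0 \<Longrightarrow> snd (snd (g1 x)) = snd (snd x) * q1 x" "continuous_on {x. wfun x > 0} q1"
    "\<And>x. wfun x > 0 \<Longrightarrow> (g1 has_derivative G1 x) (at x)"
    "\<And>b. continuous_on {x. wfun x > 0} (\<lambda>x. G1 x b)"
    "\<And>x. wfun x > 0 \<Longrightarrow> l1 x = (\<Sum>b\<in>Basis. G1 x b \<bullet> b) + (1 - 2 * s) * q1 x"
    by (rule has_wlapE) blast
  from assms(2) obtain G2 where G2: "\<And>x. wfun x > 0 \<Longrightarrow> (f2 has_derivative (\<lambda>h. g2 x \<bullet> h)) (at x)"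
    "\<And>x. wfun x > 0 \<Longrightarrow> snd (snd (g2 x)) = snd (snd x) * q2 x" "continuous_on {x. wfun x > 0} q2"
    "\<And>x. wfun x > 0 \<Longrightarrow> (g2 has_derivative G2 x) (at x)"
    "\<And>b. continuous_on {x. wfun x > 0} (\<lambda>x. G2 x b)"
    "\<And>x. wfun x > 0 \<Longrightarrow> l2 x = (\<Sum>b\<in>Basis. G2 x b \<bullet> b) + (1 - 2 * s) * q2 x"
    by (rule has_wlapE) blast
  note cont = has_wlap_continuous[OF assms(1)] has_wlap_continuous[OF assms(2)] G1(5) G2(5)
  let ?G = "\<lambda>x h. (f1 x *\<^sub>R G2 x h + (g1 x \<bullet> h) *\<^sub>R g2 x) + (f2 x *\<^sub>R G1 x h + (g2 x \<bullet> h) *\<^sub>R g1 x)"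
  show ?thesis
  proof (rule has_wlapI[where G = ?G])
    fix x :: "'a pt" assume x: "wfun x > 0"
    show "((\<lambda>x. f1 x * f2 x) has_derivative (\<lambda>h. (f1 x *\<^sub>R g2 x + f2 x *\<^sub>R g1 x) \<bullet> h)) (at x)"
      by (rule has_derivative_eq_rhs[OF has_derivative_mult[OF G1(1)[OF x] G2(1)[OF x]]])
        (auto simp: algebra_simps inner_add_left)
    show "((\<lambda>x. f1 x *\<^sub>R g2 x + f2 x *\<^sub>R g1 x) has_derivative ?G x) (at x)"
      by (intro has_derivative_add has_derivative_scaleR G1 G2 x)
    show "snd (snd (f1 x *\<^sub>R g2 x + f2 x *\<^sub>R g1 x)) = snd (snd x) * (f1 x * q2 x + f2 x * q1 x)"
      using G1(2)[OF x] G2(2)[OF x] by (simp add: algebra_simps)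
    have "(\<Sum>b\<in>Basis. ?G x b \<bullet> b) = f1 x * (\<Sum>b\<in>Basis. G2 x b \<bullet> b) + f2 x * (\<Sum>b\<in>Basis. G1 x b \<bullet> b)
        + (\<Sum>b\<in>Basis. (g1 x \<bullet> b) * (g2 x \<bullet> b)) + (\<Sum>b\<in>Basis. (g2 x \<bullet> b) * (g1 x \<bullet> b))"
      by (simp only: inner_add_left inner_scaleR_left sum.distrib sum_distrib_left ac_simps)
    also have "(\<Sum>b\<in>Basis. (g1 x \<bullet> b) * (g2 x \<bullet> b)) = g1 x \<bullet> g2 x"
      by (rule euclidean_inner[symmetric])
    also have "(\<Sum>b\<in>Basis. (g2 x \<bullet> b) * (g1 x \<bullet> b)) = g1 x \<bullet> g2 x"
      by (simp add: euclidean_inner[of "g1 x" "g2 x"] mult.commute)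
    finally have tr: "(\<Sum>b\<in>Basis. ?G x b \<bullet> b) = f1 x * (\<Sum>b\<in>Basis. G2 x b \<bullet> b) +
       f2 x * (\<Sum>b\<in>Basis. G1 x b \<bullet> b) + g1 x \<bullet> g2 x + g1 x \<bullet> g2 x" .
    show "f1 x * l2 x + f2 x * l1 x + 2 * (g1 x \<bullet> g2 x) =
        (\<Sum>b\<in>Basis. ?G x b \<bullet> b) + (1 - 2 * s) * (f1 x * q2 x + f2 x * q1 x)"
      unfolding tr G1(6)[OF x] G2(6)[OF x] by (simp add: algebra_simps)
  qed (intro continuous_intros cont)+
qed

lemma has_wlap_compose:
  assumes "has_wlap s f g q l" and T: "\<And>x. wfun x > 0 \<Longrightarrow> f x \<in> T"
    and D: "\<And>u. u \<in> T \<Longrightarrow> (p has_real_derivative p' u) (at u)"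
      "\<And>u. u \<in> T \<Longrightarrow> (p' has_real_derivative p'' u) (at u)"
    and p'': "continuous_on T p''"
  shows "has_wlap s (\<lambda>x. p (f x)) (\<lambda>x. p' (f x) *\<^sub>R g x) (\<lambda>x. p' (f x) * q x)
    (\<lambda>x. p' (f x) * l x + p'' (f x) * (g x \<bullet> g x))"
proof -
  from assms(1) obtain G where G: "\<And>x. wfun x > 0 \<Longrightarrow> (f has_derivative (\<lambda>h. g x \<bullet> h)) (at x)"
    "\<And>x. wfun x > 0 \<Longrightarrow> snd (snd (g x)) = snd (snd x) * q x" "continuous_on {x. wfun x > 0} q"
    "\<And>x. wfun x > 0 \<Longrightarrow> (g has_derivative G x) (at x)"
    "\<And>b. continuous_on {x. wfun x > 0} (\<lambda>x. G x b)"
    "\<And>x. wfun x > 0 \<Longrightarrow> l x = (\<Sum>b\<in>Basis. G x b \<bullet> b) + (1 - 2 * s) * q x"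
    by (rule has_wlapE) blast
  note cont = has_wlap_continuous[OF assms(1)] G(5)
  have Tf: "f ` {x. wfun x > 0} \<subseteq> T" using T by auto
  have "continuous_on T p'"
    using D(2) by (meson DERIV_isCont continuous_at_imp_continuous_on)
  then have c1: "continuous_on {x. wfun x > 0} (\<lambda>x. p' (f x))"
    by (rule continuous_on_compose2[OF _ cont(1) Tf])
  have c2: "continuous_on {x. wfun x > 0} (\<lambda>x. p'' (f x))"
    by (rule continuous_on_compose2[OF p'' cont(1) Tf])
  let ?G = "\<lambda>x h. p' (f x) *\<^sub>R G x h + (p'' (f x) * (g x \<bullet> h)) *\<^sub>R g x"
  show ?thesis
  proof (rule has_wlapI[where G = ?G])
    fix x :: "'a pt" assume x: "wfun x > 0"
    show "((\<lambda>x. p (f x)) has_derivative (\<lambda>h. (p' (f x) *\<^sub>R g x) \<bullet> h)) (at x)"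
      using has_derivative_compose[OF G(1)[OF x] D(1)[OF T[OF x], unfolded has_field_derivative_def]] by simp
    have "((\<lambda>x. p' (f x)) has_derivative (\<lambda>h. p'' (f x) * (g x \<bullet> h))) (at x)"
      using has_derivative_compose[OF G(1)[OF x] D(2)[OF T[OF x], unfolded has_field_derivative_def]] by simp
    then show "((\<lambda>x. p' (f x) *\<^sub>R g x) has_derivative ?G x) (at x)"
      by (intro has_derivative_scaleR G x)
    show "snd (snd (p' (f x) *\<^sub>R g x)) = snd (snd x) * (p' (f x) * q x)"
      using G(2)[OF x] by simp
    have "(\<Sum>b\<in>Basis. ?G x b \<bullet> b) = p' (f x) * (\<Sum>b\<in>Basis. G x b \<bullet> b)
        + p'' (f x) * (\<Sum>b\<in>Basis. (g x \<bullet> b) * (g x \<bullet> b))"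
      by (simp add: inner_add_left sum.distrib sum_distrib_left mult.assoc)
    also have "(\<Sum>b\<in>Basis. (g x \<bullet> b) * (g x \<bullet> b)) = g x \<bullet> g x"
      by (rule euclidean_inner[symmetric])
    finally have tr: "(\<Sum>b\<in>Basis. ?G x b \<bullet> b) =
      p' (f x) * (\<Sum>b\<in>Basis. G x b \<bullet> b) + p'' (f x) * (g x \<bullet> g x)" .
    show "p' (f x) * l x + p'' (f x) * (g x \<bullet> g x) =
        (\<Sum>b\<in>Basis. ?G x b \<bullet> b) + (1 - 2 * s) * (p' (f x) * q x)"
      unfolding tr G(6)[OF x] by (simp add: algebra_simps)
  qed (intro continuous_intros cont c1 c2)+
qed

lemma has_wlap_powr:
  assumes "has_wlap s f g q l" "\<And>x. wfun x > 0 \<Longrightarrow> f x > 0"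
  shows "has_wlap s (\<lambda>x. f x powr p) (\<lambda>x. (p * f x powr (p - 1)) *\<^sub>R g x) (\<lambda>x. p * f x powr (p - 1) * q x)
    (\<lambda>x. p * f x powr (p - 1) * l x + p * (p - 1) * f x powr (p - 2) * (g x \<bullet> g x))"
proof (rule has_wlap_compose[OF assms(1), of "{0<..}" "\<lambda>u. u powr p" "\<lambda>u. p * u powr (p - 1)"
    "\<lambda>u. p * (p - 1) * u powr (p - 2)"])
  fix u :: real assume u: "u \<in> {0<..}"
  show "((\<lambda>u. u powr p) has_real_derivative p * u powr (p - 1)) (at u)"
    by (rule has_real_derivative_powr) (use u in auto)
  have "((\<lambda>u. u powr (p - 1)) has_real_derivative (p - 1) * u powr (p - 1 - 1)) (at u)"
    by (rule has_real_derivative_powr) (use u in auto)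
  then show "((\<lambda>u. p * u powr (p - 1)) has_real_derivative p * (p - 1) * u powr (p - 2)) (at u)"
    using DERIV_cmult[of "\<lambda>u. u powr (p - 1)" _ u UNIV p] by (simp add: mult.assoc)
qed (use assms(2) in \<open>auto intro!: continuous_intros\<close>)

text \<open>Truncated subtraction in the exponents is harmless: whenever \<open>n - 1\<close> or
  \<open>n - 2\<close> is cut off, the prefactor vanishes.\<close>

lemma has_wlap_power:
  assumes "has_wlap s f g q l"
  shows "has_wlap s (\<lambda>x. f x ^ n) (\<lambda>x. (real n * f x ^ (n - 1)) *\<^sub>R g x) (\<lambda>x. real n * f x ^ (n - 1) * q x)
    (\<lambda>x. real n * f x ^ (n - 1) * l x + real n * (real n - 1) * f x ^ (n - 2) * (g x \<bullet> g x))"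
proof (rule has_wlap_compose[OF assms(1), of UNIV "\<lambda>u. u ^ n" "\<lambda>u. real n * u ^ (n - 1)"
    "\<lambda>u. real n * (real n - 1) * u ^ (n - 2)"])
  fix u :: real
  show "((\<lambda>u. u ^ n) has_real_derivative real n * u ^ (n - 1)) (at u)"
    using DERIV_pow[of n u UNIV] by simp
  show "((\<lambda>u. real n * u ^ (n - 1)) has_real_derivative real n * (real n - 1) * u ^ (n - 2)) (at u)"
  proof (cases n)
    case (Suc m)
    then show ?thesis using DERIV_cmult[OF DERIV_pow[of m u UNIV], of "real n"]
      by (cases m) (simp_all add: mult.assoc)
  qed simp
qed (auto intro!: continuous_intros)

lemma has_wlap_sqnorm:
  "has_wlap s (\<lambda>x::'m::finite pt. x \<bullet> x) (\<lambda>x. 2 *\<^sub>R x) (\<lambda>_. 2) (\<lambda>_. 2 * real DIM('m pt) + 2 * (1 - 2 * s))"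
proof (rule has_wlapI[where G = "\<lambda>_ h. 2 *\<^sub>R h"])
  fix x :: "'m pt"
  show "((\<lambda>x. x \<bullet> x) has_derivative (\<lambda>h. (2 *\<^sub>R x) \<bullet> h)) (at x)"
    by (auto intro!: derivative_eq_intros simp: inner_commute)
  have "(\<Sum>b\<in>Basis. 2 *\<^sub>R b \<bullet> (b :: 'm pt)) = (\<Sum>b\<in>(Basis :: 'm pt set). 2)"
    by (rule sum.cong) auto
  then show "2 * real DIM('m pt) + 2 * (1 - 2 * s) = (\<Sum>b\<in>Basis. 2 *\<^sub>R b \<bullet> (b :: 'm pt)) + (1 - 2 * s) * 2"
    by simp
qed (auto intro!: derivative_eq_intros)

lemma has_wlap_sqnorm_snd:
  "has_wlap s (\<lambda>x::'m::finite pt. snd x \<bullet> snd x) (\<lambda>x. (0, 2 *\<^sub>R snd x)) (\<lambda>_. 2) (\<lambda>_. 4 + 2 * (1 - 2 * s))"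
proof (rule has_wlapI[where G = "\<lambda>_ h. (0, 2 *\<^sub>R snd h)"])
  fix x :: "'m pt"
  show "((\<lambda>x. snd x \<bullet> snd x) has_derivative (\<lambda>h. (0, 2 *\<^sub>R snd x) \<bullet> h)) (at x)"
    by (auto intro!: derivative_eq_intros simp: inner_commute inner_prod_def fun_eq_iff)
  show "((\<lambda>x. (0, 2 *\<^sub>R snd x)) has_derivative (\<lambda>h. (0, 2 *\<^sub>R snd h))) (at x)"
    by (auto intro!: derivative_eq_intros simp: fun_eq_iff)
  have "(\<Sum>b\<in>Basis. (0, 2 *\<^sub>R snd b) \<bullet> (b :: 'm pt)) = 4"
    by (simp add: Basis_prod_def zero_prod_def image_iff sum.reindex inj_on_def inner_prod_def)
  then show "4 + 2 * (1 - 2 * s) = (\<Sum>b\<in>Basis. (0, 2 *\<^sub>R snd b) \<bullet> (b :: 'm pt)) + (1 - 2 * s) * 2"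
    by simp
qed auto

section \<open>The parabolic coordinates w and v\<close>

definition dr :: "'m::finite pt \<Rightarrow> 'm pt" where "dr x = (0, snd x /\<^sub>R norm (snd x))"

text \<open>In the constant 2 - 2s, one unit is the Laplacian 1/r of r in the plane and 1 - 2s is
  the contribution of the weight, since the y-derivative of r divided by y is 1/r.\<close>

lemma has_wlap_r:
  "has_wlap s (\<lambda>x::'m::finite pt. norm (snd x)) dr (\<lambda>x. 1 / norm (snd x)) (\<lambda>x. (2 - 2 * s) / norm (snd x))"
proof (rule has_wlap_cong[OF has_wlap_powr[OF has_wlap_sqnorm_snd, where p = "1/2"]])
  fix x :: "'m pt" assume x: "wfun x > 0"
  define r where "r = norm (snd x)"
  have r: "r > 0" "snd x \<bullet> snd x = r\<^sup>2" using wfun_pos_snd[OF x] by (auto simp: r_def dot_square_norm)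
  then show "snd x \<bullet> snd x > 0" by simp
  have p: "(snd x \<bullet> snd x) powr a = r powr (2 * a)" for a
  proof -
    have "r\<^sup>2 = r powr 2" using r by simp
    then show ?thesis by (simp only: r(2) powr_powr)
  qed
  have m: "r powr - 1 = 1 / r" "r powr - 3 = 1 / r ^ 3" using r by (simp_all add: powr_minus_divide)
  show "norm (snd x) = (snd x \<bullet> snd x) powr (1/2)"
    using r unfolding p by (simp add: r_def[symmetric])
  show "dr x = (1 / 2 * (snd x \<bullet> snd x) powr (1 / 2 - 1)) *\<^sub>R (0, 2 *\<^sub>R snd x)"
  proof -
    have e: "r powr (2 * (1 / 2 - 1)) = 1 / r" using m by simp
    show ?thesis unfolding p e dr_def r_def[symmetric] by (simp add: inverse_eq_divide)
  qed
  show "1 / norm (snd x) = 1 / 2 * (snd x \<bullet> snd x) powr (1 / 2 - 1) * 2"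
    unfolding p using m by (simp add: r_def[symmetric])
  have "(0, 2 *\<^sub>R snd x) \<bullet> ((0, 2 *\<^sub>R snd x) :: 'm pt) = 4 * r\<^sup>2"
    by (simp add: inner_prod_def r(2)[symmetric])
  then show "(2 - 2 * s) / norm (snd x) = 1 / 2 * (snd x \<bullet> snd x) powr (1 / 2 - 1) * (4 + 2 * (1 - 2 * s)) +
      1 / 2 * (1 / 2 - 1) * (snd x \<bullet> snd x) powr (1 / 2 - 2) * ((0, 2 *\<^sub>R snd x) \<bullet> (0, 2 *\<^sub>R snd x))"
    unfolding p using m r(1) by (simp add: r_def[symmetric] field_simps power2_eq_square power3_eq_cube)
qed

definition e_t :: "'m::finite pt" where "e_t = (0, 1, 0)"

definition vfun :: "'m::finite pt \<Rightarrow> real" where "vfun x = norm (snd x) + fst (snd x)"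

lemma inner_e_t [simp]: "x \<bullet> e_t = fst (snd x)" "e_t \<bullet> x = fst (snd x)"
  by (simp_all add: e_t_def inner_prod_def)

lemma snd_e_t [simp]: "snd (snd e_t) = 0" "fst e_t = 0" "fst (snd e_t) = 1"
  by (simp_all add: e_t_def)

lemma has_wlap_w:
  "has_wlap s wfun (\<lambda>x. dr x - e_t) (\<lambda>x. 1 / norm (snd x)) (\<lambda>x. (2 - 2 * s) / norm (snd x))"
  by (rule has_wlap_cong[OF has_wlap_add[OF has_wlap_r has_wlap_inner[of "- e_t"]]])
    (simp_all add: wfun_def)

lemma has_wlap_v:
  "has_wlap s vfun (\<lambda>x. dr x + e_t) (\<lambda>x. 1 / norm (snd x)) (\<lambda>x. (2 - 2 * s) / norm (snd x))"
  by (rule has_wlap_cong[OF has_wlap_add[OF has_wlap_r has_wlap_inner[of "e_t"]]])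
    (simp_all add: vfun_def)

text \<open>All three follow from |grad r| = 1 and the t-component t/r of grad r. The last one,
  orthogonality of the parabolic coordinates, removes the mixed term of the operator on products of
  powers of w and v.\<close>

lemma dr_inner:
  fixes x :: "'m::finite pt"
  assumes "wfun x > 0"
  shows "(dr x - e_t) \<bullet> (dr x - e_t) = 2 * wfun x / norm (snd x)"
    "(dr x + e_t) \<bullet> (dr x + e_t) = 2 * vfun x / norm (snd x)"
    "(dr x - e_t) \<bullet> (dr x + e_t) = 0"
proof -
  have r: "norm (snd x) > 0" using wfun_pos_snd[OF assms] by simp
  have "dr x \<bullet> dr x = 1"
    using r by (simp add: dr_def inner_prod_def inner_real_def dot_square_norm[of "snd x"] flip: inner_prod_def)
      (simp add: dot_square_norm power2_eq_square field_simps)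
  moreover have "fst (snd (dr x)) = fst (snd x) / norm (snd x)"
    by (simp add: dr_def divide_inverse mult.commute)
  ultimately show "(dr x - e_t) \<bullet> (dr x - e_t) = 2 * wfun x / norm (snd x)"
    "(dr x + e_t) \<bullet> (dr x + e_t) = 2 * vfun x / norm (snd x)"
    "(dr x - e_t) \<bullet> (dr x + e_t) = 0"
    using r by (simp_all add: inner_diff_left inner_diff_right inner_add_left inner_add_right wfun_def vfun_def field_simps)
qed

text \<open>The first-order term contributes i (2 - 2s) and |grad w|^2 = 2 w / r contributes 2 i (i
  - 1); their sum is 2 i (i - s).\<close>

lemma has_wlap_w_power:
  "has_wlap s (\<lambda>x. wfun x ^ i) (\<lambda>x. (real i * wfun x ^ (i - 1)) *\<^sub>R (dr x - e_t)) (\<lambda>x. real i * wfun x ^ (i - 1) * (1 / norm (snd x)))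
    (\<lambda>x. 2 / norm (snd x) * (real i * (real i - s) * wfun x ^ (i - 1)))"
proof (rule has_wlap_cong[OF has_wlap_power[OF has_wlap_w]])
  fix x :: "'a pt" assume x: "wfun x > 0"
  have r: "norm (snd x) > 0" using wfun_pos_snd[OF x] by simp
  have "real i * (real i - 1) * wfun x ^ (i - 2) * wfun x = real i * (real i - 1) * wfun x ^ (i - 1)"
    by (cases i; cases "i - 1") auto
  then have *: "real i * (real i - 1) * wfun x ^ (i - 2) * (2 * wfun x / norm (snd x)) =
     2 / norm (snd x) * (real i * (real i - 1) * wfun x ^ (i - 1))" by (simp add: field_simps)
  show "2 / norm (snd x) * (real i * (real i - s) * wfun x ^ (i - 1)) =
    real i * wfun x ^ (i - 1) * ((2 - 2 * s) / norm (snd x)) + real i * (real i - 1) * wfun x ^ (i - 2) * ((dr x - e_t) \<bullet> (dr x - e_t))"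
    unfolding dr_inner[OF x] * using r by (simp add: field_simps)
qed auto

lemma has_wlap_v_power:
  "has_wlap s (\<lambda>x. vfun x ^ i) (\<lambda>x. (real i * vfun x ^ (i - 1)) *\<^sub>R (dr x + e_t)) (\<lambda>x. real i * vfun x ^ (i - 1) * (1 / norm (snd x)))
    (\<lambda>x. 2 / norm (snd x) * (real i * (real i - s) * vfun x ^ (i - 1)))"
proof (rule has_wlap_cong[OF has_wlap_power[OF has_wlap_v]])
  fix x :: "'a pt" assume x: "wfun x > 0"
  have r: "norm (snd x) > 0" using wfun_pos_snd[OF x] by simp
  have "real i * (real i - 1) * vfun x ^ (i - 2) * vfun x = real i * (real i - 1) * vfun x ^ (i - 1)"
    by (cases i; cases "i - 1") auto
  then have *: "real i * (real i - 1) * vfun x ^ (i - 2) * (2 * vfun x / norm (snd x)) =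
     2 / norm (snd x) * (real i * (real i - 1) * vfun x ^ (i - 1))" by (simp add: field_simps)
  show "2 / norm (snd x) * (real i * (real i - s) * vfun x ^ (i - 1)) =
    real i * vfun x ^ (i - 1) * ((2 - 2 * s) / norm (snd x)) + real i * (real i - 1) * vfun x ^ (i - 2) * ((dr x + e_t) \<bullet> (dr x + e_t))"
    unfolding dr_inner[OF x] * using r by (simp add: field_simps)
qed auto

text \<open>The exponent s is the nonzero root of the indicial polynomial a (a - s).\<close>

lemma has_wlap_w_powr:
  "has_wlap s (\<lambda>x. wfun x powr s) (\<lambda>x. (s * wfun x powr (s - 1)) *\<^sub>R (dr x - e_t)) (\<lambda>x. s * wfun x powr (s - 1) * (1 / norm (snd x)))
    (\<lambda>x. 0)"
proof (rule has_wlap_cong[OF has_wlap_powr[OF has_wlap_w]])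
  fix x :: "'a pt" assume x: "wfun x > 0"
  have r: "norm (snd x) > 0" using wfun_pos_snd[OF x] by simp
  have "s * (s - 1) * wfun x powr (s - 2) * (2 * wfun x / norm (snd x)) =
     2 / norm (snd x) * (s * (s - 1) * (wfun x powr (s - 2) * wfun x))" by simp
  also have "wfun x powr (s - 2) * wfun x = wfun x powr (s - 1)"
    using x powr_add[of "wfun x" "s - 2" 1] by simp
  finally have *: "s * (s - 1) * wfun x powr (s - 2) * (2 * wfun x / norm (snd x)) =
     2 / norm (snd x) * (s * (s - 1) * wfun x powr (s - 1))" .
  show "0 = s * wfun x powr (s - 1) * ((2 - 2 * s) / norm (snd x)) + s * (s - 1) * wfun x powr (s - 2) * ((dr x - e_t) \<bullet> (dr x - e_t))"
    unfolding dr_inner[OF x] * using r by (simp add: field_simps)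
qed auto

subsection \<open>Homogeneous solutions\<close>

text \<open>\<open>coef s j\<close> makes \<open>w\<^sup>s \<Sum>\<^sub>i c\<^sub>i w\<^sup>i v\<^sup>j\<^sup>-\<^sup>i\<close> a homogeneous solution of degree \<open>j + s\<close>; up to a
  factor, this is the Jacobi polynomial with parameters \<open>(s, -s)\<close> in \<open>t / r\<close>.\<close>

fun coef :: "real \<Rightarrow> nat \<Rightarrow> nat \<Rightarrow> real" where
  "coef s j 0 = 1"
| "coef s j (Suc i) = - coef s j i * ((real j - real i) * (real j - real i - s)) / ((real i + 1) * (real i + 1 + s))"

definition hpoly :: "real \<Rightarrow> nat \<Rightarrow> 'm::finite pt \<Rightarrow> real" where
  "hpoly s j x = (\<Sum>i\<le>j. coef s j i * (wfun x ^ i * vfun x ^ (j - i)))"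

definition efun :: "real \<Rightarrow> nat \<Rightarrow> nat \<Rightarrow> 'm::finite pt \<Rightarrow> 'm pt \<Rightarrow> real" where
  "efun s j n a x = wfun x powr s * hpoly s j x * (x \<bullet> a) ^ n"

lemma has_wlap_sum:
  assumes "finite I" "\<And>i. i \<in> I \<Longrightarrow> has_wlap s (f i) (g i) (q i) (l i)"
  shows "has_wlap s (\<lambda>x. \<Sum>i\<in>I. f i x) (\<lambda>x. \<Sum>i\<in>I. g i x) (\<lambda>x. \<Sum>i\<in>I. q i x) (\<lambda>x. \<Sum>i\<in>I. l i x)"
  using assms
proof (induction rule: finite_induct)
  case empty
  then show ?case by (simp add: has_wlap_const)
next
  case (insert i I)
  then show ?case by (simp add: has_wlap_add)
qed

text \<open>The exponent of w is i + s, for which a (a - s) becomes i (i + s). That the gradient has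
  no x'-component is recorded because it later kills the cross term with powers of a horizontal
  linear form.\<close>

lemma has_wlap_term:
  fixes c :: real and i l :: nat
  shows "\<exists>g q. has_wlap s (\<lambda>x::'m::finite pt. c * (wfun x powr s * (wfun x ^ i * vfun x ^ l))) g q
    (\<lambda>x. 2 / norm (snd x) * wfun x powr s * (c * (real l * (real l - s) * (wfun x ^ i * vfun x ^ (l - 1)) +
       real i * (real i + s) * (wfun x ^ (i - 1) * vfun x ^ l)))) \<and> (\<forall>x. fst (g x) = 0)"
proof -
  define f where "f x = wfun x ^ i * vfun x ^ l" for x :: "'m pt"
  define g where "g x = wfun x ^ i *\<^sub>R (real l * vfun x ^ (l - 1)) *\<^sub>R (dr x + e_t)
      + vfun x ^ l *\<^sub>R (real i * wfun x ^ (i - 1)) *\<^sub>R (dr x - e_t)" for x :: "'m pt"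
  define q where "q x = wfun x ^ i * (real l * vfun x ^ (l - 1) * (1 / norm (snd x)))
      + vfun x ^ l * (real i * wfun x ^ (i - 1) * (1 / norm (snd x)))" for x :: "'m pt"
  have 1: "has_wlap s f g q
    (\<lambda>x. 2 / norm (snd x) * (real l * (real l - s) * (wfun x ^ i * vfun x ^ (l - 1)) +
       real i * (real i - s) * (wfun x ^ (i - 1) * vfun x ^ l)))"
    proof (rule has_wlap_cong[OF has_wlap_mult[OF has_wlap_w_power has_wlap_v_power, of s i l]])
      fix x :: "'m pt" assume x: "wfun x > 0"
      have "(real i * wfun x ^ (i - 1)) *\<^sub>R (dr x - e_t) \<bullet> (real l * vfun x ^ (l - 1)) *\<^sub>R (dr x + e_t) = 0"
        using dr_inner(3)[OF x] by simp
      then show "2 / norm (snd x) * (real l * (real l - s) * (wfun x ^ i * vfun x ^ (l - 1)) +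
       real i * (real i - s) * (wfun x ^ (i - 1) * vfun x ^ l)) =
        wfun x ^ i * (2 / norm (snd x) * (real l * (real l - s) * vfun x ^ (l - 1))) +
        vfun x ^ l * (2 / norm (snd x) * (real i * (real i - s) * wfun x ^ (i - 1))) +
        2 * ((real i * wfun x ^ (i - 1)) *\<^sub>R (dr x - e_t) \<bullet> (real l * vfun x ^ (l - 1)) *\<^sub>R (dr x + e_t))"
        by (simp only: mult_zero_right add_0_right distrib_left ac_simps)
    qed (auto simp: f_def g_def q_def)
  note 2 = has_wlap_mult[OF has_wlap_const[of s c] has_wlap_mult[OF has_wlap_w_powr 1]]
  show ?thesis
  proof (intro exI conjI allI)
    show "has_wlap s (\<lambda>x::'m pt. c * (wfun x powr s * (wfun x ^ i * vfun x ^ l)))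
       (\<lambda>x. c *\<^sub>R (wfun x powr s *\<^sub>R g x + f x *\<^sub>R (s * wfun x powr (s - 1)) *\<^sub>R (dr x - e_t)))
       (\<lambda>x. c * (wfun x powr s * q x + f x * (s * wfun x powr (s - 1) * (1 / norm (snd x)))))
    (\<lambda>x. 2 / norm (snd x) * wfun x powr s * (c * (real l * (real l - s) * (wfun x ^ i * vfun x ^ (l - 1)) +
       real i * (real i + s) * (wfun x ^ (i - 1) * vfun x ^ l))))"
    proof (rule has_wlap_cong[OF 2])
      fix x :: "'m pt" assume x: "wfun x > 0"
      have w: "wfun x powr (s - 1) * wfun x = wfun x powr s"
        using x powr_add[of "wfun x" "s - 1" 1] by simp
      have "(dr x - e_t) \<bullet> g x = vfun x ^ l * (real i * wfun x ^ (i - 1)) * (2 * wfun x / norm (snd x))"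
      proof -
        have "D \<bullet> (a *\<^sub>R b *\<^sub>R E + c *\<^sub>R d *\<^sub>R D) = a * b * (D \<bullet> E) + c * d * (D \<bullet> D)" for D E :: "'m pt" and a b c d
          by (simp add: inner_add_right)
        then show ?thesis unfolding g_def by (simp add: dr_inner[OF x])
      qed
      then have "(s * wfun x powr (s - 1)) *\<^sub>R (dr x - e_t) \<bullet> g x =
        2 / norm (snd x) * (s * real i) * ((wfun x powr (s - 1) * wfun x) * (wfun x ^ (i - 1) * vfun x ^ l))"
        by simp
      also have "\<dots> = 2 / norm (snd x) * wfun x powr s * (s * real i * (wfun x ^ (i - 1) * vfun x ^ l))"
        unfolding w by simp
      finally have e: "(s * wfun x powr (s - 1)) *\<^sub>R (dr x - e_t) \<bullet> g x =
         2 / norm (snd x) * wfun x powr s * (s * real i * (wfun x ^ (i - 1) * vfun x ^ l))" .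
      show "2 / norm (snd x) * wfun x powr s * (c * (real l * (real l - s) * (wfun x ^ i * vfun x ^ (l - 1)) +
         real i * (real i + s) * (wfun x ^ (i - 1) * vfun x ^ l))) =
        c * (wfun x powr s * (2 / norm (snd x) * (real l * (real l - s) * (wfun x ^ i * vfun x ^ (l - 1)) +
       real i * (real i - s) * (wfun x ^ (i - 1) * vfun x ^ l))) + f x * 0 + 2 * ((s * wfun x powr (s - 1)) *\<^sub>R (dr x - e_t) \<bullet> g x)) +
       wfun x powr s * f x * 0 + 2 * (0 \<bullet> (wfun x powr s *\<^sub>R g x + f x *\<^sub>R (s * wfun x powr (s - 1)) *\<^sub>R (dr x - e_t)))"
        unfolding e by (simp add: algebra_simps)
    qed (auto simp: f_def)
  qed (simp add: g_def dr_def)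
qed

lemma coef_step:
  assumes "0 < s" 
  shows "coef s j (Suc i) * (real (Suc i) * (real (Suc i) + s)) = - coef s j i * ((real j - real i) * (real j - real i - s))"
proof -
  have nz: "(real i + 1) * (real i + 1 + s) \<noteq> 0" using assms by simp
  have e: "real (Suc i) = real i + 1" by simp
  show ?thesis
    unfolding coef.simps e using nz by (metis nonzero_mult_div_cancel_right times_divide_eq_left)
qed

text \<open>The monomial w^i v^(j-i-1) receives one contribution from the term with index i and one
  from index i + 1; the recursion of \<open>coef\<close> is the condition that these two
  cancel.\<close>

lemma has_wlap_hsol:
  assumes "0 < s"
  shows "\<exists>g q. has_wlap s (\<lambda>x::'m::finite pt. wfun x powr s * hpoly s j x) g q (\<lambda>_. 0) \<and> (\<forall>x. fst (g x) = 0)"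
proof -
  let ?f = "\<lambda>i (x::'m pt). coef s j i * (wfun x powr s * (wfun x ^ i * vfun x ^ (j - i)))"
  let ?T = "\<lambda>i (x::'m pt). coef s j i * (real (j - i) * (real (j - i) - s) * (wfun x ^ i * vfun x ^ (j - i - 1)) +
       real i * (real i + s) * (wfun x ^ (i - 1) * vfun x ^ (j - i)))"
  let ?l = "\<lambda>i (x::'m pt). 2 / norm (snd x) * wfun x powr s * ?T i x"
  have "\<forall>i. \<exists>g q. has_wlap s (?f i) g q (?l i) \<and> (\<forall>x. fst (g x) = 0)"
    using has_wlap_term by blast
  from choice[OF this] obtain g where "\<forall>i. \<exists>q. has_wlap s (?f i) (g i) q (?l i) \<and> (\<forall>x. fst (g i x) = 0)" ..
  from choice[OF this] obtain q where gq: "\<And>i. has_wlap s (?f i) (g i) (q i) (?l i)" "\<And>i x. fst (g i x) = 0"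
    by blast
  have T: "(\<Sum>i\<le>j. ?T i x) = 0" for x :: "'m pt"
  proof -
    define A where "A i = coef s j i * (real (j - i) * (real (j - i) - s)) * (wfun x ^ i * vfun x ^ (j - i - 1))" for i
    define B where "B i = coef s j i * (real i * (real i + s)) * (wfun x ^ (i - 1) * vfun x ^ (j - i))" for i
    have "(\<Sum>i\<le>j. ?T i x) = (\<Sum>i\<le>j. A i) + (\<Sum>i\<le>j. B i)"
      by (simp add: A_def B_def sum.distrib[symmetric] algebra_simps)
    \<comment> \<open>Nothing is lost at the ends: the factor j - i kills the last term of
      \<open>A\<close>, and the factor i kills the first term of \<open>B\<close>.\<close>
    also have "(\<Sum>i\<le>j. A i) = (\<Sum>i<j. A i)"
      by (simp add: A_def flip: lessThan_Suc_atMost)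
    also have "(\<Sum>i\<le>j. B i) = (\<Sum>i<j. B (Suc i))"
      by (simp add: B_def sum.atMost_shift)
    also have "(\<Sum>i<j. A i) + (\<Sum>i<j. B (Suc i)) = (\<Sum>i<j. A i + B (Suc i))"
      by (rule sum.distrib[symmetric])
    also have "\<dots> = 0"
    proof (rule sum.neutral, rule)
      fix i assume i: "i \<in> {..<j}"
      then have e: "real (j - i) = real j - real i" by (simp add: of_nat_diff)
      have "B (Suc i) = - A i"
        unfolding A_def B_def coef_step[OF assms] e by simp
      then show "A i + B (Suc i) = 0" by simp
    qed
    finally show ?thesis .
  qed
  have "has_wlap s (\<lambda>x. \<Sum>i\<le>j. ?f i x) (\<lambda>x. \<Sum>i\<le>j. g i x) (\<lambda>x. \<Sum>i\<le>j. q i x) (\<lambda>x. \<Sum>i\<le>j. ?l i x)"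
    by (rule has_wlap_sum[OF finite_atMost gq(1)])
  then have "has_wlap s (\<lambda>x. wfun x powr s * hpoly s j x) (\<lambda>x. \<Sum>i\<le>j. g i x) (\<lambda>x. \<Sum>i\<le>j. q i x) (\<lambda>_. 0)"
    by (rule has_wlap_cong) (simp_all only: T sum_distrib_left[symmetric] mult_zero_right hpoly_def,
        simp add: sum_distrib_left mult_ac)
  moreover have "fst (\<Sum>i\<le>j. g i x) = 0" for x using gq(2) by (simp add: fst_sum)
  ultimately show ?thesis by blast
qed

text \<open>In the product rule the first factor is annihilated and the two gradients are
  orthogonal, one lying in the (t, y)-plane and the other along \<open>a\<close>. Only the Laplacian
  of the power of the linear form survives.\<close>

lemma has_wlap_efun:
  assumes "0 < s" "snd a = 0"
  shows "\<exists>g q. has_wlap s (efun s j n a) g q (\<lambda>x. real n * (real n - 1) * (a \<bullet> a) * efun s j (n - 2) a x)"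
proof -
  obtain g q where h: "has_wlap s (\<lambda>x::'a pt. wfun x powr s * hpoly s j x) g q (\<lambda>_. 0)" "\<And>x. fst (g x) = 0"
    using has_wlap_hsol[OF assms(1)] by blast
  have "g x \<bullet> a = 0" for x using h(2) assms(2) by (simp add: inner_prod_def)
  then show ?thesis
    by (intro exI has_wlap_cong[OF has_wlap_mult[OF h(1) has_wlap_power[OF has_wlap_inner[of a], of s n]]])
      (use assms in \<open>auto simp: efun_def\<close>)
qed

section \<open>Homogeneity, Euler's identity and the extension of degree zero\<close>

lemma vfun_scale: "c \<ge> 0 \<Longrightarrow> vfun (c *\<^sub>R x) = c * vfun x"
  by (simp add: vfun_def algebra_simps)

lemma hpoly_scale: "c \<ge> 0 \<Longrightarrow> hpoly s j (c *\<^sub>R x) = c ^ j * hpoly s j x"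
proof -
  assume c: "c \<ge> 0"
  have "(c * u) ^ i * (c * v) ^ (j - i) = c ^ j * (u ^ i * v ^ (j - i))" if "i \<le> j" for i and u v :: real
  proof -
    have "c ^ j = c ^ i * c ^ (j - i)" using that by (simp flip: power_add)
    then show ?thesis by (simp add: power_mult_distrib)
  qed
  then show ?thesis using c
    by (simp add: hpoly_def vfun_scale scale_coords sum_distrib_left) (intro sum.cong, auto)
qed

lemma efun_scale:
  assumes "c > 0" shows "efun s j n a (c *\<^sub>R x) = c powr (real (j + n) + s) * efun s j n a x"
proof -
  have "c powr (real (j + n) + s) = c powr s * c ^ j * c ^ n"
    using assms by (simp add: powr_add powr_realpow)
  then show ?thesis
    using assms wfun_nonneg[of x]
    by (simp add: efun_def hpoly_scale scale_coords powr_mult power_mult_distrib)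
qed

text \<open>Euler's identity, obtained by differentiating c \<mapsto> f(c x) at c = 1 in two
  ways.\<close>

lemma homogeneous_gradient:
  fixes f :: "'a::real_inner \<Rightarrow> real"
  assumes "\<And>c. c > 0 \<Longrightarrow> f (c *\<^sub>R x) = c powr \<gamma> * f x" "(f has_derivative (\<lambda>h. g \<bullet> h)) (at x)"
  shows "g \<bullet> x = \<gamma> * f x"
proof -
  have "((\<lambda>c. f (c *\<^sub>R x)) has_derivative (\<lambda>h. g \<bullet> (h *\<^sub>R x))) (at 1)"
    by (rule has_derivative_compose[of "\<lambda>c. c *\<^sub>R x" "\<lambda>h. h *\<^sub>R x" 1 UNIV f])
      (use assms(2) in \<open>auto intro!: derivative_eq_intros\<close>)
  moreover have "(\<lambda>h. g \<bullet> (h *\<^sub>R x)) = (*) (g \<bullet> x)" by (auto simp: fun_eq_iff)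
  ultimately have 1: "((\<lambda>c. f (c *\<^sub>R x)) has_real_derivative g \<bullet> x) (at 1)"
    unfolding has_field_derivative_def by simp
  have "((\<lambda>c. c powr \<gamma> * f x) has_real_derivative \<gamma> * f x) (at 1)"
    by (auto intro!: derivative_eq_intros)
  then have "((\<lambda>c. f (c *\<^sub>R x)) has_real_derivative \<gamma> * f x) (at 1)"
    by (rule has_field_derivative_transform_within_open[where S = "{0<..}"]) (use assms(1) in auto)
  with 1 show ?thesis by (rule DERIV_unique)
qed

text \<open>The usual p (p + D - 2) with the effective dimension D = \<open>CARD('m)\<close> + 3 -
  2s: the weight adds 1 - 2s to the true dimension \<open>CARD('m)\<close> + 2.\<close>

lemma has_wlap_norm_powr:
  "has_wlap s (\<lambda>x::'m::finite pt. norm x powr p) (\<lambda>x. (p * norm x powr (p - 2)) *\<^sub>R x) (\<lambda>x. p * norm x powr (p - 2))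
    (\<lambda>x. p * (p + real CARD('m) + 1 - 2 * s) * norm x powr (p - 2))"
proof (rule has_wlap_cong[OF has_wlap_powr[OF has_wlap_sqnorm, where p = "p / 2"]])
  fix x :: "'m pt" assume x: "wfun x > 0"
  have r: "norm x > 0" using wfun_pos_snd[OF x] by auto
  then show "x \<bullet> x > 0" by simp
  have q: "(x \<bullet> x) powr a = norm x powr (2 * a)" for a
  proof -
    have "x \<bullet> x = norm x powr 2" using r by (simp add: dot_square_norm)
    then show ?thesis by (simp only: powr_powr)
  qed
  show "norm x powr p = (x \<bullet> x) powr (p / 2)" unfolding q by simp
  have e: "2 * (p / 2 - 1) = p - 2" by simp
  show "(p * norm x powr (p - 2)) *\<^sub>R x = (p / 2 * (x \<bullet> x) powr (p / 2 - 1)) *\<^sub>R 2 *\<^sub>R x"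
    unfolding q e by simp
  show "p * norm x powr (p - 2) = p / 2 * (x \<bullet> x) powr (p / 2 - 1) * 2"
    unfolding q e by simp
  have "norm x powr (2 * (p / 2 - 2)) * (2 *\<^sub>R x \<bullet> 2 *\<^sub>R x) = 4 * (norm x powr (p - 4) * norm x powr 2)"
    using r by (simp add: dot_square_norm)
  also have "norm x powr (p - 4) * norm x powr 2 = norm x powr (p - 2)"
    by (simp only: powr_add[symmetric]) simp
  finally have f: "p / 2 * (p / 2 - 1) * norm x powr (2 * (p / 2 - 2)) * (2 *\<^sub>R x \<bullet> 2 *\<^sub>R x) = p * (p - 2) * norm x powr (p - 2)"
    by (simp add: algebra_simps)
  show "p * (p + real CARD('m) + 1 - 2 * s) * norm x powr (p - 2) =
    p / 2 * (x \<bullet> x) powr (p / 2 - 1) * (2 * real DIM('m pt) + 2 * (1 - 2 * s)) +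
    p / 2 * (p / 2 - 1) * (x \<bullet> x) powr (p / 2 - 2) * (2 *\<^sub>R x \<bullet> 2 *\<^sub>R x)"
    unfolding q e f by (simp add: algebra_simps)
qed

text \<open>Euler's identity evaluates the cross term as -2 \<gamma>^2 times a power of |x| times f,
  which turns the factor -\<gamma> (-\<gamma> + N - 2s) of the radial power into -\<gamma> (\<gamma>
  + N - 2s), where N = \<open>CARD('m)\<close> + 1. For \<gamma> = k + s this is minus the claimed
  eigenvalue.\<close>

lemma has_wlap_degree_zero:
  fixes f :: "'m::finite pt \<Rightarrow> real"
  assumes f: "has_wlap s f g q l" and hom: "\<And>c x. c > 0 \<Longrightarrow> f (c *\<^sub>R x) = c powr \<gamma> * f x"
  shows "has_wlap s (\<lambda>x. norm x powr - \<gamma> * f x)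
    (\<lambda>x. norm x powr - \<gamma> *\<^sub>R g x + f x *\<^sub>R (- \<gamma> * norm x powr (- \<gamma> - 2)) *\<^sub>R x)
    (\<lambda>x. norm x powr - \<gamma> * q x + f x * (- \<gamma> * norm x powr (- \<gamma> - 2)))
    (\<lambda>x. norm x powr - \<gamma> * l x - \<gamma> * (\<gamma> + real CARD('m) + 1 - 2 * s) * norm x powr (- \<gamma> - 2) * f x)"
proof (rule has_wlap_cong[OF has_wlap_mult[OF has_wlap_norm_powr[where p = "- \<gamma>"] f]])
  fix x :: "'m pt" assume x: "wfun x > 0"
  have "g x \<bullet> x = \<gamma> * f x"
    by (rule homogeneous_gradient[OF hom has_wlap_derivative[OF f x]])
  then have e: "(- \<gamma> * norm x powr (- \<gamma> - 2)) *\<^sub>R x \<bullet> g x = - \<gamma> * norm x powr (- \<gamma> - 2) * (\<gamma> * f x)"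
    by (simp add: inner_commute)
  show "norm x powr - \<gamma> * l x - \<gamma> * (\<gamma> + real CARD('m) + 1 - 2 * s) * norm x powr (- \<gamma> - 2) * f x =
    norm x powr - \<gamma> * l x + f x * (- \<gamma> * (- \<gamma> + real CARD('m) + 1 - 2 * s) * norm x powr (- \<gamma> - 2)) +
    2 * ((- \<gamma> * norm x powr (- \<gamma> - 2)) *\<^sub>R x \<bullet> g x)"
    unfolding e by (simp add: algebra_simps)
qed auto

lemma finite_measure_weighted:
  "0 < s \<Longrightarrow> s < 1 \<Longrightarrow> finite_measure (weighted_measure s :: 'm::finite pt measure)"
  using finite_weighted_measure[of s, where 'm = 'm] by (intro finite_measureI) auto

subsection \<open>Spherical gradients\<close>

lemma radial_has_derivative:
  fixes x :: "'a::euclidean_space"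
  assumes "x \<noteq> 0"
  shows "((\<lambda>x. x /\<^sub>R norm x) has_derivative
    (\<lambda>h. (h - ((x /\<^sub>R norm x) \<bullet> h) *\<^sub>R (x /\<^sub>R norm x)) /\<^sub>R norm x)) (at x)"
proof -
  have n: "(norm has_derivative (\<lambda>h. h \<bullet> sgn x)) (at x)"
    by (rule has_derivative_norm[OF assms])
  have "((\<lambda>x. inverse (norm x)) has_derivative (\<lambda>h. - (inverse (norm x) * (h \<bullet> sgn x) * inverse (norm x)))) (at x)"
    by (rule Deriv.has_derivative_inverse[OF _ n]) (use assms in simp)
  then have "((\<lambda>x. inverse (norm x) *\<^sub>R x) has_derivative (\<lambda>h. inverse (norm x) *\<^sub>R h +
      (- (inverse (norm x) * (h \<bullet> sgn x) * inverse (norm x))) *\<^sub>R x)) (at x)"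
    by (rule has_derivative_scaleR) (rule has_derivative_ident)
  then show ?thesis
    by (rule has_derivative_eq_rhs)
      (auto simp: fun_eq_iff sgn_div_norm algebra_simps inner_commute)
qed

definition tang :: "'a::euclidean_space \<Rightarrow> 'a \<Rightarrow> 'a" where
  "tang \<theta> g = g - (g \<bullet> \<theta>) *\<^sub>R \<theta>"

lemma radial_extension_derivative:
  fixes x :: "'a::euclidean_space"
  assumes "x \<noteq> 0" "(F has_derivative (\<lambda>h. g \<bullet> h)) (at (x /\<^sub>R norm x))"
  shows "((\<lambda>x. F (x /\<^sub>R norm x)) has_derivative (\<lambda>h. (tang (x /\<^sub>R norm x) g /\<^sub>R norm x) \<bullet> h)) (at x)"
proof -
  have "((\<lambda>x. F (x /\<^sub>R norm x)) has_derivative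
      (\<lambda>h. g \<bullet> ((h - ((x /\<^sub>R norm x) \<bullet> h) *\<^sub>R (x /\<^sub>R norm x)) /\<^sub>R norm x))) (at x)"
    by (rule has_derivative_compose[OF radial_has_derivative[OF assms(1)] assms(2)])
  then show ?thesis
    by (rule has_derivative_eq_rhs) (auto simp: tang_def inner_diff_left inner_diff_right algebra_simps)
qed

lemma GDERIV_unique:
  assumes "GDERIV f x :> g" "GDERIV f x :> g'" shows "g = g'"
proof -
  have "(\<lambda>h. h \<bullet> g) = (\<lambda>h. h \<bullet> g')"
    using assms has_derivative_unique unfolding gderiv_def by blast
  then show ?thesis by (metis inner_commute vector_eq_ldot)
qed

lemma sphere_grad_eqI: "GDERIV (\<lambda>x. f (x /\<^sub>R norm x)) \<theta> :> g \<Longrightarrow> sphere_grad f \<theta> = g"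
  unfolding sphere_grad_def by (rule the_equality) (auto intro: GDERIV_unique)

lemma open_upper: "open {x::'m::finite pt. snd (snd x) > 0}"
  by (intro open_Collect_less continuous_intros)

lemma hemi_norm: "\<theta> \<in> hemi \<Longrightarrow> norm \<theta> = 1" "\<theta> \<in> hemi \<Longrightarrow> snd (snd \<theta>) > 0"
  by (simp_all add: hemi_def)

lemma hemi_wfun: "\<theta> \<in> hemi \<Longrightarrow> wfun \<theta> > 0"
  using wfun_pos[of \<theta>] hemi_norm(2)[of \<theta>] by simp

lemma radial_closed_hemi: "snd (snd x) > 0 \<Longrightarrow> x /\<^sub>R norm x \<in> closed_hemi"
  using radial_hemi[of x] by (auto simp: hemi_def closed_hemi_def)

text \<open>Agreement on the open half-sphere is enough: points near \<theta> have y > 0 and are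
  projected back into \<open>hemi\<close>, so the radial extensions of both functions coincide
  there.\<close>

lemma sphere_grad_hemi:
  fixes \<phi> :: "'m::finite pt \<Rightarrow> real"
  assumes \<theta>: "\<theta> \<in> hemi" and eq: "\<And>\<theta>. \<theta> \<in> hemi \<Longrightarrow> \<phi> \<theta> = F \<theta>"
    and D: "(F has_derivative (\<lambda>h. g \<bullet> h)) (at \<theta>)"
  shows "sphere_grad \<phi> \<theta> = tang \<theta> g"
proof (rule sphere_grad_eqI)
  have n: "norm \<theta> = 1" "\<theta> \<noteq> 0" using hemi_norm[OF \<theta>] by auto
  have "((\<lambda>x. F (x /\<^sub>R norm x)) has_derivative (\<lambda>h. (tang (\<theta> /\<^sub>R norm \<theta>) g /\<^sub>R norm \<theta>) \<bullet> h)) (at \<theta>)"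
    by (rule radial_extension_derivative[OF n(2)]) (use D n in simp)
  then have "((\<lambda>x. F (x /\<^sub>R norm x)) has_derivative (\<lambda>h. h \<bullet> tang \<theta> g)) (at \<theta>)"
    using n by (simp add: inner_commute)
  then show "GDERIV (\<lambda>x. \<phi> (x /\<^sub>R norm x)) \<theta> :> tang \<theta> g"
    unfolding gderiv_def
  proof (rule has_derivative_transform_within_open[OF _ open_upper])
    show "F (x /\<^sub>R norm x) = \<phi> (x /\<^sub>R norm x)" if "x \<in> {x. snd (snd x) > 0}" for x
      using eq[OF radial_hemi[of x]] that by simp
  qed (use hemi_norm[OF \<theta>] in simp)
qed

lemma smooth_closed_hemiE:
  fixes \<phi> :: "'m::finite pt \<Rightarrow> real"
  assumes "\<phi> \<in> smooth_closed_hemi"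
  obtains U F dF where "open U" "closed_hemi \<subseteq> U" "\<And>\<theta>. \<theta> \<in> closed_hemi \<Longrightarrow> \<phi> \<theta> = F \<theta>"
    "\<And>x. x \<in> U \<Longrightarrow> (F has_derivative (\<lambda>h. dF x \<bullet> h)) (at x)" "continuous_on U dF"
proof -
  from assms obtain U F where U: "open U" "closed_hemi \<subseteq> U" "smooth_on U F" "\<And>\<theta>. \<theta> \<in> closed_hemi \<Longrightarrow> \<phi> \<theta> = F \<theta>"
    by (auto simp: smooth_closed_hemi_def)
  then have "Ck_on (Suc 0) U F" unfolding smooth_on_def by blast
  then have d: "\<And>x. x \<in> U \<Longrightarrow> F differentiable (at x)"
    and c: "\<And>v. continuous_on U (\<lambda>x. frechet_derivative F (at x) v)" by auto
  define dF where "dF x = (\<Sum>b\<in>Basis. frechet_derivative F (at x) b *\<^sub>R b)" for x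
  have "(F has_derivative (\<lambda>h. dF x \<bullet> h)) (at x)" if "x \<in> U" for x
  proof -
    have D: "(F has_derivative frechet_derivative F (at x)) (at x)"
      using d[OF that] frechet_derivative_works by blast
    then have lin: "linear (frechet_derivative F (at x))" by (rule has_derivative_linear)
    have "frechet_derivative F (at x) h = dF x \<bullet> h" for h
    proof -
      have "frechet_derivative F (at x) h = frechet_derivative F (at x) (\<Sum>b\<in>Basis. (h \<bullet> b) *\<^sub>R b)"
        by (simp add: euclidean_representation)
      also have "\<dots> = (\<Sum>b\<in>Basis. (h \<bullet> b) * frechet_derivative F (at x) b)"
        using lin by (simp add: linear_sum linear_cmul)
      also have "\<dots> = dF x \<bullet> h"
        by (simp add: dF_def inner_sum_left inner_commute[of h] mult.commute)
      finally show ?thesis .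
    qed
    with D show ?thesis by (metis (no_types, lifting) has_derivative_eq_rhs ext)
  qed
  moreover have "continuous_on U dF" unfolding dF_def by (intro continuous_intros c)
  ultimately show ?thesis using that U by blast
qed

text \<open>Support away from \<open>S1_plus\<close> is turned into w > 0 on the support: where y =
  0 it forces t < 0, and where y is nonzero w is positive anyway.\<close>

lemma test_functionsE:
  fixes \<phi> :: "'m::finite pt \<Rightarrow> real"
  assumes "\<phi> \<in> test_functions"
  obtains K where "\<phi> \<in> smooth_closed_hemi" "compact K" "K \<subseteq> {x. wfun x > 0}" "K \<subseteq> closed_hemi" 
    "\<And>\<theta>. \<theta> \<in> closed_hemi \<Longrightarrow> \<theta> \<notin> K \<Longrightarrow> \<phi> \<theta> = 0"
proof -
  from assms obtain K where K: "\<phi> \<in> smooth_closed_hemi" "compact K" "K \<subseteq> closed_hemi - S1_plus" 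
    "\<And>\<theta>. \<theta> \<in> closed_hemi \<Longrightarrow> \<theta> \<notin> K \<Longrightarrow> \<phi> \<theta> = 0"
    by (auto simp: test_functions_def)
  have "wfun \<theta> > 0" if "\<theta> \<in> K" for \<theta>
  proof (cases "snd (snd \<theta>) = 0")
    case True
    then have "fst (snd \<theta>) < 0" using K(3) that by (auto simp: closed_hemi_def S1_plus_def)
    then show ?thesis unfolding wfun_def using norm_ge_zero[of "snd \<theta>"] by linarith
  qed (rule wfun_pos)
  then show ?thesis using that K by blast
qed

lemma compact_closed_hemi: "compact (closed_hemi :: 'm::finite pt set)"
proof -
  have "closed_hemi = sphere (0::'m pt) 1 \<inter> {x. snd (snd x) \<ge> 0}" by (auto simp: closed_hemi_def)
  moreover have "closed {x::'m pt. snd (snd x) \<ge> 0}" by (intro closed_Collect_le continuous_intros)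
  ultimately show ?thesis by (metis compact_Int_closed compact_sphere)
qed

lemma hemi_subset: "hemi \<subseteq> closed_hemi"
  by (auto simp: hemi_def closed_hemi_def)

lemma jet_smooth_bounded:
  fixes \<phi> :: "'m::finite pt \<Rightarrow> real"
  assumes "\<phi> \<in> smooth_closed_hemi"
  obtains C where "\<And>\<theta>. \<theta> \<in> hemi \<Longrightarrow> \<bar>\<phi> \<theta>\<bar> \<le> C" "\<And>\<theta>. \<theta> \<in> hemi \<Longrightarrow> norm (sphere_grad \<phi> \<theta>) \<le> C"
    "continuous_on hemi \<phi>" "continuous_on hemi (sphere_grad \<phi>)"
proof -
  from smooth_closed_hemiE[OF assms] obtain U F dF where F: "open U" "closed_hemi \<subseteq> U"
    "\<And>\<theta>. \<theta> \<in> closed_hemi \<Longrightarrow> \<phi> \<theta> = F \<theta>"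
    "\<And>x. x \<in> U \<Longrightarrow> (F has_derivative (\<lambda>h. dF x \<bullet> h)) (at x)" "continuous_on U dF" by metis
  have cF: "continuous_on closed_hemi F"
    by (rule continuous_on_subset[OF _ F(2)])
      (intro continuous_at_imp_continuous_on ballI, rule has_derivative_continuous, rule F(4))
  have ct: "continuous_on closed_hemi (\<lambda>\<theta>. tang \<theta> (dF \<theta>))"
    unfolding tang_def using continuous_on_subset[OF F(5) F(2)] by (intro continuous_intros)
  have sg: "sphere_grad \<phi> \<theta> = tang \<theta> (dF \<theta>)" if "\<theta> \<in> hemi" for \<theta>
    by (rule sphere_grad_hemi[OF that _ F(4)]) (use that hemi_subset F in auto)
  have "bounded (F ` closed_hemi)" "bounded ((\<lambda>\<theta>. tang \<theta> (dF \<theta>)) ` closed_hemi)"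
    using cF ct compact_closed_hemi by (blast intro: compact_imp_bounded compact_continuous_image)+
  then obtain A B where AB: "\<And>\<theta>. \<theta> \<in> closed_hemi \<Longrightarrow> \<bar>F \<theta>\<bar> \<le> A" "\<And>\<theta>. \<theta> \<in> closed_hemi \<Longrightarrow> norm (tang \<theta> (dF \<theta>)) \<le> B"
    by (auto simp: bounded_iff)
  have "\<bar>\<phi> \<theta>\<bar> \<le> max A B" "norm (sphere_grad \<phi> \<theta>) \<le> max A B" if "\<theta> \<in> hemi" for \<theta>
    using AB[of \<theta>] that hemi_subset F(3)[of \<theta>] sg[OF that] by auto
  moreover have "continuous_on hemi \<phi>" 
    by (rule continuous_on_eq[OF continuous_on_subset[OF cF hemi_subset]]) (use F(3) hemi_subset in auto)
  moreover have "continuous_on hemi (sphere_grad \<phi>)" 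
    by (rule continuous_on_eq[OF continuous_on_subset[OF ct hemi_subset]]) (use sg in auto)
  ultimately show ?thesis by (rule that)
qed

text \<open>The factor \<open>q\<close> may blow up at the Dirichlet cone, but the test function
  vanishes off a compact subset of \<open>wfun x > 0\<close>, on which \<open>q\<close> is
  bounded.\<close>

lemma test_function_product_bounded:
  fixes \<phi> :: "'m::finite pt \<Rightarrow> real"
  assumes \<phi>: "\<phi> \<in> test_functions" and q: "continuous_on {x. wfun x > 0} q"
  obtains C where "\<And>\<theta>. \<theta> \<in> hemi \<Longrightarrow> \<bar>\<phi> \<theta> * q \<theta>\<bar> \<le> C"
proof -
  from test_functionsE[OF \<phi>] obtain K where K: "\<phi> \<in> smooth_closed_hemi" "compact K" "K \<subseteq> {x. wfun x > 0}" "K \<subseteq> closed_hemi" 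
    "\<And>\<theta>. \<theta> \<in> closed_hemi \<Longrightarrow> \<theta> \<notin> K \<Longrightarrow> \<phi> \<theta> = 0" by blast
  obtain A where A: "\<And>\<theta>. \<theta> \<in> hemi \<Longrightarrow> \<bar>\<phi> \<theta>\<bar> \<le> A" by (rule jet_smooth_bounded[OF K(1)]) blast
  have "bounded (q ` K)"
    using compact_continuous_image[OF continuous_on_subset[OF q K(3)] K(2)] compact_imp_bounded by blast
  then obtain B where B: "\<And>\<theta>. \<theta> \<in> K \<Longrightarrow> \<bar>q \<theta>\<bar> \<le> B" by (auto simp: bounded_iff)
  have "\<bar>\<phi> \<theta> * q \<theta>\<bar> \<le> max 0 (A * B)" if "\<theta> \<in> hemi" for \<theta>
  proof (cases "\<theta> \<in> K")
    case True
    have "\<bar>\<phi> \<theta> * q \<theta>\<bar> \<le> A * B" unfolding abs_mult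
      using A[OF that] B[OF True] by (intro mult_mono) auto
    then show ?thesis by simp
  next
    case False
    then have "\<phi> \<theta> = 0" using K(5) that hemi_subset by blast
    then show ?thesis by simp
  qed
  then show ?thesis by (rule that)
qed

lemma test_function_grad_bounded:
  fixes \<phi> :: "'m::finite pt \<Rightarrow> real"
  assumes \<phi>: "\<phi> \<in> test_functions" and g: "continuous_on {x. wfun x > 0} g"
  obtains C where "\<And>\<theta>. \<theta> \<in> hemi \<Longrightarrow> \<bar>sphere_grad \<phi> \<theta> \<bullet> g \<theta>\<bar> \<le> C"
proof -
  from test_functionsE[OF \<phi>] obtain K where K: "\<phi> \<in> smooth_closed_hemi" "compact K" "K \<subseteq> {x. wfun x > 0}" "K \<subseteq> closed_hemi" 
    "\<And>\<theta>. \<theta> \<in> closed_hemi \<Longrightarrow> \<theta> \<notin> K \<Longrightarrow> \<phi> \<theta> = 0" by blast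
  obtain A where A: "\<And>\<theta>. \<theta> \<in> hemi \<Longrightarrow> norm (sphere_grad \<phi> \<theta>) \<le> A" by (rule jet_smooth_bounded[OF K(1)]) blast
  have "bounded (g ` K)"
    using compact_continuous_image[OF continuous_on_subset[OF g K(3)] K(2)] compact_imp_bounded by blast
  then obtain B where B: "\<And>\<theta>. \<theta> \<in> K \<Longrightarrow> norm (g \<theta>) \<le> B" by (auto simp: bounded_iff)
  have "\<bar>sphere_grad \<phi> \<theta> \<bullet> g \<theta>\<bar> \<le> max 0 (A * B)" if \<theta>: "\<theta> \<in> hemi" for \<theta>
  proof (cases "\<theta> \<in> K")
    case True
    have "\<bar>sphere_grad \<phi> \<theta> \<bullet> g \<theta>\<bar> \<le> norm (sphere_grad \<phi> \<theta>) * norm (g \<theta>)" by (rule Cauchy_Schwarz_ineq2)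
    also have "\<dots> \<le> A * B"
      using A[OF that] B[OF True] order_trans[OF norm_ge_zero A[OF that]] by (intro mult_mono) auto
    finally show ?thesis by simp
  next
    case False
    \<comment> \<open>Vanishing at \<theta> alone would not control the gradient. Since
      \<open>K\<close> is closed, the radial extension vanishes in a whole neighbourhood of
      \<theta>.\<close>
    let ?O = "{x::'m pt. snd (snd x) > 0} \<inter> ((\<lambda>x. x /\<^sub>R norm x) -` (- K) \<inter> (- {0}))"
    have "open ((\<lambda>x::'m pt. x /\<^sub>R norm x) -` (- K) \<inter> (- {0}))"
    proof -
      have "continuous_on (- {0}) (\<lambda>x::'m pt. x /\<^sub>R norm x)" by (intro continuous_intros) auto
      moreover have "open (- {0::'m pt})" by auto
      moreover have "open (- K)" using K(2) compact_imp_closed by blast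
      ultimately show ?thesis using continuous_on_open_vimage by blast
    qed
    then have op: "open ?O" using open_upper by blast
    have "GDERIV (\<lambda>x. \<phi> (x /\<^sub>R norm x)) \<theta> :> 0"
      unfolding gderiv_def
    proof (rule has_derivative_transform_within_open[OF _ op, of "\<lambda>_. 0"])
      show "((\<lambda>_. 0) has_derivative (\<lambda>h. h \<bullet> 0)) (at \<theta>)" by simp
      show "\<theta> \<in> ?O" using hemi_norm[OF \<theta>] False by auto
      show "0 = \<phi> (x /\<^sub>R norm x)" if "x \<in> ?O" for x
        using K(5)[of "x /\<^sub>R norm x"] radial_closed_hemi[of x] that by auto
    qed
    then have "sphere_grad \<phi> \<theta> = 0" by (rule sphere_grad_eqI)
    then show ?thesis by simp
  qed
  then show ?thesis by (rule that)
qed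

subsection \<open>Green's formula on the half-sphere\<close>

text \<open>Differentiating f(c x) = f(x) shows that the gradient has degree -1; dividing its last
  component by y makes \<open>q\<close> of degree -2. The orthogonality is Euler's identity in
  degree zero.\<close>

lemma degree_zero_homogeneity:
  fixes f :: "'m::finite pt \<Rightarrow> real"
  assumes f: "has_wlap s f g q l" and hom: "\<And>c x. c > 0 \<Longrightarrow> f (c *\<^sub>R x) = f x"
    and x: "snd (snd x) > 0" and c: "c > 0"
  shows "g (c *\<^sub>R x) = g x /\<^sub>R c" "q (c *\<^sub>R x) = q x / c\<^sup>2" "g x \<bullet> x = 0"
proof -
  have w: "wfun x > 0" "wfun (c *\<^sub>R x) > 0" using x c by (auto intro!: wfun_pos)
  have sc: "((\<lambda>x. c *\<^sub>R x) has_derivative (\<lambda>h. c *\<^sub>R h)) (at x)" by (auto intro!: derivative_eq_intros)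
  have "((\<lambda>x. f (c *\<^sub>R x)) has_derivative (\<lambda>h. g (c *\<^sub>R x) \<bullet> (c *\<^sub>R h))) (at x)"
    by (rule has_derivative_compose[OF sc has_wlap_derivative[OF f w(2)]])
  then have "GDERIV f x :> c *\<^sub>R g (c *\<^sub>R x)"
    unfolding gderiv_def using hom[OF c] by (simp add: inner_commute)
  moreover have "GDERIV f x :> g x"
    unfolding gderiv_def using has_wlap_derivative[OF f w(1)] by (simp add: inner_commute)
  ultimately have "c *\<^sub>R g (c *\<^sub>R x) = g x" by (rule GDERIV_unique)
  then show g: "g (c *\<^sub>R x) = g x /\<^sub>R c" using c by (metis scaleR_one scaleR_scaleR left_inverse less_irrefl)
  have "snd (snd (c *\<^sub>R x)) * q (c *\<^sub>R x) = snd (snd (g x)) / c"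
    using f w(2) g unfolding has_wlap_def by (metis snd_scaleR real_scaleR_def divide_inverse mult.commute)
  moreover have "snd (snd (g x)) = snd (snd x) * q x"
    using f w(1) unfolding has_wlap_def by blast
  ultimately show "q (c *\<^sub>R x) = q x / c\<^sup>2"
    using x c by (simp add: field_simps power2_eq_square)
  have "g x \<bullet> x = 0 * f x"
    by (rule homogeneous_gradient[OF _ has_wlap_derivative[OF f w(1)]]) (use hom in auto)
  then show "g x \<bullet> x = 0" by simp
qed

text \<open>The vector field \<open>cutoff\<^sub>n(y) cutoff\<^sub>n(\<rho>) cutoff\<^sub>n(1 - \<rho>) \<rho>\<^sup>2\<^sup>s\<^sup>+\<^sup>1 y\<^sup>1\<^sup>-\<^sup>2\<^sup>s \<phi> \<nabla>f\<close>, where \<open>\<rho> = |x|\<close> and \<open>\<phi>\<close> and \<open>f\<close> are extended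
  by homogeneity of degree zero, is compactly supported in the open half-ball. Since \<open>\<nabla>f\<close> is orthogonal
  to \<open>x\<close>, the radial factors do not contribute to its divergence.\<close>

lemma green_formula:
  fixes \<phi> f :: "'m::finite pt \<Rightarrow> real"
  assumes s: "0 < s" "s < 1"
    and f: "has_wlap s f g q l" and hom: "\<And>c x. c > 0 \<Longrightarrow> f (c *\<^sub>R x) = f x"
    and hl: "\<And>c x. c > 0 \<Longrightarrow> snd (snd x) > 0 \<Longrightarrow> l (c *\<^sub>R x) = l x / c\<^sup>2"
    and \<phi>: "\<phi> \<in> test_functions"
  shows "(\<integral>\<theta>. sphere_grad \<phi> \<theta> \<bullet> g \<theta> + \<phi> \<theta> * l \<theta> \<partial>weighted_measure s) = 0"
proof -
  let ?O = "{x::'m pt. snd (snd x) > 0}"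
  have Ow: "wfun x > 0" if "x \<in> ?O" for x using that by (auto intro: wfun_pos)
  have On: "x \<noteq> 0" "norm x > 0" if "x \<in> ?O" for x using that by auto
  have sub: "?O \<subseteq> {x. wfun x > 0}" using Ow by auto
  have \<phi>s: "\<phi> \<in> smooth_closed_hemi" using \<phi> by (simp add: test_functions_def)
  from f obtain G where G: 
    "\<And>x. wfun x > 0 \<Longrightarrow> snd (snd (g x)) = snd (snd x) * q x" "continuous_on {x. wfun x > 0} q"
    "\<And>x. wfun x > 0 \<Longrightarrow> (g has_derivative G x) (at x)"
    "\<And>b. continuous_on {x. wfun x > 0} (\<lambda>x. G x b)"
    "\<And>x. wfun x > 0 \<Longrightarrow> l x = (\<Sum>b\<in>Basis. G x b \<bullet> b) + (1 - 2 * s) * q x"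
    by (rule has_wlapE) blast
  have cg: "continuous_on {x. wfun x > 0} g" by (rule has_wlap_continuous(2)[OF f])
  have cl: "continuous_on {x. wfun x > 0} l"
    by (rule continuous_on_eq[of _ "\<lambda>x. (\<Sum>b\<in>Basis. G x b \<bullet> b) + (1 - 2 * s) * q x"])
      (use G in \<open>auto intro!: continuous_intros\<close>)
  from smooth_closed_hemiE[OF \<phi>s] obtain U F dF where F: "open U" "closed_hemi \<subseteq> U"
    "\<And>\<theta>. \<theta> \<in> closed_hemi \<Longrightarrow> \<phi> \<theta> = F \<theta>"
    "\<And>x. x \<in> U \<Longrightarrow> (F has_derivative (\<lambda>h. dF x \<bullet> h)) (at x)" "continuous_on U dF" by metis
  define P where "P x = F (x /\<^sub>R norm x)" for x
  define dP where "dP x = tang (x /\<^sub>R norm x) (dF (x /\<^sub>R norm x)) /\<^sub>R norm x" for x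
  have pU: "x /\<^sub>R norm x \<in> U" if "x \<in> ?O" for x using radial_closed_hemi F(2) that by blast
  have P: "(P has_derivative (\<lambda>h. dP x \<bullet> h)) (at x)" if "x \<in> ?O" for x
    unfolding P_def[abs_def] dP_def by (rule radial_extension_derivative[OF On(1)[OF that] F(4)[OF pU[OF that]]])
  have cP: "continuous_on ?O P"
    by (intro continuous_at_imp_continuous_on ballI, rule has_derivative_continuous, rule P)
  have crad: "continuous_on ?O (\<lambda>x. x /\<^sub>R norm x)" by (intro continuous_intros) (use On in auto)
  have cdF: "continuous_on ?O (\<lambda>x. dF (x /\<^sub>R norm x))"
    by (rule continuous_on_compose2[OF F(5) crad]) (rule image_subsetI, rule pU)
  have cdP: "continuous_on ?O dP"
    unfolding dP_def tang_def by (intro continuous_intros crad cdF) (use On in auto)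
  have sg: "sphere_grad \<phi> \<theta> = tang \<theta> (dF \<theta>)" if "\<theta> \<in> hemi" for \<theta>
    by (rule sphere_grad_hemi[OF that _ F(4)]) (use that hemi_subset F in auto)
  have dPx: "dP x = sphere_grad \<phi> (x /\<^sub>R norm x) /\<^sub>R norm x" "P x = \<phi> (x /\<^sub>R norm x)" if "x \<in> ?O" for x
    using sg[OF radial_hemi[of x]] F(3)[OF radial_closed_hemi[of x]] that by (simp_all add: dP_def P_def)
  define Y where "Y n y = cutoff n y * y powr (1 - 2 * s)" for n and y :: real
  define Y' where "Y' n y = cutoff' n y * y powr (1 - 2 * s) + cutoff n y * ((1 - 2 * s) * y powr (1 - 2 * s - 1))" for n and y :: real
  have Y: "(Y n has_real_derivative Y' n y) (at y)" if "y > 0" for n y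
    unfolding Y_def[abs_def] Y'_def
    by (rule DERIV_cong[OF DERIV_mult[OF cutoff_DERIV has_real_derivative_powr[OF that]]]) simp
  \<comment> \<open>The exponent 2s + 1 makes the limiting integrand homogeneous of degree zero:
    y^(1-2s) has degree 1 - 2s, and the divergence terms have degree -2. The integral over the
    half-ball is then the one that represents \<open>weighted_measure\<close>.\<close>
  define R where "R n \<rho> = cutoff n \<rho> * cutoff n (1 - \<rho>) * \<rho> powr (2 * s + 1)" for n and \<rho> :: real
  define R' where "R' n \<rho> = (cutoff' n \<rho> * cutoff n (1 - \<rho>) - cutoff n \<rho> * cutoff' n (1 - \<rho>)) * \<rho> powr (2 * s + 1) +
      cutoff n \<rho> * cutoff n (1 - \<rho>) * ((2 * s + 1) * \<rho> powr (2 * s + 1 - 1))" for n and \<rho> :: real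
  have R: "(R n has_real_derivative R' n \<rho>) (at \<rho>)" if "\<rho> > 0" for n \<rho>
  proof -
    have "((\<lambda>\<rho>. cutoff n (1 - \<rho>)) has_real_derivative cutoff' n (1 - \<rho>) * - 1) (at \<rho>)"
      by (rule DERIV_chain2[OF cutoff_DERIV]) (auto intro!: derivative_eq_intros)
    from DERIV_mult[OF DERIV_mult[OF cutoff_DERIV this] has_real_derivative_powr[OF that, of "2 * s + 1"]]
    show ?thesis unfolding R_def[abs_def] R'_def by (rule DERIV_cong) (simp add: algebra_simps)
  qed
  define h where "h n b x = Y n (snd (snd x)) * R n (norm x) * P x * (g x \<bullet> b)" for n and b x :: "'m pt"
  define D where "D n b x k = Y' n (snd (snd x)) * snd (snd k) * R n (norm x) * P x * (g x \<bullet> b)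
     + Y n (snd (snd x)) * (R' n (norm x) * (k \<bullet> sgn x)) * P x * (g x \<bullet> b)
     + Y n (snd (snd x)) * R n (norm x) * (dP x \<bullet> k) * (g x \<bullet> b)
     + Y n (snd (snd x)) * R n (norm x) * P x * (G x k \<bullet> b)" for n and b x k :: "'m pt"
  have hD: "(h n b has_derivative D n b x) (at x)" if x: "x \<in> ?O" for n b x
  proof -
    have 1: "((\<lambda>x::'m pt. Y n (snd (snd x))) has_derivative (\<lambda>k. Y' n (snd (snd x)) * snd (snd k))) (at x)"
      by (rule has_derivative_compose[OF _ Y[unfolded has_field_derivative_def]])
        (use x in \<open>auto intro!: derivative_eq_intros\<close>)
    have 2: "((\<lambda>x::'m pt. R n (norm x)) has_derivative (\<lambda>k. R' n (norm x) * (k \<bullet> sgn x))) (at x)"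
      by (rule has_derivative_compose[OF has_derivative_norm[OF On(1)[OF x]] R[unfolded has_field_derivative_def, OF On(2)[OF x]]])
    have 3: "((\<lambda>x. g x \<bullet> b) has_derivative (\<lambda>k. G x k \<bullet> b)) (at x)"
      using G(3)[OF Ow[OF x]] by (rule has_derivative_inner_left)
    show ?thesis
      unfolding h_def[abs_def] D_def[abs_def]
      by (rule has_derivative_eq_rhs[OF has_derivative_mult[OF has_derivative_mult[OF has_derivative_mult[OF 1 2] P[OF x]] 3]])
        (auto simp: algebra_simps fun_eq_iff)
  qed
  have cD: "continuous_on ?O (\<lambda>x. D n b x b')" for n b b'
  proof -
    have cG: "continuous_on ?O (\<lambda>x. G x b')" "continuous_on ?O g"
      using G(4) cg continuous_on_subset[OF _ sub] by blast+
    have y0: "continuous_on ?O (\<lambda>x. snd (snd x) powr a)" for a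
      by (rule continuous_on_powr) (auto intro!: continuous_intros)
    have n0: "continuous_on ?O (\<lambda>x. norm x powr a)" for a
      by (rule continuous_on_powr) (use On in \<open>auto intro!: continuous_intros\<close>)
    have s0: "continuous_on ?O (\<lambda>x. sgn x)" using crad by (simp add: sgn_div_norm)
    show ?thesis
      unfolding D_def Y_def Y'_def R_def R'_def
      by (intro continuous_on_add continuous_on_mult continuous_on_inner continuous_on_diff continuous_cut
        y0 n0 s0 cG cP cdP continuous_on_const continuous_on_snd continuous_on_norm continuous_on_id)
  qed
  have int0: "(\<integral>x. indicator ?O x * D n b x b \<partial>lborel) = 0" "integrable lborel (\<lambda>x. indicator ?O x * D n b x b)"
    if n: "n > 0" for n b
  proof -
    let ?K = "cball 0 1 \<inter> {x::'m pt. snd (snd x) \<ge> 1 / real n}"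
    have "closed {x::'m pt. snd (snd x) \<ge> 1 / real n}" by (intro closed_Collect_le continuous_intros)
    then have K: "compact ?K" by (intro compact_Int_closed) auto
    have KO: "?K \<subseteq> ?O" using n by (auto intro: less_le_trans[of 0 "1 / real n"])
    have h0: "h n b x = 0" if "x \<notin> ?K" for x
    proof (cases "norm x \<le> 1")
      case True
      then have "snd (snd x) < 1 / real n" using that by auto
      then have "real n * snd (snd x) \<le> 1" using n by (simp add: field_simps)
      then show ?thesis by (simp add: h_def Y_def cutoff_eq_0)
    next
      case False
      then have "real n * (1 - norm x) \<le> 1" using n by (smt (verit) mult_nonneg_nonpos of_nat_0_le_iff)
      then show ?thesis by (simp add: h_def R_def cutoff_eq_0)
    qed
    show "(\<integral>x. indicator ?O x * D n b x b \<partial>lborel) = 0" "integrable lborel (\<lambda>x. indicator ?O x * D n b x b)"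
      by (rule integral_directional_derivative_zero[OF open_upper K KO h0 hD cD]; assumption)+
  qed
  define I where "I n x = indicator ?O x * (R n (norm x) * (snd (snd x)) powr (1 - 2 * s) *
    (cutoff' n (snd (snd x)) * snd (snd x) * (P x * q x) + cutoff n (snd (snd x)) * (dP x \<bullet> g x + P x * l x)))" for n x
  have sumD: "(\<Sum>b\<in>Basis. indicator ?O x * D n b x b) = I n x" for n x
  proof (cases "x \<in> ?O")
    case x: True
    let ?y = "snd (snd x)" and ?R = "R n (norm x)"
    have ind: "(\<Sum>b\<in>Basis. indicator ?O x * D n b x b) = (\<Sum>b\<in>Basis. D n b x b)" using x by simp
    have "(\<Sum>b\<in>Basis. D n b x b) = Y' n ?y * ?R * P x * (\<Sum>b\<in>Basis. snd (snd b) * (g x \<bullet> b))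
      + Y n ?y * R' n (norm x) * P x * (\<Sum>b\<in>Basis. (b \<bullet> sgn x) * (g x \<bullet> b))
      + Y n ?y * ?R * (\<Sum>b\<in>Basis. (dP x \<bullet> b) * (g x \<bullet> b))
      + Y n ?y * ?R * P x * (\<Sum>b\<in>Basis. G x b \<bullet> b)"
      by (simp only: D_def sum.distrib sum_distrib_left ac_simps)
    also have "(\<Sum>b\<in>Basis. snd (snd b) * (g x \<bullet> b)) = ((0, 0, 1) :: 'm pt) \<bullet> g x"
      unfolding euclidean_inner[of "(0, 0, 1)" "g x"] by (simp add: inner_prod_def)
    also have "\<dots> = ?y * q x" using G(1)[OF Ow[OF x]] by (simp add: inner_prod_def)
    also have "(\<Sum>b\<in>Basis. (b \<bullet> sgn x) * (g x \<bullet> b)) = sgn x \<bullet> g x"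
      unfolding euclidean_inner[of "sgn x" "g x"] by (simp add: inner_commute)
    also have "\<dots> = 0"
      using degree_zero_homogeneity(3)[OF f hom, of x 1] x by (simp add: sgn_div_norm inner_commute)
    also have "(\<Sum>b\<in>Basis. (dP x \<bullet> b) * (g x \<bullet> b)) = dP x \<bullet> g x"
      by (rule euclidean_inner[symmetric])
    \<comment> \<open>The subtracted term cancels against the derivative of y^(1-2s) in
      \<open>Y'\<close>, which is multiplied by y q and so gives (1 - 2s) y^(1-2s) q.\<close>
    also have "(\<Sum>b\<in>Basis. G x b \<bullet> b) = l x - (1 - 2 * s) * q x"
      using G(5)[OF Ow[OF x]] by simp
    also have "Y' n ?y * ?R * P x * (?y * q x) + Y n ?y * R' n (norm x) * P x * 0
      + Y n ?y * ?R * (dP x \<bullet> g x) + Y n ?y * ?R * P x * (l x - (1 - 2 * s) * q x) = I n x"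
    proof -
      have "?y powr (1 - 2 * s - 1) * ?y = ?y powr (1 - 2 * s)"
        using x powr_add[of ?y "1 - 2 * s - 1" 1] by simp
      then have "Y' n ?y * ?y = cutoff' n ?y * ?y powr (1 - 2 * s) * ?y + cutoff n ?y * ((1 - 2 * s) * ?y powr (1 - 2 * s))"
        by (simp add: Y'_def distrib_right mult.assoc)
      then have e: "Y' n ?y * ?R * P x * (?y * q x) = 
         (cutoff' n ?y * ?y powr (1 - 2 * s) * ?y + cutoff n ?y * ((1 - 2 * s) * ?y powr (1 - 2 * s))) * ?R * P x * q x"
        by (metis (no_types, opaque_lifting) mult.assoc mult.commute)
      show ?thesis unfolding e using x by (simp add: I_def Y_def algebra_simps)
    qed
    finally show ?thesis using ind by simp
  qed (simp add: I_def)
  have intI: "(\<integral>x. I n x \<partial>lborel) = 0" "integrable lborel (I n)" if n: "n > 0" for n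
  proof -
    have "(\<integral>x. (\<Sum>b\<in>Basis. indicator ?O x * D n b x b) \<partial>lborel) = (\<Sum>b\<in>Basis. (\<integral>x. indicator ?O x * D n b x b \<partial>lborel))"
      by (rule Bochner_Integration.integral_sum) (rule int0(2)[OF n])
    then show "(\<integral>x. I n x \<partial>lborel) = 0" by (simp only: sumD int0(1)[OF n] sum.neutral_const)
    have "integrable lborel (\<lambda>x. \<Sum>b\<in>Basis. indicator ?O x * D n b x b)"
      by (rule Bochner_Integration.integrable_sum) (rule int0(2)[OF n])
    then show "integrable lborel (I n)" by (simp only: sumD) 
  qed
  let ?M = "weighted_measure s :: 'm pt measure"
  define H where "H \<theta> = sphere_grad \<phi> \<theta> \<bullet> g \<theta> + \<phi> \<theta> * l \<theta>" for \<theta>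
  obtain C1 where C1: "\<And>\<theta>. \<theta> \<in> hemi \<Longrightarrow> \<bar>sphere_grad \<phi> \<theta> \<bullet> g \<theta>\<bar> \<le> C1"
    by (rule test_function_grad_bounded[OF \<phi> cg]) blast
  obtain C2 where C2: "\<And>\<theta>. \<theta> \<in> hemi \<Longrightarrow> \<bar>\<phi> \<theta> * l \<theta>\<bar> \<le> C2"
    by (rule test_function_product_bounded[OF \<phi> cl]) blast
  obtain C3 where C3: "\<And>\<theta>. \<theta> \<in> hemi \<Longrightarrow> \<bar>\<phi> \<theta> * q \<theta>\<bar> \<le> C3"
    by (rule test_function_product_bounded[OF \<phi> G(2)]) blast
  have hw: "hemi \<subseteq> {x::'m pt. wfun x > 0}" using hemi_wfun by auto
  have Hm: "H \<in> borel_measurable ?M"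
  proof -
    have c: "continuous_on hemi \<phi>" "continuous_on hemi (sphere_grad \<phi>)"
      by (rule jet_smooth_bounded[OF \<phi>s], assumption)+
    have "continuous_on hemi H"
      unfolding H_def by (intro continuous_intros c continuous_on_subset[OF cg hw] continuous_on_subset[OF cl hw])
    then show ?thesis
      unfolding measurable_weighted by (rule borel_measurable_continuous_on_restrict)
  qed
  define V where "V x = (snd (snd x) / norm x) powr (1 - 2 * s)" for x :: "'m pt"
  have Vb: "ball_weight s x = real DIM('m pt) * V x" for x :: "'m pt" by (simp add: ball_weight_def V_def)
  have Ix: "I n x = indicator half_ball x * (cutoff n (norm x) * cutoff n (1 - norm x) * V x *
      (cutoff' n (snd (snd x)) * snd (snd x) * (\<phi> (x /\<^sub>R norm x) * q (x /\<^sub>R norm x)) + cutoff n (snd (snd x)) * H (x /\<^sub>R norm x)))"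
    if n: "n > 0" for n x
  proof (cases "x \<in> half_ball")
    case True
    then have x: "x \<in> ?O" by (simp add: half_ball_def)
    define \<rho> where "\<rho> = norm x"
    define \<theta> where "\<theta> = x /\<^sub>R norm x"
    have \<rho>: "\<rho> > 0" using On(2)[OF x] by (simp add: \<rho>_def)
    have x\<theta>: "x = \<rho> *\<^sub>R \<theta>" using \<rho> by (simp add: \<theta>_def \<rho>_def)
    have \<theta>: "\<theta> \<in> hemi" "snd (snd \<theta>) > 0" using radial_hemi[of x] x by (auto simp: \<theta>_def hemi_def)
    have e: "g x = g \<theta> /\<^sub>R \<rho>" "q x = q \<theta> / \<rho>\<^sup>2" "l x = l \<theta> / \<rho>\<^sup>2" "P x = \<phi> \<theta>" "dP x = sphere_grad \<phi> \<theta> /\<^sub>R \<rho>"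
      using degree_zero_homogeneity(1,2)[OF f hom \<theta>(2) \<rho>, folded x\<theta>] hl[OF \<rho> \<theta>(2), folded x\<theta>]
        dPx[OF x, folded \<theta>_def \<rho>_def] by auto
    have pw: "\<rho> powr (2 * s + 1) * (snd (snd x)) powr (1 - 2 * s) = V x * \<rho>\<^sup>2"
    proof -
      have "V x = (snd (snd x)) powr (1 - 2 * s) / \<rho> powr (1 - 2 * s)"
        using x \<rho> by (simp add: V_def powr_divide \<rho>_def)
      then have "(snd (snd x)) powr (1 - 2 * s) = V x * \<rho> powr (1 - 2 * s)" using \<rho> by simp
      then have "\<rho> powr (2 * s + 1) * (snd (snd x)) powr (1 - 2 * s) = V x * (\<rho> powr (2 * s + 1) * \<rho> powr (1 - 2 * s))"
        by simp
      also have "\<rho> powr (2 * s + 1) * \<rho> powr (1 - 2 * s) = \<rho>\<^sup>2"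
        using \<rho> by (simp add: powr_add[symmetric])
      finally show ?thesis .
    qed
    have "I n x = cutoff n \<rho> * cutoff n (1 - \<rho>) * (\<rho> powr (2 * s + 1) * (snd (snd x)) powr (1 - 2 * s)) *
      (cutoff' n (snd (snd x)) * snd (snd x) * (\<phi> \<theta> * q \<theta> / \<rho>\<^sup>2) + cutoff n (snd (snd x)) * (H \<theta> / \<rho>\<^sup>2))"
      using x \<rho> by (simp add: I_def R_def \<rho>_def[symmetric] e H_def field_simps power2_eq_square)
    also have "\<dots> = cutoff n \<rho> * cutoff n (1 - \<rho>) * V x *
      (cutoff' n (snd (snd x)) * snd (snd x) * (\<phi> \<theta> * q \<theta>) + cutoff n (snd (snd x)) * H \<theta>)"
      unfolding pw using \<rho> by (simp add: field_simps)
    finally show ?thesis using True by (simp add: \<rho>_def \<theta>_def)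
  next
    case False
    show ?thesis
    proof (cases "x \<in> ?O")
      case True
      then have "norm x \<ge> 1" using False by (auto simp: half_ball_def)
      then have "real n * (1 - norm x) \<le> 1" by (smt (verit) mult_nonneg_nonpos of_nat_0_le_iff)
      then have "R n (norm x) = 0" by (simp add: R_def cutoff_eq_0)
      then show ?thesis using False by (simp add: I_def)
    qed (use False in \<open>simp add: I_def\<close>)
  qed
  \<comment> \<open>Here the Neumann condition takes effect: the term with \<open>cutoff'\<close>
    carries an extra factor y, so it is bounded by 2 \<open>C3\<close> uniformly in n and tends to 0
    pointwise. \<open>C1\<close> and \<open>C2\<close> bound the two parts of
    \<open>H\<close>.\<close>
  define C where "C = 2 * C3 + (C1 + C2)"
  have bound: "norm (I (Suc n) x) \<le> indicator half_ball x * (V x * C)" for n x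
  proof (cases "x \<in> half_ball")
    case True
    define \<theta> where "\<theta> = x /\<^sub>R norm x"
    have \<theta>: "\<theta> \<in> hemi" using radial_hemi[of x] True by (auto simp: \<theta>_def half_ball_def)
    let ?y = "snd (snd x)"
    have H: "\<bar>H \<theta>\<bar> \<le> C1 + C2" using C1[OF \<theta>] C2[OF \<theta>] by (simp add: H_def)
    have "\<bar>cutoff' (Suc n) ?y * ?y * (\<phi> \<theta> * q \<theta>)\<bar> \<le> 2 * C3"
      unfolding abs_mult[of _ "\<phi> \<theta> * q \<theta>"] using cutoff'_bound[of ?y "Suc n"] C3[OF \<theta>]
      by (intro mult_mono) (auto simp: mult.commute)
    moreover have "\<bar>cutoff (Suc n) ?y * H \<theta>\<bar> \<le> 1 * (C1 + C2)"
      unfolding abs_mult using cutoff_nonneg[of "Suc n" ?y] cutoff_le_1[of "Suc n" ?y] H by (intro mult_mono) auto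
    ultimately have b: "\<bar>cutoff' (Suc n) ?y * ?y * (\<phi> \<theta> * q \<theta>) + cutoff (Suc n) ?y * H \<theta>\<bar> \<le> C"
      by (simp add: C_def)
    have c: "0 \<le> cutoff (Suc n) (norm x) * cutoff (Suc n) (1 - norm x)" "cutoff (Suc n) (norm x) * cutoff (Suc n) (1 - norm x) \<le> 1"
      by (simp_all add: cutoff_nonneg cutoff_le_1 mult_le_one)
    have V: "V x \<ge> 0" by (simp add: V_def)
    have "norm (I (Suc n) x) = cutoff (Suc n) (norm x) * cutoff (Suc n) (1 - norm x) * (V x *
       \<bar>cutoff' (Suc n) ?y * ?y * (\<phi> \<theta> * q \<theta>) + cutoff (Suc n) ?y * H \<theta>\<bar>)"
      using True c V by (simp add: Ix \<theta>_def abs_mult cutoff_nonneg)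
    also have "\<dots> \<le> 1 * (V x * C)"
      using b c V by (intro mult_mono) auto
    finally show ?thesis using True by simp
  qed (simp add: Ix)
  have lim: "(\<lambda>n. I (Suc n) x) \<longlonglongrightarrow> indicator half_ball x * (V x * H (x /\<^sub>R norm x))" for x
  proof (cases "x \<in> half_ball")
    case True
    then have x: "snd (snd x) > 0" "norm x > 0" "1 - norm x > 0" using On by (auto simp: half_ball_def)
    have "(\<lambda>n. indicator half_ball x * (cutoff (Suc n) (norm x) * cutoff (Suc n) (1 - norm x) * V x *
      (cutoff' (Suc n) (snd (snd x)) * snd (snd x) * (\<phi> (x /\<^sub>R norm x) * q (x /\<^sub>R norm x)) + cutoff (Suc n) (snd (snd x)) * H (x /\<^sub>R norm x))))
      \<longlonglongrightarrow> indicator half_ball x * (1 * 1 * V x * (0 * snd (snd x) * (\<phi> (x /\<^sub>R norm x) * q (x /\<^sub>R norm x)) + 1 * H (x /\<^sub>R norm x)))"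
      by (intro tendsto_intros LIMSEQ_Suc[OF cutoff_tendsto] LIMSEQ_Suc[OF cutoff'_tendsto] x)
    then show ?thesis by (simp add: Ix)
  qed (simp add: Ix)
  have "integrable ?M (\<lambda>_. 1)"
    by (rule finite_measure.integrable_const[OF finite_measure_weighted[OF s]])
  then have "integrable lborel (\<lambda>x::'m pt. indicator half_ball x * (ball_weight s x * 1))"
    by (subst (asm) integral_weighted(2)) auto
  then have "integrable lborel (\<lambda>x::'m pt. (indicator half_ball x * (ball_weight s x * 1)) * (C / real DIM('m pt)))"
    by (rule integrable_mult_left)
  then have dom: "integrable lborel (\<lambda>x::'m pt. indicator half_ball x * (V x * C))"
    by (simp add: Vb mult.assoc)
  have Im: "(\<lambda>x. indicator half_ball x * (V x * H (x /\<^sub>R norm x))) \<in> borel_measurable lborel"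
    by (rule borel_measurable_LIMSEQ_real[OF lim]) (use intI(2) in auto)
  have "(\<lambda>n. \<integral>x. I (Suc n) x \<partial>lborel) \<longlonglongrightarrow> (\<integral>x. indicator half_ball x * (V x * H (x /\<^sub>R norm x)) \<partial>lborel)"
    by (rule integral_dominated_convergence[OF Im _ dom]) (use lim bound intI(2) in auto)
  then have "(\<lambda>n. 0) \<longlonglongrightarrow> (\<integral>x. indicator half_ball x * (V x * H (x /\<^sub>R norm x)) \<partial>lborel)"
    by (simp only: intI(1)[OF zero_less_Suc])
  then have z: "(\<integral>x. indicator half_ball x * (V x * H (x /\<^sub>R norm x)) \<partial>lborel) = 0"
    using LIMSEQ_unique tendsto_const by blast
  have "(\<integral>\<theta>. H \<theta> \<partial>?M) = (\<integral>x. indicator half_ball x * (ball_weight s x * H (x /\<^sub>R norm x)) \<partial>lborel)"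
    by (rule integral_weighted(1)[OF Hm])
  also have "\<dots> = (\<integral>x. real DIM('m pt) * (indicator half_ball x * (V x * H (x /\<^sub>R norm x))) \<partial>lborel)"
    by (rule Bochner_Integration.integral_cong) (auto simp: Vb)
  also have "\<dots> = 0" using z by simp
  finally show ?thesis by (simp only: H_def)
qed

subsection \<open>Square-integrable jets\<close>

lemma continuous_hemi_measurable:
  "continuous_on hemi f \<Longrightarrow> f \<in> borel_measurable (weighted_measure s)"
  unfolding measurable_weighted by (rule borel_measurable_continuous_on_restrict)

lemma jet_measurable:
  assumes "\<phi> \<in> smooth_closed_hemi"
  shows "\<phi> \<in> borel_measurable (weighted_measure s)" "sphere_grad \<phi> \<in> borel_measurable (weighted_measure s)"
  by (rule jet_smooth_bounded[OF assms], rule continuous_hemi_measurable, assumption)+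

lemma test_functions_smooth: "\<phi> \<in> test_functions \<Longrightarrow> \<phi> \<in> smooth_closed_hemi"
  by (simp add: test_functions_def)

lemma H1_measurable:
  assumes "p \<in> H1 s"
  shows "fst p \<in> borel_measurable (weighted_measure s)" "snd p \<in> borel_measurable (weighted_measure s)"
  using assms by (simp_all add: H1_def)

lemma H0_H1: "p \<in> H0 s \<Longrightarrow> p \<in> H1 s"
  by (simp add: H0_def)

lemma norm_sq_add_le: "(norm (a + b))\<^sup>2 \<le> 2 * (norm a)\<^sup>2 + 2 * (norm b)\<^sup>2" for a b :: "'a::real_inner"
proof -
  have "(norm (a + b))\<^sup>2 \<le> (norm a + norm b)\<^sup>2" by (intro power_mono norm_triangle_ineq) auto
  also have "\<dots> \<le> 2 * (norm a)\<^sup>2 + 2 * (norm b)\<^sup>2"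
    using sum_squares_bound[of "norm a" "norm b"] by (simp add: power2_sum)
  finally show ?thesis .
qed

text \<open>An element of \<open>H1\<close> lies at finite distance from some smooth jet, which is
  bounded, and the weighted measure is finite.\<close>

lemma H1_square_integrable:
  fixes p :: "'m::finite jet"
  assumes s: "0 < s" "s < 1" and p: "p \<in> H1 s"
  shows "(\<integral>\<^sup>+\<theta>. ennreal ((norm (snd p \<theta>))\<^sup>2 + (fst p \<theta>)\<^sup>2) \<partial>weighted_measure s) < \<infinity>"
proof -
  let ?M = "weighted_measure s :: 'm pt measure"
  from p have "\<forall>\<epsilon>>0. \<exists>\<phi>\<in>smooth_closed_hemi. sq_dist s p (jet \<phi>) < \<epsilon>" by (simp add: H1_def)
  then obtain \<phi> where \<phi>: "\<phi> \<in> smooth_closed_hemi" "sq_dist s p (jet \<phi>) < 1"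
    using zero_less_one by blast
  obtain C where C: "\<And>\<theta>. \<theta> \<in> hemi \<Longrightarrow> \<bar>\<phi> \<theta>\<bar> \<le> C" "\<And>\<theta>. \<theta> \<in> hemi \<Longrightarrow> norm (sphere_grad \<phi> \<theta>) \<le> C"
    by (rule jet_smooth_bounded[OF \<phi>(1)]) blast
  note [measurable] = H1_measurable[OF p] jet_measurable[OF \<phi>(1)]
  define d where "d \<theta> = (norm (snd p \<theta> - sphere_grad \<phi> \<theta>))\<^sup>2 + (fst p \<theta> - \<phi> \<theta>)\<^sup>2" for \<theta>
  have [measurable]: "d \<in> borel_measurable ?M" unfolding d_def by measurable
  have d0: "d \<theta> \<ge> 0" for \<theta> by (simp add: d_def)
  have lin: "P \<le> 2 * D + 2 * G \<Longrightarrow> Q \<le> 2 * E + 2 * H \<Longrightarrow> G \<le> F \<Longrightarrow> H \<le> F \<Longrightarrow> P + Q \<le> 2 * (D + E) + 4 * F"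
    for P Q D E F G H :: real by (smt (verit) distrib_left)
  have "(\<integral>\<^sup>+\<theta>. ennreal ((norm (snd p \<theta>))\<^sup>2 + (fst p \<theta>)\<^sup>2) \<partial>?M) \<le>
    (\<integral>\<^sup>+\<theta>. 2 * ennreal (d \<theta>) + ennreal (4 * C\<^sup>2) \<partial>?M)"
  proof (rule nn_integral_mono)
    fix \<theta> :: "'m pt" assume "\<theta> \<in> space ?M"
    then have \<theta>: "\<theta> \<in> hemi" by simp
    have "(norm (snd p \<theta>))\<^sup>2 \<le> 2 * (norm (snd p \<theta> - sphere_grad \<phi> \<theta>))\<^sup>2 + 2 * (norm (sphere_grad \<phi> \<theta>))\<^sup>2"
      using norm_sq_add_le[of "snd p \<theta> - sphere_grad \<phi> \<theta>" "sphere_grad \<phi> \<theta>"] by simp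
    moreover have "(fst p \<theta>)\<^sup>2 \<le> 2 * (fst p \<theta> - \<phi> \<theta>)\<^sup>2 + 2 * (\<phi> \<theta>)\<^sup>2"
      using norm_sq_add_le[of "fst p \<theta> - \<phi> \<theta>" "\<phi> \<theta>"] by simp
    moreover have "(norm (sphere_grad \<phi> \<theta>))\<^sup>2 \<le> C\<^sup>2" using C(2)[OF \<theta>] by (intro power_mono) auto
    moreover have "(\<phi> \<theta>)\<^sup>2 \<le> C\<^sup>2" using C(1)[OF \<theta>] by (metis abs_ge_zero power2_abs power_mono)
    ultimately have "(norm (snd p \<theta>))\<^sup>2 + (fst p \<theta>)\<^sup>2 \<le> 2 * d \<theta> + 4 * C\<^sup>2"
      unfolding d_def by (rule lin)
    then have "ennreal ((norm (snd p \<theta>))\<^sup>2 + (fst p \<theta>)\<^sup>2) \<le> ennreal (2 * d \<theta> + 4 * C\<^sup>2)" by (rule ennreal_leI)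
    also have "\<dots> = 2 * ennreal (d \<theta>) + ennreal (4 * C\<^sup>2)"
      using d0[of \<theta>] by (subst ennreal_plus) (auto simp: ennreal_mult)
    finally show "ennreal ((norm (snd p \<theta>))\<^sup>2 + (fst p \<theta>)\<^sup>2) \<le> 2 * ennreal (d \<theta>) + ennreal (4 * C\<^sup>2)" .
  qed
  also have "\<dots> = 2 * (\<integral>\<^sup>+\<theta>. ennreal (d \<theta>) \<partial>?M) + ennreal (4 * C\<^sup>2) * emeasure ?M (space ?M)"
    by (subst nn_integral_add) (simp_all add: nn_integral_cmult)
  also have "\<dots> < \<infinity>"
    using \<phi>(2) finite_weighted_measure[OF s, where 'm = 'm]
    by (auto simp: sq_dist_def jet_def d_def[symmetric] ennreal_mult_less_top less_top intro: less_trans)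
  finally show ?thesis .
qed

lemma integrable_inner_L2:
  fixes u v :: "'a \<Rightarrow> 'b::euclidean_space"
  assumes [measurable]: "u \<in> borel_measurable M" "v \<in> borel_measurable M"
    and "(\<integral>\<^sup>+\<theta>. ennreal ((norm (u \<theta>))\<^sup>2) \<partial>M) < \<infinity>" "(\<integral>\<^sup>+\<theta>. ennreal ((norm (v \<theta>))\<^sup>2) \<partial>M) < \<infinity>"
  shows "integrable M (\<lambda>\<theta>. u \<theta> \<bullet> v \<theta>)"
proof -
  have "integrable M (\<lambda>\<theta>. (norm (u \<theta>))\<^sup>2)" "integrable M (\<lambda>\<theta>. (norm (v \<theta>))\<^sup>2)"
    using assms(3,4) by (auto simp: integrable_iff_bounded)
  then have "integrable M (\<lambda>\<theta>. (norm (u \<theta>))\<^sup>2 + (norm (v \<theta>))\<^sup>2)" by (rule Bochner_Integration.integrable_add)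
  then show ?thesis
  proof (rule Bochner_Integration.integrable_bound)
    show "AE \<theta> in M. norm (u \<theta> \<bullet> v \<theta>) \<le> norm ((norm (u \<theta>))\<^sup>2 + (norm (v \<theta>))\<^sup>2)"
    proof (rule AE_I2)
      fix \<theta>
      have "\<bar>u \<theta> \<bullet> v \<theta>\<bar> \<le> norm (u \<theta>) * norm (v \<theta>)" by (rule Cauchy_Schwarz_ineq2)
      also have "\<dots> \<le> (norm (u \<theta>))\<^sup>2 + (norm (v \<theta>))\<^sup>2"
        using sum_squares_bound[of "norm (u \<theta>)" "norm (v \<theta>)"] mult_nonneg_nonneg[OF norm_ge_zero[of "u \<theta>"] norm_ge_zero[of "v \<theta>"]]
        by linarith
      finally show "norm (u \<theta> \<bullet> v \<theta>) \<le> norm ((norm (u \<theta>))\<^sup>2 + (norm (v \<theta>))\<^sup>2)" by simp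
    qed
  qed measurable
qed

definition L2_jet :: "real \<Rightarrow> 'm::finite jet \<Rightarrow> bool" where
  "L2_jet s p \<longleftrightarrow> fst p \<in> borel_measurable (weighted_measure s) \<and> snd p \<in> borel_measurable (weighted_measure s) \<and>
    (\<integral>\<^sup>+\<theta>. ennreal ((norm (snd p \<theta>))\<^sup>2 + (fst p \<theta>)\<^sup>2) \<partial>weighted_measure s) < \<infinity>"

lemma H1_L2: "0 < s \<Longrightarrow> s < 1 \<Longrightarrow> p \<in> H1 s \<Longrightarrow> L2_jet s p"
  using H1_square_integrable[of s p] H1_measurable[of p s] by (simp add: L2_jet_def)

lemma L2_jet_parts:
  assumes "L2_jet s p"
  shows "fst p \<in> borel_measurable (weighted_measure s)" "snd p \<in> borel_measurable (weighted_measure s)"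
   "(\<integral>\<^sup>+\<theta>. ennreal ((norm (fst p \<theta>))\<^sup>2) \<partial>weighted_measure s) < \<infinity>"
   "(\<integral>\<^sup>+\<theta>. ennreal ((norm (snd p \<theta>))\<^sup>2) \<partial>weighted_measure s) < \<infinity>"
proof -
  have "(\<integral>\<^sup>+\<theta>. ennreal ((norm (fst p \<theta>))\<^sup>2) \<partial>weighted_measure s) \<le> (\<integral>\<^sup>+\<theta>. ennreal ((norm (snd p \<theta>))\<^sup>2 + (fst p \<theta>)\<^sup>2) \<partial>weighted_measure s)"
    "(\<integral>\<^sup>+\<theta>. ennreal ((norm (snd p \<theta>))\<^sup>2) \<partial>weighted_measure s) \<le> (\<integral>\<^sup>+\<theta>. ennreal ((norm (snd p \<theta>))\<^sup>2 + (fst p \<theta>)\<^sup>2) \<partial>weighted_measure s)"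
    by (intro nn_integral_mono ennreal_leI; simp)+
  then show "(\<integral>\<^sup>+\<theta>. ennreal ((norm (fst p \<theta>))\<^sup>2) \<partial>weighted_measure s) < \<infinity>"
   "(\<integral>\<^sup>+\<theta>. ennreal ((norm (snd p \<theta>))\<^sup>2) \<partial>weighted_measure s) < \<infinity>"
    using assms unfolding L2_jet_def by (auto intro: le_less_trans)
qed (use assms in \<open>auto simp: L2_jet_def\<close>)

lemma L2_jet_integrable:
  assumes "L2_jet s p" "L2_jet s q"
  shows "integrable (weighted_measure s) (\<lambda>\<theta>. snd p \<theta> \<bullet> snd q \<theta>)"
    "integrable (weighted_measure s) (\<lambda>\<theta>. fst p \<theta> * fst q \<theta>)"
  using integrable_inner_L2[OF L2_jet_parts(2)[OF assms(1)] L2_jet_parts(2)[OF assms(2)] L2_jet_parts(4)[OF assms(1)] L2_jet_parts(4)[OF assms(2)]]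
    integrable_inner_L2[OF L2_jet_parts(1)[OF assms(1)] L2_jet_parts(1)[OF assms(2)] L2_jet_parts(3)[OF assms(1)] L2_jet_parts(3)[OF assms(2)]]
  by simp_all

lemma weighted_Young:
  fixes g u :: "'a::real_inner" and l v :: real
  assumes "\<delta> > 0"
  shows "\<bar>g \<bullet> u + l * v\<bar> \<le> \<delta> * ((norm g)\<^sup>2 + l\<^sup>2) + (1 / \<delta>) * ((norm u)\<^sup>2 + v\<^sup>2)"
proof -
  have y: "a * b \<le> \<delta> * a\<^sup>2 + (1 / \<delta>) * b\<^sup>2" for a b :: real
  proof -
    have "2 * (sqrt \<delta> * a) * (b / sqrt \<delta>) \<le> (sqrt \<delta> * a)\<^sup>2 + (b / sqrt \<delta>)\<^sup>2"
      by (rule sum_squares_bound)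
    then have "2 * (a * b) \<le> \<delta> * a\<^sup>2 + (1 / \<delta>) * b\<^sup>2"
      using assms by (simp add: power_mult_distrib power_divide)
    moreover have "0 \<le> \<delta> * a\<^sup>2 + (1 / \<delta>) * b\<^sup>2" using assms by simp
    ultimately show ?thesis by linarith
  qed
  have "\<bar>g \<bullet> u + l * v\<bar> \<le> norm g * norm u + \<bar>l\<bar> * \<bar>v\<bar>"
    using Cauchy_Schwarz_ineq2[of g u] abs_triangle_ineq[of "g \<bullet> u" "l * v"] by (simp add: abs_mult)
  also have "\<dots> \<le> (\<delta> * (norm g)\<^sup>2 + (1 / \<delta>) * (norm u)\<^sup>2) + (\<delta> * \<bar>l\<bar>\<^sup>2 + (1 / \<delta>) * \<bar>v\<bar>\<^sup>2)"
    by (intro add_mono y)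
  finally show ?thesis by (simp add: algebra_simps)
qed

text \<open>The pair \<open>X\<close> defines a linear functional on jets that is continuous for
  \<open>sq_dist\<close>, and test functions are dense in \<open>H0\<close>. Continuity is expressed
  through a weighted Young inequality, which avoids a Cauchy-Schwarz inequality for
  integrals.\<close>

lemma H0_functional_zero:
  fixes X :: "'m::finite jet"
  assumes s: "0 < s" "s < 1" and X: "L2_jet s X" and p: "p \<in> H0 s"
    and test: "\<And>\<phi>. \<phi> \<in> test_functions \<Longrightarrow> (\<integral>\<theta>. snd X \<theta> \<bullet> sphere_grad \<phi> \<theta> + fst X \<theta> * \<phi> \<theta> \<partial>weighted_measure s) = 0"
  shows "(\<integral>\<theta>. snd X \<theta> \<bullet> snd p \<theta> + fst X \<theta> * fst p \<theta> \<partial>weighted_measure s) = 0"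
proof -
  let ?M = "weighted_measure s :: 'm pt measure"
  define A where "A = (\<integral>\<theta>. (norm (snd X \<theta>))\<^sup>2 + (fst X \<theta>)\<^sup>2 \<partial>?M)"
  define z where "z = (\<integral>\<theta>. snd X \<theta> \<bullet> snd p \<theta> + fst X \<theta> * fst p \<theta> \<partial>?M)"
  have pL: "L2_jet s p" using H1_L2[OF s H0_H1[OF p]] .
  have [measurable]: "snd X \<in> borel_measurable ?M" "fst X \<in> borel_measurable ?M" 
    "snd p \<in> borel_measurable ?M" "fst p \<in> borel_measurable ?M"
    using L2_jet_parts[OF X] L2_jet_parts[OF pL] by auto
  have Xi: "integrable ?M (\<lambda>\<theta>. (norm (snd X \<theta>))\<^sup>2 + (fst X \<theta>)\<^sup>2)"
    using X by (simp add: L2_jet_def integrable_iff_bounded)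
  have A: "A \<ge> 0" unfolding A_def by (rule Bochner_Integration.integral_nonneg) simp
  have "\<bar>z\<bar> \<le> \<eta>" if \<eta>: "\<eta> > 0" for \<eta>
  proof -
    \<comment> \<open>This makes \<delta> A at most \<eta>/2, with A + 1 in place of A to exclude a
      zero denominator; the approximation error \<delta> \<eta>/2 becomes \<eta>/2 after division by
      \<delta>.\<close>
    define \<delta> where "\<delta> = (\<eta> / 2) * inverse (A + 1)"
    have \<delta>: "\<delta> > 0" using \<eta> A by (simp add: \<delta>_def)
    from p have "\<forall>\<epsilon>>0. \<exists>\<phi>\<in>test_functions. sq_dist s p (jet \<phi>) < \<epsilon>" by (simp add: H0_def)
    moreover have "ennreal (\<delta> * \<eta> / 2) > 0" using \<delta> \<eta> by simp
    ultimately obtain \<phi> where \<phi>: "\<phi> \<in> test_functions" "sq_dist s p (jet \<phi>) < ennreal (\<delta> * \<eta> / 2)" by blast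
    have \<phi>s: "\<phi> \<in> smooth_closed_hemi" by (rule test_functions_smooth[OF \<phi>(1)])
    note [measurable] = jet_measurable[OF \<phi>s]
    obtain C where C: "\<And>\<theta>. \<theta> \<in> hemi \<Longrightarrow> \<bar>\<phi> \<theta>\<bar> \<le> C" "\<And>\<theta>. \<theta> \<in> hemi \<Longrightarrow> norm (sphere_grad \<phi> \<theta>) \<le> C"
      by (rule jet_smooth_bounded[OF \<phi>s]) blast
    define d where "d \<theta> = (norm (snd p \<theta> - sphere_grad \<phi> \<theta>))\<^sup>2 + (fst p \<theta> - \<phi> \<theta>)\<^sup>2" for \<theta>
    have dm [measurable]: "d \<in> borel_measurable ?M" unfolding d_def by measurable
    have d0: "d \<theta> \<ge> 0" for \<theta> by (simp add: d_def)
    have dn: "(\<integral>\<^sup>+\<theta>. ennreal (d \<theta>) \<partial>?M) < ennreal (\<delta> * \<eta> / 2)" using \<phi>(2) by (simp add: sq_dist_def jet_def d_def)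
    then have di: "integrable ?M d" using d0 by (auto simp: integrable_iff_bounded intro: less_trans)
    have dI: "(\<integral>\<theta>. d \<theta> \<partial>?M) \<le> \<delta> * \<eta> / 2"
    proof -
      have "ennreal (\<integral>\<theta>. d \<theta> \<partial>?M) = (\<integral>\<^sup>+\<theta>. ennreal (d \<theta>) \<partial>?M)"
        by (rule nn_integral_eq_integral[symmetric, OF di]) (simp add: d0)
      then show ?thesis using dn \<delta> \<eta> by (metis ennreal_le_iff less_imp_le mult_pos_pos half_gt_zero)
    qed
    have "L2_jet s (jet \<phi>)"
    proof -
      have "jet \<phi> \<in> H1 s"
      proof -
        have "sq_dist s (jet \<phi>) (jet \<phi>) = 0" by (simp add: sq_dist_def)
        then show ?thesis using \<phi>s jet_measurable[OF \<phi>s] by (auto simp: H1_def jet_def intro!: bexI[of _ \<phi>])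
      qed
      then show ?thesis by (rule H1_L2[OF s])
    qed
    note i1 = L2_jet_integrable[OF X pL] and i2 = L2_jet_integrable[OF X this, unfolded jet_def fst_conv snd_conv]
    have "z = z - (\<integral>\<theta>. snd X \<theta> \<bullet> sphere_grad \<phi> \<theta> + fst X \<theta> * \<phi> \<theta> \<partial>?M)"
      using test[OF \<phi>(1)] by simp
    also have "\<dots> = (\<integral>\<theta>. (snd X \<theta> \<bullet> snd p \<theta> + fst X \<theta> * fst p \<theta>) - (snd X \<theta> \<bullet> sphere_grad \<phi> \<theta> + fst X \<theta> * \<phi> \<theta>) \<partial>?M)"
      unfolding z_def by (intro Bochner_Integration.integral_diff[symmetric] Bochner_Integration.integrable_add i1 i2)
    also have "\<dots> = (\<integral>\<theta>. snd X \<theta> \<bullet> (snd p \<theta> - sphere_grad \<phi> \<theta>) + fst X \<theta> * (fst p \<theta> - \<phi> \<theta>) \<partial>?M)"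
      by (rule Bochner_Integration.integral_cong) (simp_all add: inner_diff_right algebra_simps)
    finally have z: "z = \<dots>" .
    have "\<bar>z\<bar> \<le> (\<integral>\<theta>. \<bar>snd X \<theta> \<bullet> (snd p \<theta> - sphere_grad \<phi> \<theta>) + fst X \<theta> * (fst p \<theta> - \<phi> \<theta>)\<bar> \<partial>?M)"
      unfolding z using integral_norm_bound[of ?M "\<lambda>\<theta>. snd X \<theta> \<bullet> (snd p \<theta> - sphere_grad \<phi> \<theta>) + fst X \<theta> * (fst p \<theta> - \<phi> \<theta>)"] by simp
    also have "\<dots> \<le> (\<integral>\<theta>. \<delta> * ((norm (snd X \<theta>))\<^sup>2 + (fst X \<theta>)\<^sup>2) + (1 / \<delta>) * d \<theta> \<partial>?M)"
    proof (rule integral_mono')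
      show "integrable ?M (\<lambda>\<theta>. \<delta> * ((norm (snd X \<theta>))\<^sup>2 + (fst X \<theta>)\<^sup>2) + (1 / \<delta>) * d \<theta>)"
        by (intro Bochner_Integration.integrable_add integrable_mult_right Xi di)
      show "\<bar>snd X \<theta> \<bullet> (snd p \<theta> - sphere_grad \<phi> \<theta>) + fst X \<theta> * (fst p \<theta> - \<phi> \<theta>)\<bar> \<le>
        \<delta> * ((norm (snd X \<theta>))\<^sup>2 + (fst X \<theta>)\<^sup>2) + (1 / \<delta>) * d \<theta>" for \<theta>
        unfolding d_def by (rule weighted_Young[OF \<delta>])
      show "0 \<le> \<delta> * ((norm (snd X \<theta>))\<^sup>2 + (fst X \<theta>)\<^sup>2) + (1 / \<delta>) * d \<theta>" for \<theta>
        using \<delta> d0 by simp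
    qed
    also have "\<dots> = \<delta> * A + (1 / \<delta>) * (\<integral>\<theta>. d \<theta> \<partial>?M)"
      unfolding A_def by (subst Bochner_Integration.integral_add) (simp_all add: Xi di)
    also have "\<dots> \<le> \<eta> / 2 + \<eta> / 2"
    proof (rule add_mono)
      have "\<delta> * A \<le> \<delta> * (A + 1)" using \<delta> by simp
      also have "\<dots> = \<eta> / 2"
      proof -
        have "A + 1 \<noteq> 0" using A by simp
        then show ?thesis unfolding \<delta>_def by (simp only: mult.assoc left_inverse mult_1_right not_False_eq_True)
      qed
      finally show "\<delta> * A \<le> \<eta> / 2" .
      have "(1 / \<delta>) * (\<integral>\<theta>. d \<theta> \<partial>?M) \<le> (1 / \<delta>) * (\<delta> * \<eta> / 2)" using dI \<delta> by (intro mult_left_mono) auto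
      then show "(1 / \<delta>) * (\<integral>\<theta>. d \<theta> \<partial>?M) \<le> \<eta> / 2" using \<delta> by simp
    qed
    finally show ?thesis by simp
  qed
  then have "\<bar>z\<bar> \<le> 0" by (meson dense_ge)
  then show ?thesis by (simp add: z_def)
qed

subsection \<open>The explicit solutions belong to the energy space\<close>

text \<open>Bounds on the gradient are recorded instead of continuity up to the boundary, because
  the gradients of w and v are bounded but have no limit at r = 0.\<close>

definition bdd_C1 :: "('m::finite pt \<Rightarrow> real) \<Rightarrow> bool" where
  "bdd_C1 Q \<longleftrightarrow> (\<exists>dQ C. \<forall>x. wfun x > 0 \<longrightarrow> (Q has_derivative (\<lambda>h. dQ x \<bullet> h)) (at x) \<and>
     (norm x \<le> 1 \<longrightarrow> \<bar>Q x\<bar> \<le> C \<and> norm (dQ x) \<le> C))"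

lemma bdd_C1I:
  assumes "\<And>x. wfun x > 0 \<Longrightarrow> (Q has_derivative (\<lambda>h. dQ x \<bullet> h)) (at x)"
    "\<And>x. wfun x > 0 \<Longrightarrow> norm x \<le> 1 \<Longrightarrow> \<bar>Q x\<bar> \<le> C" "\<And>x. wfun x > 0 \<Longrightarrow> norm x \<le> 1 \<Longrightarrow> norm (dQ x) \<le> C'"
  shows "bdd_C1 Q"
  unfolding bdd_C1_def
  by (rule exI[of _ dQ], rule exI[of _ "max C C'"]) (use assms in \<open>simp add: le_max_iff_disj\<close>)

lemma bdd_C1E:
  assumes "bdd_C1 Q"
  obtains dQ C where "\<And>x. wfun x > 0 \<Longrightarrow> (Q has_derivative (\<lambda>h. dQ x \<bullet> h)) (at x)"
    "\<And>x. wfun x > 0 \<Longrightarrow> norm x \<le> 1 \<Longrightarrow> \<bar>Q x\<bar> \<le> C" "\<And>x. wfun x > 0 \<Longrightarrow> norm x \<le> 1 \<Longrightarrow> norm (dQ x) \<le> C" "C \<ge> 0"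
proof -
  from assms obtain dQ C where *: "\<And>x. wfun x > 0 \<Longrightarrow> (Q has_derivative (\<lambda>h. dQ x \<bullet> h)) (at x)"
    "\<And>x. wfun x > 0 \<Longrightarrow> norm x \<le> 1 \<Longrightarrow> \<bar>Q x\<bar> \<le> C \<and> norm (dQ x) \<le> C"
    unfolding bdd_C1_def by blast
  show ?thesis
    by (rule that[OF *(1), of "max 0 C"]) (use * in \<open>simp_all add: le_max_iff_disj\<close>)
qed

lemma bdd_C1_const: "bdd_C1 (\<lambda>_. c)"
  by (rule bdd_C1I[where dQ = "\<lambda>_. 0" and C = "\<bar>c\<bar>" and C' = 0]) auto

lemma bdd_C1_inner: "bdd_C1 (\<lambda>x. x \<bullet> a)"
proof (rule bdd_C1I[where dQ = "\<lambda>_. a" and C = "norm a" and C' = "norm a"])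
  fix x :: "'a pt" assume x: "norm x \<le> 1"
  have "\<bar>x \<bullet> a\<bar> \<le> norm x * norm a" by (rule Cauchy_Schwarz_ineq2)
  also have "\<dots> \<le> norm a" using x by (simp add: mult_left_le_one_le)
  finally show "\<bar>x \<bullet> a\<bar> \<le> norm a" .
qed (auto intro!: derivative_eq_intros simp: inner_commute)

lemma bdd_C1_add:
  assumes "bdd_C1 P" "bdd_C1 Q" shows "bdd_C1 (\<lambda>x. P x + Q x)"
proof -
  obtain dP A where P: "\<And>x. wfun x > 0 \<Longrightarrow> (P has_derivative (\<lambda>h. dP x \<bullet> h)) (at x)"
    "\<And>x. wfun x > 0 \<Longrightarrow> norm x \<le> 1 \<Longrightarrow> \<bar>P x\<bar> \<le> A" "\<And>x. wfun x > 0 \<Longrightarrow> norm x \<le> 1 \<Longrightarrow> norm (dP x) \<le> A" "A \<ge> 0"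
    by (rule bdd_C1E[OF assms(1)]) blast
  obtain dQ B where Q: "\<And>x. wfun x > 0 \<Longrightarrow> (Q has_derivative (\<lambda>h. dQ x \<bullet> h)) (at x)"
    "\<And>x. wfun x > 0 \<Longrightarrow> norm x \<le> 1 \<Longrightarrow> \<bar>Q x\<bar> \<le> B" "\<And>x. wfun x > 0 \<Longrightarrow> norm x \<le> 1 \<Longrightarrow> norm (dQ x) \<le> B" "B \<ge> 0"
    by (rule bdd_C1E[OF assms(2)]) blast
  show ?thesis
  proof (rule bdd_C1I[where dQ = "\<lambda>x. dP x + dQ x" and C = "A + B" and C' = "A + B"])
    fix x :: "'a pt" assume w: "wfun x > 0"
    show "((\<lambda>x. P x + Q x) has_derivative (\<lambda>h. (dP x + dQ x) \<bullet> h)) (at x)"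
      using has_derivative_add[OF P(1)[OF w] Q(1)[OF w]] by (simp add: inner_add_left)
    assume x: "norm x \<le> 1"
    show "\<bar>P x + Q x\<bar> \<le> A + B" using P(2)[OF w x] Q(2)[OF w x] by linarith
    show "norm (dP x + dQ x) \<le> A + B" by (rule norm_triangle_le[OF add_mono[OF P(3)[OF w x] Q(3)[OF w x]]])
  qed
qed

lemma bdd_C1_mult:
  assumes "bdd_C1 P" "bdd_C1 Q" shows "bdd_C1 (\<lambda>x. P x * Q x)"
proof -
  obtain dP A where P: "\<And>x. wfun x > 0 \<Longrightarrow> (P has_derivative (\<lambda>h. dP x \<bullet> h)) (at x)"
    "\<And>x. wfun x > 0 \<Longrightarrow> norm x \<le> 1 \<Longrightarrow> \<bar>P x\<bar> \<le> A" "\<And>x. wfun x > 0 \<Longrightarrow> norm x \<le> 1 \<Longrightarrow> norm (dP x) \<le> A" "A \<ge> 0"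
    by (rule bdd_C1E[OF assms(1)]) blast
  obtain dQ B where Q: "\<And>x. wfun x > 0 \<Longrightarrow> (Q has_derivative (\<lambda>h. dQ x \<bullet> h)) (at x)"
    "\<And>x. wfun x > 0 \<Longrightarrow> norm x \<le> 1 \<Longrightarrow> \<bar>Q x\<bar> \<le> B" "\<And>x. wfun x > 0 \<Longrightarrow> norm x \<le> 1 \<Longrightarrow> norm (dQ x) \<le> B" "B \<ge> 0"
    by (rule bdd_C1E[OF assms(2)]) blast
  show ?thesis
  proof (rule bdd_C1I[where dQ = "\<lambda>x. P x *\<^sub>R dQ x + Q x *\<^sub>R dP x" and C = "A * B" and C' = "A * B + B * A"])
    fix x :: "'a pt" assume w: "wfun x > 0"
    show "((\<lambda>x. P x * Q x) has_derivative (\<lambda>h. (P x *\<^sub>R dQ x + Q x *\<^sub>R dP x) \<bullet> h)) (at x)"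
      by (rule has_derivative_eq_rhs[OF has_derivative_mult[OF P(1)[OF w] Q(1)[OF w]]])
        (auto simp: inner_add_left)
    assume x: "norm x \<le> 1"
    show "\<bar>P x * Q x\<bar> \<le> A * B" unfolding abs_mult using P(2)[OF w x] Q(2)[OF w x] P(4) by (intro mult_mono) auto
    have "norm (P x *\<^sub>R dQ x) \<le> A * B" "norm (Q x *\<^sub>R dP x) \<le> B * A"
      unfolding norm_scaleR using P(2,3)[OF w x] Q(2,3)[OF w x] P(4) Q(4) by (auto intro!: mult_mono)
    then show "norm (P x *\<^sub>R dQ x + Q x *\<^sub>R dP x) \<le> A * B + B * A" by (rule norm_triangle_le[OF add_mono])
  qed
qed

lemma bdd_C1_power: "bdd_C1 P \<Longrightarrow> bdd_C1 (\<lambda>x. P x ^ n)"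
  by (induction n) (auto intro: bdd_C1_const bdd_C1_mult)

lemma bdd_C1_sum: "finite I \<Longrightarrow> (\<And>i. i \<in> I \<Longrightarrow> bdd_C1 (f i)) \<Longrightarrow> bdd_C1 (\<lambda>x. \<Sum>i\<in>I. f i x)"
  by (induction I rule: finite_induct) (auto intro: bdd_C1_const bdd_C1_add)

lemma norm_dr: "wfun x > 0 \<Longrightarrow> norm (dr x) = 1"
  using wfun_pos_snd[of x] by (simp add: dr_def norm_Pair)

lemma bdd_C1_norm_snd: "bdd_C1 (\<lambda>x. norm (snd x))"
  by (rule bdd_C1I[where dQ = dr and C = 1 and C' = 1])
    (auto intro: has_wlap_derivative[OF has_wlap_r] order_trans[OF norm_components_le(2)] simp: norm_dr)

lemma bdd_C1_w: "bdd_C1 wfun" and bdd_C1_v: "bdd_C1 vfun"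
  using bdd_C1_add[OF bdd_C1_norm_snd bdd_C1_inner[of "- e_t"]] bdd_C1_add[OF bdd_C1_norm_snd bdd_C1_inner[of "e_t"]]
  by (simp_all add: wfun_def[abs_def] vfun_def[abs_def])

lemma bdd_C1_hpoly: "bdd_C1 (\<lambda>x. hpoly s j x * (x \<bullet> a) ^ n)"
  unfolding hpoly_def
  by (intro bdd_C1_mult bdd_C1_sum bdd_C1_power bdd_C1_const bdd_C1_inner bdd_C1_w bdd_C1_v) simp

section \<open>Cutting off the explicit solutions near the Dirichlet set\<close>

lemma sm_norm_snd: "sm n (\<lambda>x. norm (snd x))"
  using sm_rpow[of n 1] by simp

lemma sm_wfun: "sm n wfun"
  using sm_add[OF sm_norm_snd sm_minus[OF sm_fst_snd]] by (simp add: wfun_def[abs_def])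

lemma sm_vfun: "sm n vfun"
  using sm_add[OF sm_norm_snd sm_fst_snd] by (simp add: vfun_def[abs_def])

lemma sm_efun: "sm k (efun s j n a)"
  unfolding efun_def[abs_def] hpoly_def
  by (intro sm_mult sm_wpow sm_sum sm_const sm_power sm_wfun sm_vfun sm_inner)

lemma cutoff_test_function:
  fixes a :: "'m::finite pt"
  assumes "k > 0"
  shows "(\<lambda>x. cutoff k (wfun x) * efun s j n a x) \<in> test_functions"
proof -
  have "smooth_on UNIV (\<lambda>x. cutoff k (wfun x) * efun s j n a x)"
    by (rule smooth_cutoff[OF sm_efun assms])
  then have 1: "(\<lambda>x. cutoff k (wfun x) * efun s j n a x) \<in> smooth_closed_hemi"
    unfolding smooth_closed_hemi_def
    by (intro CollectI exI[of _ UNIV] exI[of _ "\<lambda>x. cutoff k (wfun x) * efun s j n a x"]) simp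
  let ?K = "closed_hemi \<inter> {x::'m pt. wfun x \<ge> 1 / real k}"
  have "closed {x::'m pt. wfun x \<ge> 1 / real k}" by (intro closed_Collect_le continuous_intros)
  then have "compact ?K" by (intro compact_Int_closed compact_closed_hemi)
  moreover have "?K \<subseteq> closed_hemi - S1_plus"
  proof -
    have "wfun \<theta> = 0" if "\<theta> \<in> S1_plus" for \<theta> :: "'m pt"
      using that by (simp add: S1_plus_def wfun_def norm_prod_def)
    then show ?thesis using assms by force
  qed
  moreover have "cutoff k (wfun \<theta>) * efun s j n a \<theta> = 0" if "\<theta> \<in> closed_hemi - ?K" for \<theta>
  proof -
    have "wfun \<theta> < 1 / real k" using that by auto
    then have "real k * wfun \<theta> \<le> 1" using assms by (simp add: field_simps)
    then show ?thesis by (simp add: cutoff_eq_0)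
  qed
  ultimately show ?thesis using 1 unfolding test_functions_def by blast
qed

lemma norm_tang: "norm \<theta> = 1 \<Longrightarrow> norm (tang \<theta> g) \<le> norm g"
proof -
  assume "norm \<theta> = 1"
  then have n: "\<theta> \<bullet> \<theta> = 1" by (simp add: dot_square_norm)
  have "(norm (tang \<theta> g))\<^sup>2 = g \<bullet> g - (g \<bullet> \<theta>)\<^sup>2"
    unfolding power2_norm_eq_inner tang_def
    by (simp add: inner_diff_left inner_diff_right n inner_commute power2_eq_square)
  also have "\<dots> \<le> (norm g)\<^sup>2" by (simp add: power2_norm_eq_inner)
  finally show ?thesis by (rule power2_le_imp_le) simp
qed

lemma tang_linear: "tang \<theta> (c *\<^sub>R u + d *\<^sub>R v) = c *\<^sub>R tang \<theta> u + d *\<^sub>R tang \<theta> v"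
  by (simp add: tang_def inner_add_left algebra_simps)

text \<open>With \<open>efun\<close> written as w^s Q, where Q and its gradient are bounded, the
  product rule gives w^s grad Q, bounded since w \<le> 2 on the sphere, and s w^(s-1) Q grad w,
  whose square is of order w^(2s-1)/r because |grad w|^2 = 2 w / r.\<close>

lemma efun_gradient_bound:
  fixes a :: "'m::finite pt"
  assumes s: "0 < s" "s < 1"
    and g: "\<And>\<theta>. \<theta> \<in> hemi \<Longrightarrow> (efun s j n a has_derivative (\<lambda>h. g \<theta> \<bullet> h)) (at \<theta>)"
  obtains C where "C \<ge> 0" "\<And>\<theta>. \<theta> \<in> hemi \<Longrightarrow> \<bar>efun s j n a \<theta>\<bar> \<le> C * wfun \<theta> powr s"
    "\<And>\<theta>. \<theta> \<in> hemi \<Longrightarrow> (norm (g \<theta>))\<^sup>2 \<le> C * (wfun \<theta> powr (2 * s - 1) / norm (snd \<theta>) + 1)"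
proof -
  define Q where "Q x = hpoly s j x * (x \<bullet> a) ^ n" for x
  have ef: "efun s j n a = (\<lambda>x. wfun x powr s * Q x)" by (simp add: efun_def[abs_def] Q_def mult.assoc)
  have "bdd_C1 Q" unfolding Q_def[abs_def] by (rule bdd_C1_hpoly)
  then obtain dQ A where Q: "\<And>x. wfun x > 0 \<Longrightarrow> (Q has_derivative (\<lambda>h. dQ x \<bullet> h)) (at x)"
    "\<And>x. wfun x > 0 \<Longrightarrow> norm x \<le> 1 \<Longrightarrow> \<bar>Q x\<bar> \<le> A" "\<And>x. wfun x > 0 \<Longrightarrow> norm x \<le> 1 \<Longrightarrow> norm (dQ x) \<le> A" "A \<ge> 0"
    by (rule bdd_C1E) blast
  have e1: "\<bar>efun s j n a \<theta>\<bar> \<le> A * wfun \<theta> powr s" if \<theta>: "\<theta> \<in> hemi" for \<theta>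
    using Q(2)[OF hemi_wfun[OF \<theta>]] hemi_norm(1)[OF \<theta>] by (simp add: ef abs_mult mult.commute mult_right_mono)
  have e2: "(norm (g \<theta>))\<^sup>2 \<le> (8 * A\<^sup>2) * (wfun \<theta> powr (2 * s - 1) / norm (snd \<theta>) + 1)" if \<theta>: "\<theta> \<in> hemi" for \<theta>
  proof -
    note w = hemi_wfun[OF \<theta>]
    define W where "W = wfun \<theta>"
    have W: "0 < W" "W \<le> 2" using w wfun_le[of \<theta>] norm_components_le(2)[of \<theta>] hemi_norm(1)[OF \<theta>] by (auto simp: W_def)
    have r: "norm (snd \<theta>) > 0" using wfun_pos_snd[OF w] by simp
    let ?D = "dr \<theta> - e_t"
    have nA: "norm \<theta> \<le> 1" using hemi_norm(1)[OF \<theta>] by simp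
    have "(efun s j n a has_derivative (\<lambda>h. (W powr s *\<^sub>R dQ \<theta> + (s * W powr (s - 1) * Q \<theta>) *\<^sub>R ?D) \<bullet> h)) (at \<theta>)"
      unfolding ef W_def
      by (rule has_derivative_eq_rhs[OF has_derivative_mult[OF has_wlap_derivative[OF has_wlap_w_powr w] Q(1)[OF w]]])
        (auto simp: inner_add_left)
    then have "g \<theta> = W powr s *\<^sub>R dQ \<theta> + (s * W powr (s - 1) * Q \<theta>) *\<^sub>R ?D"
      using g[OF \<theta>] by (intro GDERIV_unique) (simp_all add: gderiv_def inner_commute)
    then have "(norm (g \<theta>))\<^sup>2 \<le> 2 * (norm (W powr s *\<^sub>R dQ \<theta>))\<^sup>2 + 2 * (norm ((s * W powr (s - 1) * Q \<theta>) *\<^sub>R ?D))\<^sup>2"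
      using norm_sq_add_le by metis
    also have "(norm (W powr s *\<^sub>R dQ \<theta>))\<^sup>2 \<le> 4 * A\<^sup>2"
    proof -
      have "W powr s \<le> 2 powr s" using W s by (intro powr_mono2) auto
      also have "\<dots> \<le> 2 powr 1" using s by (intro powr_mono) auto
      finally have "norm (W powr s *\<^sub>R dQ \<theta>) \<le> 2 * A" using Q(3)[OF w nA] by (auto intro!: mult_mono)
      then have "(norm (W powr s *\<^sub>R dQ \<theta>))\<^sup>2 \<le> (2 * A)\<^sup>2" by (intro power_mono) auto
      then show ?thesis by (simp add: power_mult_distrib)
    qed
    also have "(norm ((s * W powr (s - 1) * Q \<theta>) *\<^sub>R ?D))\<^sup>2 \<le> 2 * A\<^sup>2 * (W powr (2 * s - 1) / norm (snd \<theta>))"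
    proof -
      have "(norm ?D)\<^sup>2 = 2 * W / norm (snd \<theta>)"
        unfolding power2_norm_eq_inner dr_inner(1)[OF w] W_def ..
      then have "(norm ((s * W powr (s - 1) * Q \<theta>) *\<^sub>R ?D))\<^sup>2 = s\<^sup>2 * (Q \<theta>)\<^sup>2 * ((W powr (s - 1))\<^sup>2 * (2 * W / norm (snd \<theta>)))"
        by (simp add: power_mult_distrib)
      also have "(W powr (s - 1))\<^sup>2 * (2 * W / norm (snd \<theta>)) = 2 * (W powr (2 * s - 1) / norm (snd \<theta>))"
      proof -
        have "(W powr (s - 1))\<^sup>2 * W = W powr (s - 1) * W powr (s - 1) * W powr 1" using W by (simp add: power2_eq_square)
        also have "\<dots> = W powr (2 * s - 1)" by (simp only: powr_add[symmetric]) simp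
        finally show ?thesis by simp
      qed
      also have "s\<^sup>2 * (Q \<theta>)\<^sup>2 * (2 * (W powr (2 * s - 1) / norm (snd \<theta>))) \<le> (1 * A\<^sup>2) * (2 * (W powr (2 * s - 1) / norm (snd \<theta>)))"
      proof (intro mult_right_mono mult_mono)
        show "s\<^sup>2 \<le> 1" using s by (simp add: power_le_one)
        show "(Q \<theta>)\<^sup>2 \<le> A\<^sup>2" using Q(2)[OF w nA] by (metis abs_ge_zero power2_abs power_mono)
      qed auto
      finally show ?thesis by (simp only: mult_1_left mult_ac)
    qed
    finally have "(norm (g \<theta>))\<^sup>2 \<le> 8 * A\<^sup>2 + 4 * A\<^sup>2 * (W powr (2 * s - 1) / norm (snd \<theta>))" by simp
    also have "\<dots> \<le> (8 * A\<^sup>2) * (W powr (2 * s - 1) / norm (snd \<theta>) + 1)"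
    proof -
      have gen: "8 * A\<^sup>2 + 4 * A\<^sup>2 * Z \<le> (8 * A\<^sup>2) * (Z + 1)" if "Z \<ge> 0" for Z
        using mult_nonneg_nonneg[OF zero_le_power2[of A] that] by (simp add: algebra_simps)
      show ?thesis by (rule gen) simp
    qed
    finally show ?thesis by (simp add: W_def)
  qed
  define C where "C = max A (8 * A\<^sup>2)"
  show ?thesis
  proof (rule that[of C])
    show "C \<ge> 0" using Q(4) by (simp add: C_def)
    fix \<theta> :: "'m pt" assume \<theta>: "\<theta> \<in> hemi"
    have "A * wfun \<theta> powr s \<le> C * wfun \<theta> powr s" by (intro mult_right_mono) (auto simp: C_def)
    then show "\<bar>efun s j n a \<theta>\<bar> \<le> C * wfun \<theta> powr s" using e1[OF \<theta>] by simp
    have "8 * A\<^sup>2 * (wfun \<theta> powr (2 * s - 1) / norm (snd \<theta>) + 1) \<le> C * (wfun \<theta> powr (2 * s - 1) / norm (snd \<theta>) + 1)"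
      by (intro mult_right_mono) (auto simp: C_def)
    then show "(norm (g \<theta>))\<^sup>2 \<le> C * (wfun \<theta> powr (2 * s - 1) / norm (snd \<theta>) + 1)" using e2[OF \<theta>] by simp
  qed
qed

lemma wfun_borel [measurable]: "wfun \<in> borel_measurable (borel :: 'm::finite pt measure)"
  by (intro borel_measurable_continuous_onI continuous_intros)

text \<open>The approximants are the products with \<open>cutoff\<close> of w. In the gradient error
  the critical term is \<open>cutoff'\<close> times f times grad w; as f is of order w^s and w
  \<open>cutoff'\<close>(w) is bounded, its square is again at most of order w^(2s-1)/r. One
  integrable majorant thus serves all approximants and dominated convergence applies.\<close>

lemma efun_jet_H0:
  fixes a :: "'m::finite pt"
  assumes s: "0 < s" "s < 1"
    and g: "\<And>\<theta>. \<theta> \<in> hemi \<Longrightarrow> (efun s j n a has_derivative (\<lambda>h. g \<theta> \<bullet> h)) (at \<theta>)"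
    and G: "\<And>\<theta>. \<theta> \<in> hemi \<Longrightarrow> G \<theta> = tang \<theta> (g \<theta>)" "continuous_on hemi G"
  shows "(efun s j n a, G) \<in> H0 s"
proof -
  let ?M = "weighted_measure s :: 'm pt measure"
  define f where "f = efun s j n a"
  have cf: "continuous_on hemi f"
    unfolding f_def by (intro continuous_at_imp_continuous_on ballI, rule has_derivative_continuous, rule g)
  have fm [measurable]: "f \<in> borel_measurable ?M" and Gm [measurable]: "G \<in> borel_measurable ?M"
    by (intro continuous_hemi_measurable cf G(2))+
  obtain C where C: "C \<ge> 0" "\<And>\<theta>. \<theta> \<in> hemi \<Longrightarrow> \<bar>f \<theta>\<bar> \<le> C * wfun \<theta> powr s"
    "\<And>\<theta>. \<theta> \<in> hemi \<Longrightarrow> (norm (g \<theta>))\<^sup>2 \<le> C * (wfun \<theta> powr (2 * s - 1) / norm (snd \<theta>) + 1)"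
    unfolding f_def by (rule efun_gradient_bound[OF s g]) blast+
  define \<phi> where "\<phi> k x = cutoff (Suc k) (wfun x) * f x" for k x
  have \<phi>: "\<phi> k \<in> test_functions" for k
    unfolding \<phi>_def f_def by (rule cutoff_test_function) simp
  note \<phi>s = test_functions_smooth[OF \<phi>]
  have wD: "(wfun has_derivative (\<lambda>h. (dr \<theta> - e_t) \<bullet> h)) (at \<theta>)" if "\<theta> \<in> hemi" for \<theta>
    by (rule has_wlap_derivative[OF has_wlap_w hemi_wfun[OF that]])
  have sg: "sphere_grad (\<phi> k) \<theta> = (cutoff' (Suc k) (wfun \<theta>) * f \<theta>) *\<^sub>R tang \<theta> (dr \<theta> - e_t) + cutoff (Suc k) (wfun \<theta>) *\<^sub>R G \<theta>"
    if \<theta>: "\<theta> \<in> hemi" for k \<theta>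
  proof -
    have "((\<lambda>x. cutoff (Suc k) (wfun x)) has_derivative (\<lambda>h. cutoff' (Suc k) (wfun \<theta>) * ((dr \<theta> - e_t) \<bullet> h))) (at \<theta>)"
      by (rule has_derivative_compose[OF wD[OF \<theta>] cutoff_DERIV[unfolded has_field_derivative_def]])
    from has_derivative_mult[OF this g[OF \<theta>]]
    have "(\<phi> k has_derivative (\<lambda>h. ((cutoff' (Suc k) (wfun \<theta>) * f \<theta>) *\<^sub>R (dr \<theta> - e_t) + cutoff (Suc k) (wfun \<theta>) *\<^sub>R g \<theta>) \<bullet> h)) (at \<theta>)"
      unfolding \<phi>_def[abs_def] f_def
      by (rule has_derivative_eq_rhs) (auto simp: inner_add_left mult_ac)
    from sphere_grad_hemi[OF \<theta> refl this] show ?thesis by (simp only: tang_linear G(1)[OF \<theta>])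
  qed
  define d where "d k \<theta> = (norm (G \<theta> - sphere_grad (\<phi> k) \<theta>))\<^sup>2 + (f \<theta> - \<phi> k \<theta>)\<^sup>2" for k \<theta>
  \<comment> \<open>The constants 2 C and 16 C^2 come from the two gradient terms, doubled by
    \<open>norm_sq_add_le\<close>; 4 C^2 bounds the zeroth-order error, since w^s \<le> 2.\<close>
  define B where "B \<theta> = (2 * C + 16 * C\<^sup>2) * (wfun \<theta> powr (2 * s - 1) / norm (snd \<theta>) + 1) + 4 * C\<^sup>2" for \<theta> :: "'m pt"
  have bound: "d k \<theta> \<le> B \<theta>" if \<theta>: "\<theta> \<in> hemi" for k \<theta>
  proof -
    define W where "W = wfun \<theta>"
    define r where "r = norm (snd \<theta>)"
    define c where "c = cutoff (Suc k) W"
    define c' where "c' = cutoff' (Suc k) W"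
    note w = hemi_wfun[OF \<theta>]
    have W: "0 < W" "W \<le> 2" using w wfun_le[of \<theta>] norm_components_le(2)[of \<theta>] hemi_norm(1)[OF \<theta>] by (auto simp: W_def)
    have r: "r > 0" using wfun_pos_snd[OF w] by (simp add: r_def)
    have c: "0 \<le> c" "c \<le> 1" by (simp_all add: c_def cutoff_nonneg cutoff_le_1)
    have c'W: "(c' * W)\<^sup>2 \<le> 4"
    proof -
      have "\<bar>c' * W\<bar> \<le> 2" using cutoff'_bound[of W "Suc k"] by (simp add: c'_def mult.commute)
      then have "\<bar>c' * W\<bar>\<^sup>2 \<le> 2\<^sup>2" by (intro power_mono) auto
      then show ?thesis by simp
    qed
    let ?T = "tang \<theta> (dr \<theta> - e_t)"
    have fW: "(f \<theta>)\<^sup>2 \<le> C\<^sup>2 * (W powr s)\<^sup>2"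
    proof -
      have "\<bar>f \<theta>\<bar>\<^sup>2 \<le> (C * W powr s)\<^sup>2" using C(2)[OF \<theta>] by (intro power_mono) (auto simp: W_def)
      then show ?thesis by (simp add: power_mult_distrib)
    qed
    have "W powr s \<le> 2 powr s" using W s by (intro powr_mono2) auto
    also have "\<dots> \<le> 2 powr 1" using s by (intro powr_mono) auto
    finally have "(W powr s)\<^sup>2 \<le> 2\<^sup>2" by (intro power_mono) auto
    then have f4: "(f \<theta>)\<^sup>2 \<le> 4 * C\<^sup>2" 
      using fW mult_left_mono[of "(W powr s)\<^sup>2" 4 "C\<^sup>2"] by simp
    have "(f \<theta> - \<phi> k \<theta>)\<^sup>2 = (1 - c)\<^sup>2 * (f \<theta>)\<^sup>2"
      by (simp add: \<phi>_def c_def W_def power_mult_distrib[symmetric] algebra_simps)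
    also have "\<dots> \<le> 1 * (4 * C\<^sup>2)" using c f4 by (intro mult_mono) (auto simp: power_le_one)
    finally have d2: "(f \<theta> - \<phi> k \<theta>)\<^sup>2 \<le> 4 * C\<^sup>2" by simp
    have "G \<theta> - sphere_grad (\<phi> k) \<theta> = (1 - c) *\<^sub>R G \<theta> + (- (c' * f \<theta>)) *\<^sub>R ?T"
      using sg[OF \<theta>] by (simp add: c_def c'_def W_def algebra_simps)
    then have "(norm (G \<theta> - sphere_grad (\<phi> k) \<theta>))\<^sup>2 \<le> 2 * (norm ((1 - c) *\<^sub>R G \<theta>))\<^sup>2 + 2 * (norm ((- (c' * f \<theta>)) *\<^sub>R ?T))\<^sup>2"
      using norm_sq_add_le by metis
    also have "(norm ((1 - c) *\<^sub>R G \<theta>))\<^sup>2 \<le> C * (W powr (2 * s - 1) / r + 1)"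
    proof -
      have "norm ((1 - c) *\<^sub>R G \<theta>) \<le> 1 * norm (G \<theta>)" unfolding norm_scaleR using c by (intro mult_right_mono) auto
      also have "\<dots> \<le> norm (g \<theta>)" using norm_tang[OF hemi_norm(1)[OF \<theta>]] by (simp add: G(1)[OF \<theta>])
      finally have "(norm ((1 - c) *\<^sub>R G \<theta>))\<^sup>2 \<le> (norm (g \<theta>))\<^sup>2" by (intro power_mono) auto
      also have "\<dots> \<le> C * (W powr (2 * s - 1) / r + 1)" using C(3)[OF \<theta>] by (simp add: W_def r_def)
      finally show ?thesis .
    qed
    also have "(norm ((- (c' * f \<theta>)) *\<^sub>R ?T))\<^sup>2 \<le> 8 * C\<^sup>2 * (W powr (2 * s - 1) / r)"
    proof -
      have T: "(norm ?T)\<^sup>2 \<le> 2 * W / r"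
      proof -
        have "(norm ?T)\<^sup>2 \<le> (norm (dr \<theta> - e_t))\<^sup>2" by (intro power_mono norm_tang hemi_norm \<theta>) auto
        also have "\<dots> = 2 * W / r" unfolding power2_norm_eq_inner dr_inner(1)[OF w] W_def r_def ..
        finally show ?thesis .
      qed
      have "(norm ((- (c' * f \<theta>)) *\<^sub>R ?T))\<^sup>2 = c'\<^sup>2 * (f \<theta>)\<^sup>2 * (norm ?T)\<^sup>2"
        by (simp add: power_mult_distrib abs_mult)
      also have "\<dots> \<le> c'\<^sup>2 * (C\<^sup>2 * (W powr s)\<^sup>2) * (2 * W / r)"
        using fW T by (intro mult_mono mult_left_mono) auto
      also have "\<dots> = (c' * W)\<^sup>2 * (2 * C\<^sup>2 * ((W powr s)\<^sup>2 / W / r))"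
        using W r by (simp add: field_simps power2_eq_square)
      also have "(W powr s)\<^sup>2 / W = W powr (2 * s - 1)"
      proof -
        have "(W powr s)\<^sup>2 / W = W powr s * W powr s / W powr 1" using W by (simp add: power2_eq_square)
        also have "\<dots> = W powr (2 * s - 1)" by (simp only: powr_add[symmetric] powr_diff[symmetric]) simp
        finally show ?thesis .
      qed
      also have "(c' * W)\<^sup>2 * (2 * C\<^sup>2 * (W powr (2 * s - 1) / r)) \<le> 4 * (2 * C\<^sup>2 * (W powr (2 * s - 1) / r))"
        using c'W r by (intro mult_right_mono) auto
      finally show ?thesis by simp
    qed
    finally have "(norm (G \<theta> - sphere_grad (\<phi> k) \<theta>))\<^sup>2 \<le> 2 * (C * (W powr (2 * s - 1) / r + 1)) + 2 * (8 * C\<^sup>2 * (W powr (2 * s - 1) / r))"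
      by simp
    also have "\<dots> \<le> (2 * C + 16 * C\<^sup>2) * (W powr (2 * s - 1) / r + 1)"
      by (simp add: algebra_simps)
    finally show ?thesis using d2 by (simp add: d_def B_def W_def r_def)
  qed
  have lim: "(\<lambda>k. d k \<theta>) \<longlonglongrightarrow> 0" if \<theta>: "\<theta> \<in> hemi" for \<theta>
  proof -
    note w = hemi_wfun[OF \<theta>]
    have "(\<lambda>k. (norm (G \<theta> - ((cutoff' (Suc k) (wfun \<theta>) * f \<theta>) *\<^sub>R tang \<theta> (dr \<theta> - e_t) + cutoff (Suc k) (wfun \<theta>) *\<^sub>R G \<theta>)))\<^sup>2
        + (f \<theta> - cutoff (Suc k) (wfun \<theta>) * f \<theta>)\<^sup>2) \<longlonglongrightarrow>
       (norm (G \<theta> - ((0 * f \<theta>) *\<^sub>R tang \<theta> (dr \<theta> - e_t) + 1 *\<^sub>R G \<theta>)))\<^sup>2 + (f \<theta> - 1 * f \<theta>)\<^sup>2"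
      by (intro tendsto_intros LIMSEQ_Suc[OF cutoff_tendsto[OF w]] LIMSEQ_Suc[OF cutoff'_tendsto[OF w]])
    then show ?thesis by (simp add: d_def sg[OF \<theta>] \<phi>_def)
  qed
  have Bm: "(\<lambda>\<theta>. ennreal (B \<theta>)) \<in> borel_measurable ?M"
  proof -
    have "B \<in> borel_measurable borel" unfolding B_def[abs_def] by measurable
    then show ?thesis unfolding measurable_weighted by (auto intro!: measurable_restrict_space1)
  qed
  have Bfin: "(\<integral>\<^sup>+\<theta>. ennreal (B \<theta>) \<partial>?M) < \<infinity>"
  proof -
    let ?e = "\<lambda>\<theta>::'m pt. wfun \<theta> powr (2 * s - 1) / norm (snd \<theta>)"
    have "?e \<in> borel_measurable borel" by measurable
    then have em: "?e \<in> borel_measurable ?M" unfolding measurable_weighted by (rule measurable_restrict_space1)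
    then have "integrable ?M ?e"
      using singular_energy_finite[OF s, where 'm = 'm] by (auto simp: integrable_iff_bounded abs_mult)
    then have "integrable ?M B" unfolding B_def[abs_def]
      by (intro Bochner_Integration.integrable_add integrable_mult_right finite_measure.integrable_const[OF finite_measure_weighted[OF s]])
    then have "(\<integral>\<^sup>+\<theta>. ennreal (norm (B \<theta>)) \<partial>?M) < \<infinity>" by (simp add: integrable_iff_bounded)
    moreover have "B \<theta> \<ge> 0" for \<theta> using C(1) by (simp add: B_def)
    ultimately show ?thesis by simp
  qed
  have dm [measurable]: "d k \<in> borel_measurable ?M" for k
    using jet_measurable[OF \<phi>s[of k], of s] unfolding d_def by measurable
  have "(\<lambda>k. \<integral>\<^sup>+\<theta>. ennreal (d k \<theta>) \<partial>?M) \<longlonglongrightarrow> (\<integral>\<^sup>+\<theta>. 0 \<partial>?M)"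
  proof (rule nn_integral_dominated_convergence[OF _ _ Bm _ Bfin])
    show "AE \<theta> in ?M. ennreal (d k \<theta>) \<le> ennreal (B \<theta>)" for k
      by (rule AE_I2) (use bound in \<open>auto intro!: ennreal_leI\<close>)
    show "AE \<theta> in ?M. (\<lambda>k. ennreal (d k \<theta>)) \<longlonglongrightarrow> 0"
    proof (rule AE_I2)
      fix \<theta> :: "'m pt" assume "\<theta> \<in> space ?M"
      then have "(\<lambda>k. ennreal (d k \<theta>)) \<longlonglongrightarrow> ennreal 0" by (intro tendsto_ennrealI lim) simp
      then show "(\<lambda>k. ennreal (d k \<theta>)) \<longlonglongrightarrow> 0" by simp
    qed
  qed auto
  then have conv: "(\<lambda>k. sq_dist s (f, G) (jet (\<phi> k))) \<longlonglongrightarrow> 0"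
    by (simp add: sq_dist_def jet_def d_def)
  have approx: "\<exists>\<phi>\<in>test_functions. sq_dist s (f, G) (jet \<phi>) < \<epsilon>" if "\<epsilon> > 0" for \<epsilon>
  proof -
    have "\<forall>\<^sub>F k in sequentially. sq_dist s (f, G) (jet (\<phi> k)) < \<epsilon>"
      by (rule order_tendstoD(2)[OF conv that])
    then obtain k where "sq_dist s (f, G) (jet (\<phi> k)) < \<epsilon>" by (auto simp: eventually_sequentially)
    then show ?thesis using \<phi> by blast
  qed
  then have "\<exists>\<phi>\<in>smooth_closed_hemi. sq_dist s (f, G) (jet \<phi>) < \<epsilon>" if "\<epsilon> > 0" for \<epsilon>
    using that test_functions_smooth by blast
  then show ?thesis using approx fm Gm unfolding H0_def H1_def f_def by simp
qed

text \<open>On the sphere, the degree-zero extension of a homogeneous \<open>f\<close> of degree \<open>\<gamma>\<close> with weighted Laplacian \<open>l\<close> has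
  weighted Laplacian \<open>l - \<gamma> (\<gamma> + N - 2 s) f\<close>, where \<open>N = CARD('m) + 1\<close>.\<close>

lemma efun_weak_equation:
  fixes a :: "'m::finite pt"
  assumes s: "0 < s" "s < 1" and a: "snd a = 0"
  obtains G where "(efun s j n a, G) \<in> H0 s"
    "\<And>p. p \<in> H0 s \<Longrightarrow> (\<integral>\<theta>. G \<theta> \<bullet> snd p \<theta> \<partial>weighted_measure s) =
      (\<integral>\<theta>. ((real (j + n) + s) * (real (j + n) + real CARD('m) + 1 - s) * efun s j n a \<theta>
         - real n * (real n - 1) * (a \<bullet> a) * efun s j (n - 2) a \<theta>) * fst p \<theta> \<partial>weighted_measure s)"
proof -
  let ?M = "weighted_measure s :: 'm pt measure"
  define \<gamma> where "\<gamma> = real (j + n) + s"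
  define \<kappa> where "\<kappa> = real n * (real n - 1) * (a \<bullet> a)"
  define \<mu> where "\<mu> = \<gamma> * (\<gamma> + real CARD('m) + 1 - 2 * s)"
  have \<mu>: "\<mu> = (real (j + n) + s) * (real (j + n) + real CARD('m) + 1 - s)" by (simp add: \<mu>_def \<gamma>_def)
  obtain g q where gq: "has_wlap s (efun s j n a) g q (\<lambda>x. \<kappa> * efun s j (n - 2) a x)"
    unfolding \<kappa>_def using has_wlap_efun[OF s(1) a] by blast
  have hom: "efun s j n a (c *\<^sub>R x) = c powr \<gamma> * efun s j n a x" if "c > 0" for c and x :: "'m pt"
    unfolding \<gamma>_def by (rule efun_scale[OF that])
  define f where "f x = norm x powr - \<gamma> * efun s j n a x" for x
  define G where "G x = norm x powr - \<gamma> *\<^sub>R g x + efun s j n a x *\<^sub>R (- \<gamma> * norm x powr (- \<gamma> - 2)) *\<^sub>R x" for x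
  define l where "l x = norm x powr - \<gamma> * (\<kappa> * efun s j (n - 2) a x) - \<mu> * norm x powr (- \<gamma> - 2) * efun s j n a x" for x
  obtain q' where W: "has_wlap s f G q' l"
    unfolding f_def[abs_def] G_def[abs_def] l_def[abs_def] \<mu>_def using has_wlap_degree_zero[OF gq hom] by blast
  have fhom: "f (c *\<^sub>R x) = f x" if "c > 0" for c x
    using that by (simp add: f_def hom powr_mult powr_minus field_simps)
  have lhom: "l (c *\<^sub>R x) = l x / c\<^sup>2" if c: "c > 0" for c x
  proof -
    \<comment> \<open>A nonzero \<open>\<kappa>\<close> forces n \<ge> 2, so that
      \<open>n - 2\<close> is not truncated and the degree really drops by two.\<close>
    have 1: "c powr - \<gamma> * c powr (real (j + (n - 2)) + s) = 1 / c\<^sup>2" if "\<kappa> \<noteq> 0"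
    proof -
      have "n \<ge> 2" using that by (cases n; cases "n - 1") (auto simp: \<kappa>_def)
      then have "- \<gamma> + (real (j + (n - 2)) + s) = - 2" by (simp add: \<gamma>_def of_nat_diff)
      then have "c powr - \<gamma> * c powr (real (j + (n - 2)) + s) = c powr - 2" by (simp only: powr_add[symmetric])
      then show ?thesis using c by (simp add: powr_minus_divide)
    qed
    have 2: "c powr (- \<gamma> - 2) * c powr \<gamma> = 1 / c\<^sup>2"
    proof -
      have "c powr (- \<gamma> - 2) * c powr \<gamma> = c powr - 2" by (simp only: powr_add[symmetric]) simp
      then show ?thesis using c by (simp add: powr_minus_divide)
    qed
    have "l (c *\<^sub>R x) = \<kappa> * (c powr - \<gamma> * c powr (real (j + (n - 2)) + s)) * (norm x powr - \<gamma> * efun s j (n - 2) a x)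
        - \<mu> * (c powr (- \<gamma> - 2) * c powr \<gamma>) * (norm x powr (- \<gamma> - 2) * efun s j n a x)"
      unfolding l_def hom[OF c] efun_scale[OF c, of s j "n - 2"] using c by (simp add: powr_mult)
    also have "\<dots> = \<kappa> * (1 / c\<^sup>2) * (norm x powr - \<gamma> * efun s j (n - 2) a x)
        - \<mu> * (1 / c\<^sup>2) * (norm x powr (- \<gamma> - 2) * efun s j n a x)"
      unfolding 2 using 1 by (cases "\<kappa> = 0") auto
    also have "\<dots> = l x / c\<^sup>2" by (simp add: l_def diff_divide_distrib mult_ac)
    finally show ?thesis .
  qed
  have lsph: "l \<theta> = - (\<mu> * efun s j n a \<theta> - \<kappa> * efun s j (n - 2) a \<theta>)" if "\<theta> \<in> hemi" for \<theta>
    using hemi_norm(1)[OF that] by (simp add: l_def)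
  have Gsph: "G \<theta> = tang \<theta> (g \<theta>)" if \<theta>: "\<theta> \<in> hemi" for \<theta>
  proof -
    have "g \<theta> \<bullet> \<theta> = \<gamma> * efun s j n a \<theta>"
      by (rule homogeneous_gradient[OF hom has_wlap_derivative[OF gq hemi_wfun[OF \<theta>]]])
    then show ?thesis using hemi_norm(1)[OF \<theta>] by (simp add: G_def tang_def)
  qed
  have hw: "hemi \<subseteq> {x::'m pt. wfun x > 0}" using hemi_wfun by auto
  have cG: "continuous_on hemi G" by (rule continuous_on_subset[OF has_wlap_continuous(2)[OF W] hw])
  have H0: "(efun s j n a, G) \<in> H0 s"
    by (rule efun_jet_H0[OF s has_wlap_derivative[OF gq hemi_wfun] Gsph cG])
  have GL: "L2_jet s (efun s j n a, G)" by (rule H1_L2[OF s H0_H1[OF H0]])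
  define L where "L \<theta> = \<mu> * efun s j n a \<theta> - \<kappa> * efun s j (n - 2) a \<theta>" for \<theta>
  have eL2: "L2_jet s (efun s j n' a, \<lambda>_. 0)" for n'
  proof -
    obtain g q where gq: "has_wlap s (efun s j n' a) g q (\<lambda>x. real n' * (real n' - 1) * (a \<bullet> a) * efun s j (n' - 2) a x)"
      using has_wlap_efun[OF s(1) a] by blast
    have "continuous_on hemi (\<lambda>\<theta>. tang \<theta> (g \<theta>))"
      unfolding tang_def by (intro continuous_intros continuous_on_subset[OF has_wlap_continuous(2)[OF gq] hw])
    then have "(efun s j n' a, \<lambda>\<theta>. tang \<theta> (g \<theta>)) \<in> H0 s"
      by (intro efun_jet_H0[OF s has_wlap_derivative[OF gq hemi_wfun]]) auto
    from L2_jet_parts[OF H1_L2[OF s H0_H1[OF this]]] show ?thesis by (simp add: L2_jet_def)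
  qed
  \<comment> \<open>This pair represents the functional that sends p to the integral of
    \<open>G\<close> times the gradient of p minus \<open>L\<close> times p; Green's formula says
    that it vanishes on test functions.\<close>
  have LL2: "L2_jet s (\<lambda>\<theta>. - L \<theta>, G)"
  proof -
    note A = L2_jet_parts[OF eL2[of n]] and B = L2_jet_parts[OF eL2[of "n - 2"]]
    have [measurable]: "efun s j n a \<in> borel_measurable ?M" "efun s j (n - 2) a \<in> borel_measurable ?M" "G \<in> borel_measurable ?M"
      using A B L2_jet_parts(2)[OF GL] by auto
    have i: "integrable ?M (\<lambda>\<theta>. efun s j n a \<theta> * efun s j n a \<theta>)" "integrable ?M (\<lambda>\<theta>. efun s j (n - 2) a \<theta> * efun s j (n - 2) a \<theta>)"
      "integrable ?M (\<lambda>\<theta>. efun s j n a \<theta> * efun s j (n - 2) a \<theta>)" "integrable ?M (\<lambda>\<theta>. G \<theta> \<bullet> G \<theta>)"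
      using L2_jet_integrable(2)[OF eL2[of n] eL2[of n]] L2_jet_integrable(2)[OF eL2[of "n - 2"] eL2[of "n - 2"]]
        L2_jet_integrable(2)[OF eL2[of n] eL2[of "n - 2"]] L2_jet_integrable(1)[OF GL GL] by auto
    have "integrable ?M (\<lambda>\<theta>. G \<theta> \<bullet> G \<theta> + (\<mu>\<^sup>2 * (efun s j n a \<theta> * efun s j n a \<theta>) + \<kappa>\<^sup>2 * (efun s j (n - 2) a \<theta> * efun s j (n - 2) a \<theta>)
       + (- 2 * \<mu> * \<kappa>) * (efun s j n a \<theta> * efun s j (n - 2) a \<theta>)))"
      by (intro Bochner_Integration.integrable_add integrable_mult_right i)
    moreover have "G \<theta> \<bullet> G \<theta> + (\<mu>\<^sup>2 * (efun s j n a \<theta> * efun s j n a \<theta>) + \<kappa>\<^sup>2 * (efun s j (n - 2) a \<theta> * efun s j (n - 2) a \<theta>)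
       + (- 2 * \<mu> * \<kappa>) * (efun s j n a \<theta> * efun s j (n - 2) a \<theta>)) = (norm (G \<theta>))\<^sup>2 + (- L \<theta>)\<^sup>2" for \<theta>
      unfolding L_def power2_norm_eq_inner by (simp add: power2_eq_square algebra_simps)
    ultimately have "integrable ?M (\<lambda>\<theta>. (norm (G \<theta>))\<^sup>2 + (- L \<theta>)\<^sup>2)" by simp
    then have "(\<integral>\<^sup>+\<theta>. ennreal ((norm (G \<theta>))\<^sup>2 + (- L \<theta>)\<^sup>2) \<partial>?M) < \<infinity>" by (simp add: integrable_iff_bounded)
    moreover have "L \<in> borel_measurable ?M" unfolding L_def by measurable
    ultimately show ?thesis by (simp add: L2_jet_def)
  qed
  have main: "(\<integral>\<theta>. G \<theta> \<bullet> snd p \<theta> \<partial>?M) = (\<integral>\<theta>. L \<theta> * fst p \<theta> \<partial>?M)" if p: "p \<in> H0 s" for p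
  proof -
    have "(\<integral>\<theta>. snd (\<lambda>\<theta>. - L \<theta>, G) \<theta> \<bullet> snd p \<theta> + fst (\<lambda>\<theta>. - L \<theta>, G) \<theta> * fst p \<theta> \<partial>?M) = 0"
    proof (rule H0_functional_zero[OF s LL2 p])
      fix \<phi> :: "'m pt \<Rightarrow> real" assume \<phi>: "\<phi> \<in> test_functions"
      have "(\<integral>\<theta>. sphere_grad \<phi> \<theta> \<bullet> G \<theta> + \<phi> \<theta> * l \<theta> \<partial>?M) = 0"
        by (rule green_formula[OF s W fhom lhom \<phi>])
      moreover have "(\<integral>\<theta>. sphere_grad \<phi> \<theta> \<bullet> G \<theta> + \<phi> \<theta> * l \<theta> \<partial>?M) =
         (\<integral>\<theta>. snd (\<lambda>\<theta>. - L \<theta>, G) \<theta> \<bullet> sphere_grad \<phi> \<theta> + fst (\<lambda>\<theta>. - L \<theta>, G) \<theta> * \<phi> \<theta> \<partial>?M)"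
        by (rule Bochner_Integration.integral_cong) (simp_all add: lsph L_def inner_commute)
      ultimately show "(\<integral>\<theta>. snd (\<lambda>\<theta>. - L \<theta>, G) \<theta> \<bullet> sphere_grad \<phi> \<theta> + fst (\<lambda>\<theta>. - L \<theta>, G) \<theta> * \<phi> \<theta> \<partial>?M) = 0" by simp
    qed
    moreover have "(\<integral>\<theta>. G \<theta> \<bullet> snd p \<theta> + (- L \<theta>) * fst p \<theta> \<partial>?M) = (\<integral>\<theta>. G \<theta> \<bullet> snd p \<theta> \<partial>?M) + (\<integral>\<theta>. (- L \<theta>) * fst p \<theta> \<partial>?M)"
      using L2_jet_integrable[OF LL2 H1_L2[OF s H0_H1[OF p]]] by (intro Bochner_Integration.integral_add) auto
    ultimately show ?thesis by simp
  qed
  show ?thesis by (rule that[OF H0]) (use main in \<open>simp add: L_def \<mu> \<kappa>_def\<close>)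
qed

subsection \<open>Totality of the explicit solutions\<close>

text \<open>The linear span is given as a predicate, the form in which
  \<open>Stone_Weierstrass_HOL\<close> takes its subalgebra.\<close>

inductive lin_span :: "('a \<Rightarrow> real) set \<Rightarrow> ('a \<Rightarrow> real) \<Rightarrow> bool" for B where
  base: "f \<in> B \<Longrightarrow> lin_span B f"
| scale: "lin_span B f \<Longrightarrow> lin_span B (\<lambda>x. c * f x)"
| add: "lin_span B f \<Longrightarrow> lin_span B g \<Longrightarrow> lin_span B (\<lambda>x. f x + g x)"

lemma lin_span_mult:
  assumes B: "\<And>f g. f \<in> B \<Longrightarrow> g \<in> B \<Longrightarrow> (\<lambda>x. f x * g x) \<in> B"
    and f: "lin_span B f" and g: "lin_span B g"
  shows "lin_span B (\<lambda>x. f x * g x)"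
  using f
proof induction
  case (base f)
  from g show ?case
  proof induction
    case (base g)
    then show ?case using B \<open>f \<in> B\<close> by (intro lin_span.base)
  next
    case (scale g c)
    then show ?case using lin_span.scale[of B "\<lambda>x. f x * g x" c] by (simp add: mult.left_commute)
  next
    case (add g h)
    then show ?case using lin_span.add[of B "\<lambda>x. f x * g x" "\<lambda>x. f x * h x"] by (simp add: distrib_left)
  qed
next
  case (scale f c)
  then show ?case using lin_span.scale[of B "\<lambda>x. f x * g x" c] by (simp add: mult.assoc)
next
  case (add f h)
  then show ?case using lin_span.add[of B "\<lambda>x. f x * g x" "\<lambda>x. h x * g x"] by (simp add: distrib_right)
qed

text \<open>Closure under products makes the span of \<open>B\<close> an algebra, uniformly dense by
  Stone-Weierstrass, and \<open>L\<close> is bounded in the supremum norm. Linearity is assumed only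
  for continuous arguments, since \<open>L\<close> will be an integral. It is applied to
  exponentials on the ball of the x' and to products of powers of t with functions of x' on the
  closed half-sphere.\<close>

lemma annihilator_of_multiplicative_family:
  fixes S :: "'a::t2_space set" and L :: "('a \<Rightarrow> real) \<Rightarrow> real"
  assumes S: "compact S"
    and B: "\<And>f g. f \<in> B \<Longrightarrow> g \<in> B \<Longrightarrow> (\<lambda>x. f x * g x) \<in> B" "(\<lambda>_. 1) \<in> B"
      "\<And>f. f \<in> B \<Longrightarrow> continuous_on S f"
      "\<And>x y. x \<in> S \<Longrightarrow> y \<in> S \<Longrightarrow> x \<noteq> y \<Longrightarrow> \<exists>f\<in>B. f x \<noteq> f y"
    and L: "\<And>f g. continuous_on S f \<Longrightarrow> continuous_on S g \<Longrightarrow> L (\<lambda>x. f x + g x) = L f + L g"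
      "\<And>f c. continuous_on S f \<Longrightarrow> L (\<lambda>x. c * f x) = c * L f"
      "\<And>f e. continuous_on S f \<Longrightarrow> (\<And>x. x \<in> S \<Longrightarrow> \<bar>f x\<bar> \<le> e) \<Longrightarrow> \<bar>L f\<bar> \<le> C * e"
    and LB: "\<And>f. f \<in> B \<Longrightarrow> L f = 0"
    and f: "continuous_on S f"
  shows "L f = 0"
proof -
  have cont: "continuous_on S g" if "lin_span B g" for g
    using that by induction (auto intro: B continuous_intros)
  have L0: "L g = 0" if "lin_span B g" for g
    using that
  proof induction
    case (scale f c)
    then show ?case using L(2)[OF cont] by simp
  next
    case (add f g)
    then show ?case using L(1)[OF cont cont] by simp
  qed (rule LB)
  have "\<bar>L f\<bar> \<le> \<bar>C\<bar> * e" if e: "e > 0" for e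
  proof -
    have "\<exists>g. lin_span B g \<and> (\<forall>x\<in>S. \<bar>f x - g x\<bar> < e)"
    proof (rule Stone_Weierstrass_HOL[OF S _ _ _ _ _ f e])
      show "lin_span B (\<lambda>x. c)" for c using lin_span.scale[OF lin_span.base[OF B(2)], of c] by simp
      show "\<exists>h. lin_span B h \<and> h x \<noteq> h y" if "x \<in> S \<and> y \<in> S \<and> x \<noteq> y" for x y
        using B(4)[of x y] that by (auto intro: lin_span.base)
    qed (auto intro: cont lin_span.add lin_span_mult B(1))
    then obtain g where g: "lin_span B g" "\<And>x. x \<in> S \<Longrightarrow> \<bar>f x - g x\<bar> < e" by blast
    have c: "continuous_on S (\<lambda>x. f x + (-1) * g x)" by (intro continuous_intros f cont g)
    have "continuous_on S (\<lambda>x. (-1) * g x)" by (intro continuous_intros cont g)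
    from L(1)[OF f this] have "L (\<lambda>x. f x + (-1) * g x) = L f + (-1) * L g"
      by (simp only: L(2)[OF cont[OF g(1)]])
    moreover have "\<bar>L (\<lambda>x. f x + (-1) * g x)\<bar> \<le> C * e"
      by (rule L(3)[OF c]) (use g(2) in \<open>simp add: less_imp_le\<close>)
    ultimately have "\<bar>L f\<bar> \<le> C * e" using L0[OF g(1)] by simp
    also have "\<dots> \<le> \<bar>C\<bar> * e" using e by (intro mult_right_mono) auto
    finally show ?thesis .
  qed
  note le = this
  show ?thesis
  proof (rule ccontr)
    assume "L f \<noteq> 0"
    then have "\<bar>L f\<bar> > 0" by simp
    then have "\<bar>L f\<bar> \<le> \<bar>C\<bar> * (\<bar>L f\<bar> / (2 * (\<bar>C\<bar> + 1)))" by (intro le) (auto intro!: divide_pos_pos)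
    also have "\<dots> = (\<bar>C\<bar> / (\<bar>C\<bar> + 1)) * (\<bar>L f\<bar> / 2)" by (simp add: field_simps)
    also have "\<dots> \<le> 1 * (\<bar>L f\<bar> / 2)" by (intro mult_right_mono) auto
    finally show False using \<open>\<bar>L f\<bar> > 0\<close> by simp
  qed
qed

text \<open>\<open>leading d c p\<close>: \<open>p\<close> is a homogeneous polynomial of degree \<open>d\<close> in \<open>(t, r)\<close> whose \<open>t\<^sup>d\<close>-coefficient is \<open>c\<close>.\<close>

definition leading :: "nat \<Rightarrow> real \<Rightarrow> (real \<Rightarrow> real \<Rightarrow> real) \<Rightarrow> bool" where
  "leading d c p \<longleftrightarrow> (\<exists>b. \<forall>t r. p t r = c * t ^ d + (\<Sum>m<d. b m * t ^ m * r ^ (d - m)))"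

lemma leading_r: "leading d c p \<Longrightarrow> leading (Suc d) 0 (\<lambda>t r. r * p t r)"
proof -
  assume "leading d c p"
  then obtain b where b: "\<And>t r. p t r = c * t ^ d + (\<Sum>m<d. b m * t ^ m * r ^ (d - m))"
    unfolding leading_def by blast
  \<comment> \<open>After multiplication by r the former leading term is no longer a pure power of
    t; it becomes the entry with index d of the coefficient sequence.\<close>
  have "r * p t r = 0 * t ^ Suc d + (\<Sum>m<Suc d. (b(d := c)) m * t ^ m * r ^ (Suc d - m))" for t r
  proof -
    have "(\<Sum>m<d. (b(d := c)) m * t ^ m * r ^ (Suc d - m)) = r * (\<Sum>m<d. b m * t ^ m * r ^ (d - m))"
      unfolding sum_distrib_left by (intro sum.cong) (auto simp: Suc_diff_le)
    then show ?thesis by (simp add: b algebra_simps)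
  qed
  then show ?thesis unfolding leading_def by blast
qed

lemma leading_t: "leading d c p \<Longrightarrow> leading (Suc d) c (\<lambda>t r. t * p t r)"
proof -
  assume "leading d c p"
  then obtain b where b: "\<And>t r. p t r = c * t ^ d + (\<Sum>m<d. b m * t ^ m * r ^ (d - m))"
    unfolding leading_def by blast
  have "t * p t r = c * t ^ Suc d + (\<Sum>m<Suc d. (case m of 0 \<Rightarrow> 0 | Suc i \<Rightarrow> b i) * t ^ m * r ^ (Suc d - m))" for t r
    unfolding sum.lessThan_Suc_shift by (simp add: b distrib_left sum_distrib_left mult_ac)
  then show ?thesis unfolding leading_def by blast
qed

lemma leading_add: "leading d c p \<Longrightarrow> leading d c' p' \<Longrightarrow> leading d (c + c') (\<lambda>t r. p t r + p' t r)"
proof -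
  assume "leading d c p" "leading d c' p'"
  then obtain b b' where b: "\<And>t r. p t r = c * t ^ d + (\<Sum>m<d. b m * t ^ m * r ^ (d - m))"
    "\<And>t r. p' t r = c' * t ^ d + (\<Sum>m<d. b' m * t ^ m * r ^ (d - m))"
    unfolding leading_def by blast
  show ?thesis unfolding leading_def
    by (rule exI[of _ "\<lambda>m. b m + b' m"]) (simp add: b distrib_right sum.distrib)
qed

lemma leading_scale: "leading d c p \<Longrightarrow> leading d (k * c) (\<lambda>t r. k * p t r)"
proof -
  assume "leading d c p"
  then obtain b where b: "\<And>t r. p t r = c * t ^ d + (\<Sum>m<d. b m * t ^ m * r ^ (d - m))"
    unfolding leading_def by blast
  show ?thesis unfolding leading_def
    by (rule exI[of _ "\<lambda>m. k * b m"]) (simp add: b distrib_left sum_distrib_left mult.assoc)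
qed

lemma leading_sum:
  "finite I \<Longrightarrow> (\<And>i. i \<in> I \<Longrightarrow> leading d (c i) (p i)) \<Longrightarrow> leading d (\<Sum>i\<in>I. c i) (\<lambda>t r. \<Sum>i\<in>I. p i t r)"
proof (induction I rule: finite_induct)
  case empty
  show ?case unfolding leading_def by (rule exI[of _ "\<lambda>_. 0"]) simp
qed (simp add: leading_add)

lemma leading_product: "leading (i + l) ((-1) ^ i) (\<lambda>t r. (r - t) ^ i * (r + t) ^ l)"
proof (induction i)
  case 0
  show ?case
  proof (induction l)
    case 0
    show ?case unfolding leading_def by simp
  next
    case (Suc l)
    from leading_add[OF leading_r[OF Suc] leading_t[OF Suc]] show ?case by (simp add: algebra_simps)
  qed
next
  case (Suc i)
  from leading_add[OF leading_r[OF Suc] leading_scale[OF leading_t[OF Suc], of "-1"]]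
  show ?case by (simp add: algebra_simps)
qed

text \<open>The product (j - i) (j - i - s) is never negative at integers: both factors are positive
  for i < j because s < 1, and neither is positive for i \<ge> j. So each step of the recursion
  flips the sign or gives zero.\<close>

lemma coef_sign:
  assumes "0 < s" "s < 1" shows "0 \<le> (-1) ^ i * coef s j i"
proof (induction i)
  case (Suc i)
  have "0 \<le> (real j - real i) * (real j - real i - s)"
  proof (cases "i < j")
    case True
    then have "real j - real i \<ge> 1" by (metis Suc_leI of_nat_Suc of_nat_le_iff le_diff_eq add.commute)
    then show ?thesis using assms by (intro mult_nonneg_nonneg) auto
  next
    case False
    then show ?thesis using assms by (intro mult_nonpos_nonpos) auto
  qed
  then have "0 \<le> ((-1) ^ i * coef s j i) * (((real j - real i) * (real j - real i - s)) / ((real i + 1) * (real i + 1 + s)))"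
    using assms by (intro mult_nonneg_nonneg[OF Suc] divide_nonneg_nonneg) auto
  then show ?case by simp
qed simp

text \<open>The leading coefficient is nonzero because no cancellation can occur: the sign (-1)^i
  from (r - t)^i matches the alternating sign of \<open>coef\<close>, so all summands are
  nonnegative, and the one for i = 0 equals 1.\<close>

lemma hpoly_expansion:
  assumes "0 < s" "s < 1"
  obtains \<kappa> b where "\<kappa> \<noteq> 0"
    "\<And>x::'m::finite pt. hpoly s j x = \<kappa> * fst (snd x) ^ j + (\<Sum>m<j. b m * fst (snd x) ^ m * norm (snd x) ^ (j - m))"
proof -
  define \<kappa> where "\<kappa> = (\<Sum>i\<le>j. coef s j i * (-1) ^ i)"
  have "\<kappa> \<ge> (\<Sum>i\<in>{0}. coef s j i * (-1) ^ i)"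
    unfolding \<kappa>_def by (rule sum_mono2) (use coef_sign[OF assms] in \<open>auto simp: mult.commute\<close>)
  then have \<kappa>: "\<kappa> \<noteq> 0" by simp
  have "leading j \<kappa> (\<lambda>t r. \<Sum>i\<le>j. coef s j i * ((r - t) ^ i * (r + t) ^ (j - i)))"
    unfolding \<kappa>_def
  proof (rule leading_sum)
    fix i assume "i \<in> {..j}"
    then have "i + (j - i) = j" by simp
    then show "leading j (coef s j i * (-1) ^ i) (\<lambda>t r. coef s j i * ((r - t) ^ i * (r + t) ^ (j - i)))"
      using leading_scale[OF leading_product[of i "j - i"], of "coef s j i"] by simp
  qed simp
  then obtain b where "\<And>t r. (\<Sum>i\<le>j. coef s j i * ((r - t) ^ i * (r + t) ^ (j - i))) = \<kappa> * t ^ j + (\<Sum>m<j. b m * t ^ m * r ^ (j - m))"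
    unfolding leading_def by blast
  then show ?thesis using that[OF \<kappa>, of b] by (simp add: hpoly_def wfun_def vfun_def)
qed

text \<open>On the sphere r depends on x' alone, which is what allows powers of r to be absorbed
  into functions of x'.\<close>

lemma closed_hemi_norms:
  assumes "\<theta> \<in> closed_hemi"
  shows "fst \<theta> \<in> cball 0 1" "norm (snd \<theta>) = sqrt (1 - (norm (fst \<theta>))\<^sup>2)"
proof -
  have n: "norm \<theta> = 1" using assms by (simp add: closed_hemi_def)
  then show "fst \<theta> \<in> cball 0 1" using norm_components_le(1)[of \<theta>] by simp
  have "(norm (fst \<theta>))\<^sup>2 + (norm (snd \<theta>))\<^sup>2 = 1"
    using n by (simp add: norm_prod_def[of \<theta>])
  then have "(norm (snd \<theta>))\<^sup>2 = 1 - (norm (fst \<theta>))\<^sup>2" by simp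
  then show "norm (snd \<theta>) = sqrt (1 - (norm (fst \<theta>))\<^sup>2)" by (metis norm_ge_zero real_sqrt_unique)
qed

section \<open>Vanishing of an integrable density orthogonal to the explicit solutions\<close>

context
  fixes s :: real and \<omega> :: "'m::finite pt \<Rightarrow> real"
  assumes s: "0 < s" "s < 1" and \<omega>: "integrable (weighted_measure s) \<omega>"
begin

lemma annihilator_integrable:
  fixes P :: "'m pt \<Rightarrow> real"
  assumes "continuous_on closed_hemi P"
  shows "integrable (weighted_measure s) (\<lambda>\<theta>. \<omega> \<theta> * P \<theta>)"
proof -
  have "bounded (P ` closed_hemi)"
    using compact_continuous_image[OF assms compact_closed_hemi] compact_imp_bounded by blast
  then obtain K where K: "\<And>\<theta>. \<theta> \<in> closed_hemi \<Longrightarrow> \<bar>P \<theta>\<bar> \<le> K" by (auto simp: bounded_iff)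
  have [measurable]: "P \<in> borel_measurable (weighted_measure s)"
    by (rule continuous_hemi_measurable[OF continuous_on_subset[OF assms hemi_subset]])
  note [measurable] = borel_measurable_integrable[OF \<omega>]
  show ?thesis
  proof (rule Bochner_Integration.integrable_bound[OF integrable_mult_left[OF \<omega>, of K]])
    show "AE \<theta> in weighted_measure s. norm (\<omega> \<theta> * P \<theta>) \<le> norm (\<omega> \<theta> * K)"
    proof (rule AE_I2)
      fix \<theta> :: "'m pt" assume "\<theta> \<in> space (weighted_measure s)"
      then have "\<theta> \<in> closed_hemi" by (simp add: subsetD[OF hemi_subset])
      then have "\<bar>P \<theta>\<bar> \<le> \<bar>K\<bar>" using K[of \<theta>] by linarith
      then show "norm (\<omega> \<theta> * P \<theta>) \<le> norm (\<omega> \<theta> * K)" by (simp add: abs_mult mult_left_mono)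
    qed
  qed measurable
qed

lemma annihilator_bound:
  fixes P :: "'m pt \<Rightarrow> real"
  assumes P: "continuous_on closed_hemi P" and e: "\<And>\<theta>. \<theta> \<in> closed_hemi \<Longrightarrow> \<bar>P \<theta>\<bar> \<le> e"
  shows "\<bar>\<integral>\<theta>. \<omega> \<theta> * P \<theta> \<partial>weighted_measure s\<bar> \<le> (\<integral>\<theta>. \<bar>\<omega> \<theta>\<bar> \<partial>weighted_measure s) * e"
proof -
  have "\<bar>\<integral>\<theta>. \<omega> \<theta> * P \<theta> \<partial>weighted_measure s\<bar> \<le> (\<integral>\<theta>. \<bar>\<omega> \<theta> * P \<theta>\<bar> \<partial>weighted_measure s)"
    using integral_norm_bound[of "weighted_measure s" "\<lambda>\<theta>. \<omega> \<theta> * P \<theta>"] by simp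
  also have "\<dots> \<le> (\<integral>\<theta>. \<bar>\<omega> \<theta>\<bar> * e \<partial>weighted_measure s)"
  proof (rule integral_mono)
    show "integrable (weighted_measure s) (\<lambda>\<theta>. \<bar>\<omega> \<theta> * P \<theta>\<bar>)"
      by (rule integrable_abs[OF annihilator_integrable[OF P]])
    show "integrable (weighted_measure s) (\<lambda>\<theta>. \<bar>\<omega> \<theta>\<bar> * e)"
      by (intro integrable_mult_left integrable_abs \<omega>)
    fix \<theta> :: "'m pt" assume "\<theta> \<in> space (weighted_measure s)"
    then have "\<theta> \<in> closed_hemi" by (simp add: subsetD[OF hemi_subset])
    then show "\<bar>\<omega> \<theta> * P \<theta>\<bar> \<le> \<bar>\<omega> \<theta>\<bar> * e"
      using e[of \<theta>] by (simp add: abs_mult mult_left_mono)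
  qed
  also have "\<dots> = (\<integral>\<theta>. \<bar>\<omega> \<theta>\<bar> \<partial>weighted_measure s) * e" by simp
  finally show ?thesis .
qed

lemma continuous_on_horizontal:
  fixes g :: "real ^ 'm \<Rightarrow> real"
  assumes "continuous_on (cball 0 1) g"
  shows "continuous_on closed_hemi (\<lambda>\<theta>::'m pt. g (fst \<theta>))"
  by (rule continuous_on_compose2[OF assms]) (use closed_hemi_norms(1) in \<open>auto intro!: continuous_intros\<close>)

text \<open>Powers of single linear forms are not closed under products, whereas exponentials of
  linear forms are. The exponential series has partial sums bounded by exp |a| on the half-sphere,
  so orthogonality passes to the limit.\<close>

lemma annihilator_horizontal:
  fixes h :: "'m pt \<Rightarrow> real" and g :: "real ^ 'm \<Rightarrow> real"
  assumes h: "continuous_on UNIV h"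
    and orth: "\<And>n a. snd a = 0 \<Longrightarrow> (\<integral>\<theta>. \<omega> \<theta> * (h \<theta> * (\<theta> \<bullet> a) ^ n) \<partial>weighted_measure s) = 0"
    and g: "continuous_on (cball 0 1) g"
  shows "(\<integral>\<theta>. \<omega> \<theta> * (h \<theta> * g (fst \<theta>)) \<partial>weighted_measure s) = 0"
proof -
  let ?M = "weighted_measure s :: 'm pt measure"
  let ?L = "\<lambda>g. \<integral>\<theta>. \<omega> \<theta> * (h \<theta> * g (fst \<theta>)) \<partial>?M"
  let ?B = "range (\<lambda>a::real^'m. \<lambda>u. exp (u \<bullet> a))"
  have hc: "continuous_on closed_hemi h" using h continuous_on_subset by blast
  have "bounded (h ` closed_hemi)"
    using compact_continuous_image[OF hc compact_closed_hemi] compact_imp_bounded by blast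
  then obtain K where K: "\<And>\<theta>. \<theta> \<in> closed_hemi \<Longrightarrow> \<bar>h \<theta>\<bar> \<le> K" by (auto simp: bounded_iff)
  have c: "continuous_on closed_hemi (\<lambda>\<theta>. h \<theta> * g (fst \<theta>))" if "continuous_on (cball 0 1) g" for g
    by (intro continuous_intros hc continuous_on_horizontal that)
  have exp0: "?L (\<lambda>u. exp (u \<bullet> a)) = 0" for a
  proof -
    define S where "S k \<theta> = (\<Sum>n<k. (\<theta> \<bullet> ((a, 0) :: 'm pt)) ^ n / fact n)" for k \<theta>
    have Sc: "continuous_on closed_hemi (\<lambda>\<theta>. h \<theta> * S k \<theta>)" for k
      unfolding S_def by (intro continuous_intros hc) auto
    have S0: "(\<integral>\<theta>. \<omega> \<theta> * (h \<theta> * S k \<theta>) \<partial>?M) = 0" for k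
    proof -
      have i: "integrable ?M (\<lambda>\<theta>. inverse (fact n) * (\<omega> \<theta> * (h \<theta> * (\<theta> \<bullet> (a, 0)) ^ n)))" for n
        by (intro integrable_mult_right annihilator_integrable continuous_intros hc)
      have "(\<integral>\<theta>. \<omega> \<theta> * (h \<theta> * S k \<theta>) \<partial>?M) = (\<integral>\<theta>. (\<Sum>n<k. inverse (fact n) * (\<omega> \<theta> * (h \<theta> * (\<theta> \<bullet> (a, 0)) ^ n))) \<partial>?M)"
        by (rule Bochner_Integration.integral_cong) (auto simp: S_def sum_distrib_left divide_inverse mult_ac)
      also have "\<dots> = (\<Sum>n<k. (\<integral>\<theta>. inverse (fact n) * (\<omega> \<theta> * (h \<theta> * (\<theta> \<bullet> (a, 0)) ^ n)) \<partial>?M))"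
        by (rule Bochner_Integration.integral_sum) (rule i)
      also have "\<dots> = 0" using orth[of "(a, 0)"] by simp
      finally show ?thesis .
    qed
    have "(\<lambda>k. \<integral>\<theta>. \<omega> \<theta> * (h \<theta> * S k \<theta>) \<partial>?M) \<longlonglongrightarrow> ?L (\<lambda>u. exp (u \<bullet> a))"
    proof (rule integral_dominated_convergence)
      show "integrable ?M (\<lambda>\<theta>. \<bar>\<omega> \<theta>\<bar> * (K * exp (norm a)))"
        by (intro integrable_mult_left integrable_abs \<omega>)
      have "continuous_on (cball 0 1) (\<lambda>u::real^'m. exp (u \<bullet> a))" by (intro continuous_intros)
      from annihilator_integrable[OF c[OF this]]
      show "(\<lambda>\<theta>. \<omega> \<theta> * (h \<theta> * exp (fst \<theta> \<bullet> a))) \<in> borel_measurable ?M" by (rule borel_measurable_integrable)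
      show "(\<lambda>\<theta>. \<omega> \<theta> * (h \<theta> * S k \<theta>)) \<in> borel_measurable ?M" for k
        by (rule borel_measurable_integrable[OF annihilator_integrable[OF Sc]])
      have fa: "\<theta> \<bullet> (a, 0) = fst \<theta> \<bullet> a" for \<theta> :: "'m pt" by (simp add: inner_prod_def)
      show "AE \<theta> in ?M. (\<lambda>k. \<omega> \<theta> * (h \<theta> * S k \<theta>)) \<longlonglongrightarrow> \<omega> \<theta> * (h \<theta> * exp (fst \<theta> \<bullet> a))"
      proof (rule AE_I2)
        fix \<theta> :: "'m pt"
        have "(\<lambda>n. (fst \<theta> \<bullet> a) ^ n / fact n) sums exp (fst \<theta> \<bullet> a)"
          using exp_converges[of "fst \<theta> \<bullet> a"] by (simp add: divide_inverse mult.commute)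
        then have "(\<lambda>k. S k \<theta>) \<longlonglongrightarrow> exp (fst \<theta> \<bullet> a)" by (simp add: sums_def S_def fa)
        then show "(\<lambda>k. \<omega> \<theta> * (h \<theta> * S k \<theta>)) \<longlonglongrightarrow> \<omega> \<theta> * (h \<theta> * exp (fst \<theta> \<bullet> a))" by (intro tendsto_intros)
      qed
      show "AE \<theta> in ?M. norm (\<omega> \<theta> * (h \<theta> * S k \<theta>)) \<le> \<bar>\<omega> \<theta>\<bar> * (K * exp (norm a))" for k
      proof (rule AE_I2)
        fix \<theta> :: "'m pt" assume "\<theta> \<in> space ?M"
        then have \<theta>: "\<theta> \<in> closed_hemi" by (simp add: subsetD[OF hemi_subset])
        have n: "\<bar>fst \<theta> \<bullet> a\<bar> \<le> norm a"
        proof -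
          have "\<bar>fst \<theta> \<bullet> a\<bar> \<le> norm (fst \<theta>) * norm a" by (rule Cauchy_Schwarz_ineq2)
          also have "\<dots> \<le> norm a" using closed_hemi_norms(1)[OF \<theta>] by (simp add: mult_left_le_one_le)
          finally show ?thesis .
        qed
        have "\<bar>S k \<theta>\<bar> \<le> (\<Sum>n<k. norm a ^ n / fact n)"
          unfolding S_def fa
          by (rule order_trans[OF sum_abs]) (intro sum_mono, use n in \<open>auto simp: power_abs intro!: divide_right_mono power_mono\<close>)
        also have "\<dots> \<le> exp (norm a)"
          using sum_le_suminf[OF summable_exp_generic[of "norm a"], of "{..<k}"]
          by (simp add: exp_def divide_inverse mult.commute)
        finally have "\<bar>h \<theta> * S k \<theta>\<bar> \<le> K * exp (norm a)"
          unfolding abs_mult using K[OF \<theta>] by (intro mult_mono) auto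
        then show "norm (\<omega> \<theta> * (h \<theta> * S k \<theta>)) \<le> \<bar>\<omega> \<theta>\<bar> * (K * exp (norm a))"
          by (simp add: abs_mult[of "\<omega> \<theta>"] mult_left_mono)
      qed
    qed
    then have "(\<lambda>k. 0::real) \<longlonglongrightarrow> ?L (\<lambda>u. exp (u \<bullet> a))" by (simp only: S0)
    then show ?thesis using LIMSEQ_unique tendsto_const by blast
  qed
  show ?thesis
  proof (rule annihilator_of_multiplicative_family[where S = "cball 0 1" and L = ?L and B = ?B
        and C = "(\<integral>\<theta>. \<bar>\<omega> \<theta>\<bar> \<partial>?M) * \<bar>K\<bar>"])
    fix f f' assume "f \<in> ?B" "f' \<in> ?B"
    then obtain a a' where "f = (\<lambda>u. exp (u \<bullet> a))" "f' = (\<lambda>u. exp (u \<bullet> a'))" by auto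
    then have "(\<lambda>x. f x * f' x) = (\<lambda>u. exp (u \<bullet> (a + a')))" by (simp add: exp_add inner_add_right)
    then show "(\<lambda>x. f x * f' x) \<in> ?B" by blast
  next
    have "(\<lambda>_. 1) = (\<lambda>u::real^'m. exp (u \<bullet> 0))" by simp
    then show "(\<lambda>_. 1) \<in> ?B" by (rule range_eqI)
  next
    fix x y :: "real^'m" assume "x \<noteq> y"
    then have "(x - y) \<bullet> (x - y) \<noteq> 0" by simp
    then have "x \<bullet> (x - y) \<noteq> y \<bullet> (x - y)" by (simp add: inner_diff_left)
    then show "\<exists>f\<in>?B. f x \<noteq> f y" by (intro bexI[of _ "\<lambda>u. exp (u \<bullet> (x - y))"]) auto
  next
    fix f f' :: "real^'m \<Rightarrow> real" assume "continuous_on (cball 0 1) f" "continuous_on (cball 0 1) f'"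
    then show "?L (\<lambda>x. f x + f' x) = ?L f + ?L f'"
      using annihilator_integrable[OF c[of f]] annihilator_integrable[OF c[of f']] by (simp add: distrib_left)
  next
    fix f :: "real^'m \<Rightarrow> real" and k :: real
    have "?L (\<lambda>x. k * f x) = (\<integral>\<theta>. k * (\<omega> \<theta> * (h \<theta> * f (fst \<theta>))) \<partial>?M)"
      by (rule Bochner_Integration.integral_cong) auto
    then show "?L (\<lambda>x. k * f x) = k * ?L f" by simp
  next
    fix f :: "real^'m \<Rightarrow> real" and e assume f: "continuous_on (cball 0 1) f" "\<And>x. x \<in> cball 0 1 \<Longrightarrow> \<bar>f x\<bar> \<le> e"
    have "\<bar>?L f\<bar> \<le> (\<integral>\<theta>. \<bar>\<omega> \<theta>\<bar> \<partial>?M) * (\<bar>K\<bar> * e)"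
    proof (rule annihilator_bound[OF c[OF f(1)]])
      fix \<theta> :: "'m pt" assume \<theta>: "\<theta> \<in> closed_hemi"
      show "\<bar>h \<theta> * f (fst \<theta>)\<bar> \<le> \<bar>K\<bar> * e" unfolding abs_mult
        using K[OF \<theta>] f(2)[OF closed_hemi_norms(1)[OF \<theta>]] by (intro mult_mono) auto
    qed
    then show "\<bar>?L f\<bar> \<le> (\<integral>\<theta>. \<bar>\<omega> \<theta>\<bar> \<partial>?M) * \<bar>K\<bar> * e" by (simp add: mult.assoc)
  qed (use exp0 g in \<open>auto intro!: continuous_intros\<close>)
qed

text \<open>Strong induction on j for all \<open>g\<close> at once: in the expansion of
  \<open>hpoly\<close> each lower term t^m r^(j-m) g is t^m times another continuous function of x',
  hence covered by the induction hypothesis, and the leading coefficient can be divided out.\<close>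

lemma annihilator_powers:
  fixes g :: "real ^ 'm \<Rightarrow> real"
  assumes orth: "\<And>j n a. snd a = 0 \<Longrightarrow> (\<integral>\<theta>. \<omega> \<theta> * (hpoly s j \<theta> * (\<theta> \<bullet> a) ^ n) \<partial>weighted_measure s) = 0"
    and g: "continuous_on (cball 0 1) g"
  shows "(\<integral>\<theta>. \<omega> \<theta> * (fst (snd \<theta>) ^ j * g (fst \<theta>)) \<partial>weighted_measure s) = 0"
  using g
proof (induction j arbitrary: g rule: less_induct)
  case (less j)
  let ?M = "weighted_measure s :: 'm pt measure"
  obtain \<kappa> b where \<kappa>: "\<kappa> \<noteq> 0"
    and e: "\<And>x::'m pt. hpoly s j x = \<kappa> * fst (snd x) ^ j + (\<Sum>m<j. b m * fst (snd x) ^ m * norm (snd x) ^ (j - m))"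
    by (rule hpoly_expansion[OF s, of j, where 'm = 'm]) blast
  define G where "G m u = sqrt (1 - (norm u)\<^sup>2) ^ (j - m) * g u" for m and u :: "real^'m"
  have Gc: "continuous_on (cball 0 1) (G m)" for m
    unfolding G_def by (intro continuous_intros less.prems)
  have hc: "continuous_on UNIV (hpoly s j :: 'm pt \<Rightarrow> real)"
    unfolding hpoly_def[abs_def] vfun_def by (intro continuous_intros)
  have tc: "continuous_on closed_hemi (\<lambda>\<theta>::'m pt. fst (snd \<theta>) ^ m * g' (fst \<theta>))" if "continuous_on (cball 0 1) g'" for m g'
    by (intro continuous_intros continuous_on_horizontal that)
  have i: "integrable ?M (\<lambda>\<theta>. \<omega> \<theta> * (fst (snd \<theta>) ^ m * G m (fst \<theta>)))" for m
    by (rule annihilator_integrable[OF tc[OF Gc]])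
  have i': "integrable ?M (\<lambda>\<theta>. \<omega> \<theta> * (fst (snd \<theta>) ^ j * g (fst \<theta>)))"
    by (rule annihilator_integrable[OF tc[OF less.prems]])
  have "0 = (\<integral>\<theta>. \<omega> \<theta> * (hpoly s j \<theta> * g (fst \<theta>)) \<partial>?M)"
    by (rule annihilator_horizontal[symmetric, OF hc orth less.prems])
  also have "\<dots> = (\<integral>\<theta>. \<kappa> * (\<omega> \<theta> * (fst (snd \<theta>) ^ j * g (fst \<theta>))) + (\<Sum>m<j. b m * (\<omega> \<theta> * (fst (snd \<theta>) ^ m * G m (fst \<theta>)))) \<partial>?M)"
  proof (rule Bochner_Integration.integral_cong)
    fix \<theta> :: "'m pt" assume "\<theta> \<in> space ?M"
    then have r: "norm (snd \<theta>) = sqrt (1 - (norm (fst \<theta>))\<^sup>2)"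
      by (simp add: closed_hemi_norms(2)[OF subsetD[OF hemi_subset]])
    show "\<omega> \<theta> * (hpoly s j \<theta> * g (fst \<theta>)) =
      \<kappa> * (\<omega> \<theta> * (fst (snd \<theta>) ^ j * g (fst \<theta>))) + (\<Sum>m<j. b m * (\<omega> \<theta> * (fst (snd \<theta>) ^ m * G m (fst \<theta>))))"
      unfolding e G_def r by (simp add: distrib_left distrib_right sum_distrib_left sum_distrib_right mult_ac)
  qed simp
  also have "\<dots> = \<kappa> * (\<integral>\<theta>. \<omega> \<theta> * (fst (snd \<theta>) ^ j * g (fst \<theta>)) \<partial>?M) +
     (\<Sum>m<j. b m * (\<integral>\<theta>. \<omega> \<theta> * (fst (snd \<theta>) ^ m * G m (fst \<theta>)) \<partial>?M))"
    by (subst Bochner_Integration.integral_add)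
      (auto intro!: i i' integrable_mult_right Bochner_Integration.integrable_sum simp del: integrable_mult_right_iff simp: Bochner_Integration.integral_sum i)
  also have "(\<Sum>m<j. b m * (\<integral>\<theta>. \<omega> \<theta> * (fst (snd \<theta>) ^ m * G m (fst \<theta>)) \<partial>?M)) = 0"
    by (rule sum.neutral) (use less.IH[OF _ Gc] in auto)
  finally show ?case using \<kappa> by simp
qed

lemma annihilator_continuous:
  fixes P :: "'m pt \<Rightarrow> real"
  assumes orth: "\<And>j n a. snd a = 0 \<Longrightarrow> (\<integral>\<theta>. \<omega> \<theta> * (hpoly s j \<theta> * (\<theta> \<bullet> a) ^ n) \<partial>weighted_measure s) = 0"
    and P: "continuous_on closed_hemi P"
  shows "(\<integral>\<theta>. \<omega> \<theta> * P \<theta> \<partial>weighted_measure s) = 0"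
proof -
  let ?M = "weighted_measure s :: 'm pt measure"
  let ?B = "{\<lambda>\<theta>::'m pt. fst (snd \<theta>) ^ j * g (fst \<theta>) | (j::nat) (g :: real^'m \<Rightarrow> real). continuous_on (cball 0 1) g}"
  have BI: "f \<in> ?B" if "continuous_on (cball 0 1) g" "\<And>\<theta>. f \<theta> = fst (snd \<theta>) ^ j * g (fst \<theta>)" for f j g
    using that(1) ext[of f "\<lambda>\<theta>. fst (snd \<theta>) ^ j * g (fst \<theta>)", OF that(2)] by blast
  show ?thesis
  proof (rule annihilator_of_multiplicative_family[where S = closed_hemi and L = "\<lambda>P. \<integral>\<theta>. \<omega> \<theta> * P \<theta> \<partial>?M" and B = ?B
        and C = "\<integral>\<theta>. \<bar>\<omega> \<theta>\<bar> \<partial>?M"])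
    fix f f' assume "f \<in> ?B" "f' \<in> ?B"
    then obtain j g j' g' where f: "f = (\<lambda>\<theta>. fst (snd \<theta>) ^ j * g (fst \<theta>))" "continuous_on (cball 0 1) g"
      "f' = (\<lambda>\<theta>. fst (snd \<theta>) ^ j' * g' (fst \<theta>))" "continuous_on (cball 0 1) g'" by blast
    have "continuous_on (cball 0 1) (\<lambda>u. g u * g' u)" by (intro continuous_intros f)
    then show "(\<lambda>x. f x * f' x) \<in> ?B" by (rule BI[where j = "j + j'"]) (simp add: f power_add)
  next
    show "(\<lambda>_. 1) \<in> ?B" by (rule BI[where g = "\<lambda>_. 1" and j = 0]) simp_all
  next
    fix f assume "f \<in> ?B"
    then show "continuous_on closed_hemi f" by (auto intro!: continuous_intros continuous_on_horizontal)
    from \<open>f \<in> ?B\<close> show "(\<integral>\<theta>. \<omega> \<theta> * f \<theta> \<partial>?M) = 0" using annihilator_powers[OF orth] by auto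
  next
    fix x y :: "'m pt" assume xy: "x \<in> closed_hemi" "y \<in> closed_hemi" "x \<noteq> y"
    show "\<exists>f\<in>?B. f x \<noteq> f y"
    proof (cases "fst x = fst y")
      case False
      let ?g = "\<lambda>u. u \<bullet> (fst x - fst y)"
      have "(fst x - fst y) \<bullet> (fst x - fst y) \<noteq> 0" using False by simp
      then have "?g (fst x) \<noteq> ?g (fst y)" by (simp add: inner_diff_left)
      moreover have "continuous_on (cball 0 1) ?g" by (intro continuous_intros)
      then have "(\<lambda>\<theta>::'m pt. ?g (fst \<theta>)) \<in> ?B" by (rule BI[where j = 0]) simp
      ultimately show ?thesis by (rule_tac bexI)
    next
      case True
      \<comment> \<open>The family does not contain y. Points are still separated, because x'
        determines r, then t determines the square of the last coordinate, and that coordinate is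
        nonnegative on the closed half-sphere.\<close>
      have "fst (snd x) \<noteq> fst (snd y)"
      proof
        assume t: "fst (snd x) = fst (snd y)"
        have "norm (snd x) = norm (snd y)" using closed_hemi_norms(2)[OF xy(1)] closed_hemi_norms(2)[OF xy(2)] True by simp
        then have "(fst (snd x))\<^sup>2 + (snd (snd x))\<^sup>2 = (fst (snd y))\<^sup>2 + (snd (snd y))\<^sup>2"
          by (simp add: norm_prod_def)
        then have "snd (snd x) = snd (snd y)"
          using t xy by (simp add: closed_hemi_def)
        then show False using t True xy(3) by (simp add: prod_eq_iff)
      qed
      moreover have "(\<lambda>\<theta>::'m pt. fst (snd \<theta>)) \<in> ?B" by (rule BI[where g = "\<lambda>_. 1" and j = 1]) simp_all
      ultimately show ?thesis by (rule_tac bexI)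
    qed
  next
    fix f f' :: "'m pt \<Rightarrow> real" assume "continuous_on closed_hemi f" "continuous_on closed_hemi f'"
    then show "(\<integral>\<theta>. \<omega> \<theta> * (f \<theta> + f' \<theta>) \<partial>?M) = (\<integral>\<theta>. \<omega> \<theta> * f \<theta> \<partial>?M) + (\<integral>\<theta>. \<omega> \<theta> * f' \<theta> \<partial>?M)"
      using annihilator_integrable[of f] annihilator_integrable[of f'] by (simp add: distrib_left)
  next
    fix f :: "'m pt \<Rightarrow> real" and k :: real
    have "(\<integral>\<theta>. \<omega> \<theta> * (k * f \<theta>) \<partial>?M) = (\<integral>\<theta>. k * (\<omega> \<theta> * f \<theta>) \<partial>?M)"
      by (rule Bochner_Integration.integral_cong) auto
    then show "(\<integral>\<theta>. \<omega> \<theta> * (k * f \<theta>) \<partial>?M) = k * (\<integral>\<theta>. \<omega> \<theta> * f \<theta> \<partial>?M)" by simp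
  qed (use P compact_closed_hemi annihilator_bound in auto)
qed

text \<open>Indicators of closed sets are bounded limits of continuous functions of the distance.
  Closed sets form an intersection-stable generator of the Borel sets, so a Dynkin argument extends
  the vanishing to all Borel sets, and the sets where \<omega> is positive or negative finish the
  proof.\<close>

lemma annihilator_AE_zero:
  assumes cont: "\<And>P :: 'm pt \<Rightarrow> real. continuous_on UNIV P \<Longrightarrow> (\<integral>\<theta>. \<omega> \<theta> * P \<theta> \<partial>weighted_measure s) = 0"
  shows "AE \<theta> in weighted_measure s. \<omega> \<theta> = 0"
proof -
  let ?M = "weighted_measure s :: 'm pt measure"
  note [measurable] = borel_measurable_integrable[OF \<omega>]
  have Ms: "A \<inter> hemi \<in> sets ?M" if "A \<in> sets borel" for A
    using that by (auto simp: sets_weighted sets_restrict_space)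
  have indm: "(\<lambda>\<theta>. indicat_real A \<theta>) \<in> borel_measurable ?M" if "A \<in> sets borel" for A
    unfolding measurable_weighted by (rule measurable_restrict_space1) (use that in \<open>simp add: borel_measurable_indicator\<close>)
  have indi: "integrable ?M (\<lambda>\<theta>. \<omega> \<theta> * indicator A \<theta>)" if "A \<in> sets borel" for A
    using indm[OF that]
    by (intro Bochner_Integration.integrable_bound[OF \<omega>]) (auto simp: indicator_def)
  have closed: "(\<integral>\<theta>. \<omega> \<theta> * indicator C \<theta> \<partial>?M) = 0" if C: "closed C" for C
  proof (cases "C = {}")
    case False
    define P where "P n x = max 0 (1 - real n * infdist x C)" for n and x :: "'m pt"
    have Pc: "continuous_on UNIV (P n)" for n unfolding P_def by (intro continuous_intros)
    have Pb: "0 \<le> P n x" "P n x \<le> 1" for n x by (auto simp: P_def infdist_nonneg)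
    have "(\<lambda>n. \<integral>\<theta>. \<omega> \<theta> * P n \<theta> \<partial>?M) \<longlonglongrightarrow> (\<integral>\<theta>. \<omega> \<theta> * indicator C \<theta> \<partial>?M)"
    proof (rule integral_dominated_convergence[where w = "\<lambda>\<theta>. \<bar>\<omega> \<theta>\<bar>"])
      show "(\<lambda>\<theta>. \<omega> \<theta> * indicator C \<theta>) \<in> borel_measurable ?M"
        by (rule borel_measurable_integrable[OF indi[OF borel_closed[OF C]]])
      show "(\<lambda>\<theta>. \<omega> \<theta> * P n \<theta>) \<in> borel_measurable ?M" for n
        by (rule borel_measurable_integrable[OF annihilator_integrable]) (use Pc continuous_on_subset in blast)
      show "integrable ?M (\<lambda>\<theta>. \<bar>\<omega> \<theta>\<bar>)" by (rule integrable_abs[OF \<omega>])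
      show "AE \<theta> in ?M. norm (\<omega> \<theta> * P n \<theta>) \<le> \<bar>\<omega> \<theta>\<bar>" for n
        by (rule AE_I2) (use Pb in \<open>auto simp: abs_mult intro!: mult_left_le\<close>)
      show "AE \<theta> in ?M. (\<lambda>n. \<omega> \<theta> * P n \<theta>) \<longlonglongrightarrow> \<omega> \<theta> * indicator C \<theta>"
      proof (rule AE_I2, rule tendsto_mult[OF tendsto_const])
        fix x :: "'m pt"
        show "(\<lambda>n. P n x) \<longlonglongrightarrow> indicator C x"
        proof (cases "x \<in> C")
          case True
          then show ?thesis by (simp add: P_def)
        next
          case nC: False
          then have d: "infdist x C > 0" using infdist_pos_not_in_closed[OF C False] by simp
          obtain n0 where n0: "1 / infdist x C < real n0" using reals_Archimedean2 by blast
          have "P n x = 0" if "n \<ge> n0" for n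
          proof -
            have "1 / infdist x C < real n" using n0 that by linarith
            then have "1 < real n * infdist x C" using d by (simp add: field_simps)
            then show ?thesis by (simp add: P_def)
          qed
          then have "\<forall>\<^sub>F n in sequentially. P n x = 0" by (auto simp: eventually_sequentially)
          then show ?thesis using nC by (simp add: tendsto_eventually)
        qed
      qed
    qed
    then have "(\<lambda>n. 0::real) \<longlonglongrightarrow> (\<integral>\<theta>. \<omega> \<theta> * indicator C \<theta> \<partial>?M)" by (simp only: cont[OF Pc])
    then show ?thesis using LIMSEQ_unique tendsto_const by blast
  qed simp
  have all: "(\<integral>\<theta>. \<omega> \<theta> * indicator A \<theta> \<partial>?M) = 0" if A: "A \<in> sets borel" for A :: "'m pt set"
  proof -
    have "Int_stable (Collect closed :: 'm pt set set)" "Collect closed \<subseteq> Pow (UNIV :: 'm pt set)"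
      "A \<in> sigma_sets UNIV (Collect closed)"
      using A by (auto simp: Int_stable_def borel_eq_closed)
    then show ?thesis
    proof (induction rule: sigma_sets_induct_disjoint)
      case (basic A)
      then show ?case using closed by simp
    next
      case empty
      show ?case by simp
    next
      case (compl A)
      then have A: "A \<in> sets borel" by (simp add: borel_eq_closed)
      have "(\<integral>\<theta>. \<omega> \<theta> * indicator (UNIV - A) \<theta> \<partial>?M) = (\<integral>\<theta>. \<omega> \<theta> * indicator UNIV \<theta> - \<omega> \<theta> * indicator A \<theta> \<partial>?M)"
        by (rule Bochner_Integration.integral_cong) (auto simp: indicator_def)
      also have "\<dots> = 0"
        using compl closed[of UNIV] indi[OF A] indi[of UNIV] by (subst Bochner_Integration.integral_diff) auto
      finally show ?case .
    next
      case (union A)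
      then have A: "A i \<in> sets borel" for i by (auto simp: borel_eq_closed)
      then have U: "(\<Union>i. A i) \<in> sets borel" by blast
      have "(\<lambda>k. \<integral>\<theta>. \<omega> \<theta> * indicator (\<Union>i<k. A i) \<theta> \<partial>?M) \<longlonglongrightarrow> (\<integral>\<theta>. \<omega> \<theta> * indicator (\<Union>i. A i) \<theta> \<partial>?M)"
      proof (rule integral_dominated_convergence[where w = "\<lambda>\<theta>. \<bar>\<omega> \<theta>\<bar>"])
        show "(\<lambda>\<theta>. \<omega> \<theta> * indicator (\<Union>i. A i) \<theta>) \<in> borel_measurable ?M"
          by (rule borel_measurable_integrable[OF indi[OF U]])
        show "(\<lambda>\<theta>. \<omega> \<theta> * indicator (\<Union>i<k. A i) \<theta>) \<in> borel_measurable ?M" for k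
          by (rule borel_measurable_integrable[OF indi]) (use A in blast)
        show "integrable ?M (\<lambda>\<theta>. \<bar>\<omega> \<theta>\<bar>)" by (rule integrable_abs[OF \<omega>])
        show "AE \<theta> in ?M. norm (\<omega> \<theta> * indicator (\<Union>i<k. A i) \<theta>) \<le> \<bar>\<omega> \<theta>\<bar>" for k
          by (rule AE_I2) (auto simp: indicator_def)
        show "AE \<theta> in ?M. (\<lambda>k. \<omega> \<theta> * indicator (\<Union>i<k. A i) \<theta>) \<longlonglongrightarrow> \<omega> \<theta> * indicator (\<Union>i. A i) \<theta>"
          by (rule AE_I2) (intro tendsto_mult tendsto_const LIMSEQ_indicator_UN)
      qed
      moreover have "(\<integral>\<theta>. \<omega> \<theta> * indicator (\<Union>i<k. A i) \<theta> \<partial>?M) = 0" for k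
      proof -
        have "indicat_real (\<Union>i<k. A i) \<theta> = (\<Sum>i<k. indicator (A i) \<theta>)" for \<theta>
          by (rule indicator_UN_disjoint) (use union(1) in \<open>auto simp: disjoint_family_on_def\<close>)
        then have "(\<integral>\<theta>. \<omega> \<theta> * indicator (\<Union>i<k. A i) \<theta> \<partial>?M) = (\<integral>\<theta>. (\<Sum>i<k. \<omega> \<theta> * indicator (A i) \<theta>) \<partial>?M)"
          by (simp add: sum_distrib_left)
        also have "\<dots> = (\<Sum>i<k. (\<integral>\<theta>. \<omega> \<theta> * indicator (A i) \<theta> \<partial>?M))"
          by (rule Bochner_Integration.integral_sum) (rule indi[OF A])
        also have "\<dots> = 0" using union by simp
        finally show ?thesis .
      qed
      ultimately show ?case by (simp add: LIMSEQ_const_iff)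
    qed
  qed
  have zero: "AE \<theta> in ?M. f \<theta> = 0" if f: "\<And>\<theta>. f \<theta> = \<omega> \<theta> * indicator A \<theta> * c" "\<And>\<theta>. \<theta> \<in> hemi \<Longrightarrow> f \<theta> \<ge> 0" "A \<in> sets borel" for f A c
  proof -
    have "integrable ?M f" unfolding f(1)[abs_def] by (rule integrable_mult_left[OF indi[OF f(3)]])
    moreover have "(\<integral>\<theta>. f \<theta> \<partial>?M) = 0" unfolding f(1) using all[OF f(3)] by simp
    moreover have "AE \<theta> in ?M. 0 \<le> f \<theta>" by (rule AE_I2) (use f(2) in auto)
    ultimately show ?thesis using integral_nonneg_eq_0_iff_AE by blast
  qed
  \<comment> \<open>Measurable sets of the weighted measure are traces of Borel sets on
    \<open>hemi\<close>; the sign sets are therefore replaced by Borel sets before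
    \<open>all\<close> is applied.\<close>
  have ex: "\<exists>A\<in>sets borel. {\<theta>\<in>hemi. 0 < c * \<omega> \<theta>} = A \<inter> hemi" for c
  proof -
    have "{\<theta> \<in> space ?M. 0 < c * \<omega> \<theta>} \<in> sets ?M" by measurable
    then show ?thesis by (auto simp: sets_weighted sets_restrict_space)
  qed
  obtain A where A: "A \<in> sets borel" "{\<theta>\<in>hemi. 0 < 1 * \<omega> \<theta>} = A \<inter> hemi" using ex by blast
  obtain B where B: "B \<in> sets borel" "{\<theta>\<in>hemi. 0 < - 1 * \<omega> \<theta>} = B \<inter> hemi" using ex by blast
  have A': "\<omega> \<theta> > 0" if "\<theta> \<in> A" "\<theta> \<in> hemi" for \<theta> using A(2) that by auto
  have B': "\<omega> \<theta> < 0" if "\<theta> \<in> B" "\<theta> \<in> hemi" for \<theta> using B(2) that by auto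
  have "AE \<theta> in ?M. \<omega> \<theta> * indicator A \<theta> * 1 = 0"
    by (rule zero[OF refl _ A(1)]) (simp add: indicator_def less_imp_le[OF A'])
  moreover have "AE \<theta> in ?M. \<omega> \<theta> * indicator B \<theta> * - 1 = 0"
    by (rule zero[OF refl _ B(1)]) (simp add: indicator_def less_imp_le[OF B'])
  moreover have "AE \<theta> in ?M. \<theta> \<in> hemi" by (rule AE_I2) simp
  ultimately show ?thesis
  proof eventually_elim
    case (elim \<theta>)
    have "\<theta> \<in> A \<or> \<theta> \<in> B \<or> \<omega> \<theta> = 0" using A(2) B(2) elim(3) by (cases "\<omega> \<theta>" "0::real" rule: linorder_cases) auto
    then show ?case using elim by auto
  qed
qed

end

subsection \<open>The spectrum\<close>

text \<open>By homogeneity a function that vanishes almost everywhere on the half-sphere does so in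
  the half-ball; its nonzero set there is open and negligible, hence empty. Then
  \<open>hpoly\<close> vanishes throughout y > 0, which its value on the Dirichlet cone
  contradicts.\<close>

lemma efun_not_AE_zero:
  assumes s: "0 < s" "s < 1"
    and efm: "efun s j 0 (0::'m::finite pt) \<in> borel_measurable (weighted_measure s)"
    and ae: "AE \<theta> in weighted_measure s. efun s j 0 (0::'m pt) \<theta> = 0"
  shows False
proof -
  let ?M = "weighted_measure s :: 'm pt measure"
  define f where "f = efun s j 0 (0::'m pt)"
  have fm [measurable]: "f \<in> borel_measurable ?M" using efm by (simp add: f_def)
  have "snd (0::'m pt) = 0" by simp
  from has_wlap_efun[OF s(1) this] obtain g q l where W: "has_wlap s f g q l" unfolding f_def by blast
  have fc: "continuous_on {x. wfun x > 0} f" by (rule has_wlap_continuous(1)[OF W])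
  have sub: "half_ball \<subseteq> {x::'m pt. wfun x > 0}" by (auto simp: half_ball_def intro: wfun_pos)
  have op: "open (half_ball :: 'm pt set)"
    unfolding half_ball_def by (intro open_Collect_conj open_Collect_less continuous_intros)
  let ?Z = "{x \<in> half_ball. f x \<noteq> 0}"
  have "?Z = half_ball \<inter> f -` (- {0})" by auto
  moreover have "open (half_ball \<inter> f -` (- {0}))"
    using continuous_on_open_vimage[OF op, of f] continuous_on_subset[OF fc sub]
      open_Compl[OF closed_singleton[of "0::real"]] by (simp add: Int_commute)
  ultimately have opZ: "open ?Z" by simp
  have "(\<integral>\<^sup>+\<theta>. ennreal \<bar>f \<theta>\<bar> \<partial>?M) = 0"
  proof -
    have "AE \<theta> in ?M. ennreal \<bar>f \<theta>\<bar> = 0" using ae unfolding f_def[symmetric] by eventually_elim simp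
    then show ?thesis by (subst nn_integral_0_iff_AE) auto
  qed
  then have "(\<integral>\<^sup>+x. ennreal (ball_weight s x) * ennreal \<bar>f (x /\<^sub>R norm x)\<bar> * indicator half_ball x \<partial>lborel) = 0"
    by (subst (asm) nn_integral_weighted) auto
  moreover have "(\<lambda>x. ennreal (ball_weight s x) * ennreal \<bar>f (x /\<^sub>R norm x)\<bar> * indicator half_ball x) \<in> borel_measurable lborel"
  proof -
    have fh: "continuous_on half_ball (\<lambda>x. f (x /\<^sub>R norm x))"
    proof (rule continuous_on_compose2[OF fc])
      show "continuous_on half_ball (\<lambda>x::'m pt. x /\<^sub>R norm x)"
        by (intro continuous_intros) (rule ballI, drule norm_radial_pos, simp)
      show "(\<lambda>x. x /\<^sub>R norm x) ` half_ball \<subseteq> {x. wfun x > 0}"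
        using hemi_wfun[OF radial_hemi] by (auto simp: half_ball_def)
    qed
    have "(\<lambda>x. indicator half_ball x *\<^sub>R f (x /\<^sub>R norm x)) \<in> borel_measurable borel"
      by (rule borel_measurable_continuous_on_indicator[OF _ fh]) simp
    then have "(\<lambda>x. ennreal (ball_weight s x) * ennreal \<bar>indicator half_ball x *\<^sub>R f (x /\<^sub>R norm x)\<bar>) \<in> borel_measurable borel"
      by measurable
    moreover have "(\<lambda>x. ennreal (ball_weight s x) * ennreal \<bar>f (x /\<^sub>R norm x)\<bar> * indicator half_ball x) =
      (\<lambda>x. ennreal (ball_weight s x) * ennreal \<bar>indicator half_ball x *\<^sub>R f (x /\<^sub>R norm x)\<bar>)"
      by (auto simp: indicator_def)
    ultimately show ?thesis by simp
  qed
  ultimately have "AE x in lborel. ennreal (ball_weight s x) * ennreal \<bar>f (x /\<^sub>R norm x)\<bar> * indicator half_ball x = 0"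
    by (simp only: nn_integral_0_iff_AE)
  then have "AE x in lborel. x \<notin> ?Z"
  proof eventually_elim
    case (elim x)
    show ?case
    proof
      assume x: "x \<in> ?Z"
      then have n: "norm x > 0" "snd (snd x) > 0" by (auto simp: half_ball_def)
      have "f x = norm x powr (real j + s) * f (x /\<^sub>R norm x)"
        using efun_scale[of "norm x" s j 0 "0::'m pt" "x /\<^sub>R norm x"] n by (simp add: f_def)
      then have "f (x /\<^sub>R norm x) \<noteq> 0" using x by auto
      moreover have "ball_weight s x > 0" using n by (simp add: ball_weight_def)
      ultimately show False using elim x by simp
    qed
  qed
  then have "?Z \<in> null_sets lborel"
    using AE_iff_null_sets[of ?Z lborel] borel_open[OF opZ] by simp
  then have "negligible ?Z"
    using null_sets_completionI by (auto simp: negligible_iff_null_sets)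
  then have Z: "?Z = {}" using open_not_negligible[OF opZ] by blast
  have h0: "hpoly s j (0::real^'m, 1, y) = 0" if y: "y > 0" for y
  proof -
    define x :: "'m pt" where "x = (0, 1, y)"
    define c where "c = 1 / (2 * norm x)"
    have n: "norm x > 0" by (simp add: x_def zero_prod_def)
    have c: "c > 0" using n by (simp add: c_def)
    have "norm (c *\<^sub>R x) < 1" using n by (simp add: c_def)
    moreover have "snd (snd (c *\<^sub>R x)) > 0" using c y by (simp add: x_def)
    ultimately have "c *\<^sub>R x \<in> half_ball" by (simp add: half_ball_def)
    then have "f (c *\<^sub>R x) = 0" using Z by blast
    then have "f x = 0" using efun_scale[of c s j 0 "0::'m pt" x] n by (simp add: f_def c_def)
    moreover have "wfun x > 0" using y by (intro wfun_pos) (simp add: x_def)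
    ultimately show ?thesis by (simp add: f_def efun_def x_def)
  qed
  \<comment> \<open>At the point (0, 1, 0) w is 0 and v is 2, so only the term with i = 0 survives
    and \<open>hpoly\<close> equals 2^j. As \<open>efun\<close> itself vanishes there, the value is
    reached as a limit for y \<rightarrow> 0 from above.\<close>
  define H where "H y = hpoly s j (0::real^'m, 1, y)" for y
  have "continuous_on UNIV H"
    unfolding H_def hpoly_def wfun_def vfun_def by (intro continuous_intros)
  then have "(H \<longlongrightarrow> H 0) (at 0)" by (simp add: continuous_on_def)
  then have "(H \<longlongrightarrow> H 0) (at_right 0)" by (rule filterlim_at_split[THEN iffD1, THEN conjunct2])
  moreover have "\<forall>\<^sub>F y in at_right 0. H y = 0"
    unfolding eventually_at_filter by (rule always_eventually) (auto simp: H_def h0)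
  then have "(H \<longlongrightarrow> 0) (at_right 0)" by (rule tendsto_eventually)
  ultimately have "H 0 = 0" using tendsto_unique trivial_limit_at_right_real by blast
  moreover have "H 0 = 2 ^ j"
  proof -
    have "H 0 = (\<Sum>i\<le>j. if i = 0 then 2 ^ j else 0)"
      unfolding H_def hpoly_def wfun_def vfun_def by (intro sum.cong) (auto simp: norm_Pair power_0_left)
    then show ?thesis by simp
  qed
  ultimately show False by simp
qed

text \<open>Taking n = 0 removes the lower-order term and leaves a genuine eigenfunction; every
  eigenvalue is reached because only j + n enters it.\<close>

lemma eigenvalue_exists:
  assumes s: "0 < s" "s < 1"
  shows "(real j + s) * (real j + real CARD('m) + 1 - s) \<in> eigenvalues TYPE('m::finite) s"
proof -
  obtain G where G: "(efun s j 0 (0::'m pt), G) \<in> H0 s"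
    "\<And>p. p \<in> H0 s \<Longrightarrow> (\<integral>\<theta>. G \<theta> \<bullet> snd p \<theta> \<partial>weighted_measure s) =
      (\<integral>\<theta>. ((real (j + 0) + s) * (real (j + 0) + real CARD('m) + 1 - s) * efun s j 0 0 \<theta>
         - real 0 * (real 0 - 1) * ((0::'m pt) \<bullet> 0) * efun s j (0 - 2) 0 \<theta>) * fst p \<theta> \<partial>weighted_measure s)"
    by (rule efun_weak_equation[OF s, of "0::'m pt" j 0]) auto
  have em: "efun s j 0 (0::'m pt) \<in> borel_measurable (weighted_measure s)"
    using H1_measurable(1)[OF H0_H1[OF G(1)]] by simp
  have "eigenfunction s ((real j + s) * (real j + real CARD('m) + 1 - s)) (efun s j 0 (0::'m pt), G)"
    unfolding eigenfunction_def
  proof (intro conjI ballI G(1))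
    show "sq_dist s (efun s j 0 (0::'m pt), G) (\<lambda>_. 0, \<lambda>_. 0) \<noteq> 0"
    proof
      assume "sq_dist s (efun s j 0 (0::'m pt), G) (\<lambda>_. 0, \<lambda>_. 0) = 0"
      then have "AE \<theta> in weighted_measure s. ennreal ((norm (G \<theta>))\<^sup>2 + (efun s j 0 0 \<theta>)\<^sup>2) = 0"
        using em H1_measurable(2)[OF H0_H1[OF G(1)]] unfolding sq_dist_def
        by (subst (asm) nn_integral_0_iff_AE) auto
      then have "AE \<theta> in weighted_measure s. efun s j 0 (0::'m pt) \<theta> = 0"
        by eventually_elim (simp add: sum_power2_le_zero_iff ennreal_eq_0_iff)
      then show False by (rule efun_not_AE_zero[OF s em])
    qed
    fix p :: "'m jet" assume "p \<in> H0 s"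
    from G(2)[OF this] show "(\<integral>\<theta>. snd (efun s j 0 (0::'m pt), G) \<theta> \<bullet> snd p \<theta> \<partial>weighted_measure s) =
      (real j + s) * (real j + real CARD('m) + 1 - s) * (\<integral>\<theta>. fst (efun s j 0 (0::'m pt), G) \<theta> * fst p \<theta> \<partial>weighted_measure s)"
      by (simp add: mult.assoc)
  qed
  then show ?thesis unfolding eigenvalues_def by blast
qed

text \<open>The equation of \<open>efun\<close> is tested with \<psi> and that of \<psi> with
  \<open>efun\<close>. By symmetry the gradient integrals agree, so (\<nu> - \<mu>) times the wanted
  integral is \<kappa> times the integral for n - 2, where \<kappa> = 0 if n < 2. No \<nu> equals
  \<mu>.\<close>

lemma eigenfunction_orthogonal:
  fixes \<psi> :: "'m::finite jet"
  assumes s: "0 < s" "s < 1" and ef: "eigenfunction s \<mu> \<psi>"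
    and \<mu>: "\<And>k::nat. \<mu> \<noteq> (real k + s) * (real k + real CARD('m) + 1 - s)"
    and a: "snd a = 0"
  shows "(\<integral>\<theta>. fst \<psi> \<theta> * efun s j n a \<theta> \<partial>weighted_measure s) = 0"
proof (induction n rule: less_induct)
  case (less n)
  let ?M = "weighted_measure s :: 'm pt measure"
  have \<psi>: "\<psi> \<in> H0 s" using ef by (simp add: eigenfunction_def)
  define \<nu> where "\<nu> = (real (j + n) + s) * (real (j + n) + real CARD('m) + 1 - s)"
  define \<kappa> where "\<kappa> = real n * (real n - 1) * (a \<bullet> a)"
  obtain G where G: "(efun s j n a, G) \<in> H0 s"
    "\<And>p. p \<in> H0 s \<Longrightarrow> (\<integral>\<theta>. G \<theta> \<bullet> snd p \<theta> \<partial>?M) =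
      (\<integral>\<theta>. (\<nu> * efun s j n a \<theta> - \<kappa> * efun s j (n - 2) a \<theta>) * fst p \<theta> \<partial>?M)"
    unfolding \<nu>_def \<kappa>_def by (rule efun_weak_equation[OF s a, of j n]) auto
  obtain G' where G': "(efun s j (n - 2) a, G') \<in> H0 s"
    by (rule efun_weak_equation[OF s a, of j "n - 2"]) auto
  have L: "L2_jet s \<psi>" "L2_jet s (efun s j n a, G)" "L2_jet s (efun s j (n - 2) a, G')"
    using H1_L2[OF s H0_H1] \<psi> G(1) G' by blast+
  have i: "integrable ?M (\<lambda>\<theta>. fst \<psi> \<theta> * efun s j n a \<theta>)" "integrable ?M (\<lambda>\<theta>. fst \<psi> \<theta> * efun s j (n - 2) a \<theta>)"
    using L2_jet_integrable(2)[OF L(1,2)] L2_jet_integrable(2)[OF L(1,3)] by simp_all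
  have "\<kappa> * (\<integral>\<theta>. fst \<psi> \<theta> * efun s j (n - 2) a \<theta> \<partial>?M) = 0"
  proof (cases "n < 2")
    case True
    then have "\<kappa> = 0" by (cases n) (auto simp: \<kappa>_def)
    then show ?thesis by simp
  qed (use less.IH[of "n - 2"] in simp)
  moreover have "(\<integral>\<theta>. G \<theta> \<bullet> snd \<psi> \<theta> \<partial>?M) = \<nu> * (\<integral>\<theta>. fst \<psi> \<theta> * efun s j n a \<theta> \<partial>?M) - \<kappa> * (\<integral>\<theta>. fst \<psi> \<theta> * efun s j (n - 2) a \<theta> \<partial>?M)"
  proof -
    have "(\<integral>\<theta>. G \<theta> \<bullet> snd \<psi> \<theta> \<partial>?M) = (\<integral>\<theta>. \<nu> * (fst \<psi> \<theta> * efun s j n a \<theta>) - \<kappa> * (fst \<psi> \<theta> * efun s j (n - 2) a \<theta>) \<partial>?M)"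
      unfolding G(2)[OF \<psi>] by (rule Bochner_Integration.integral_cong) (auto simp: algebra_simps)
    also have "\<dots> = (\<integral>\<theta>. \<nu> * (fst \<psi> \<theta> * efun s j n a \<theta>) \<partial>?M) - (\<integral>\<theta>. \<kappa> * (fst \<psi> \<theta> * efun s j (n - 2) a \<theta>) \<partial>?M)"
      by (rule Bochner_Integration.integral_diff) (intro integrable_mult_right i)+
    finally show ?thesis by simp
  qed
  moreover have "(\<integral>\<theta>. snd \<psi> \<theta> \<bullet> snd (efun s j n a, G) \<theta> \<partial>?M) = \<mu> * (\<integral>\<theta>. fst \<psi> \<theta> * fst (efun s j n a, G) \<theta> \<partial>?M)"
    using ef G(1) unfolding eigenfunction_def by blast
  then have "(\<integral>\<theta>. G \<theta> \<bullet> snd \<psi> \<theta> \<partial>?M) = \<mu> * (\<integral>\<theta>. fst \<psi> \<theta> * efun s j n a \<theta> \<partial>?M)"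
    by (simp add: inner_commute)
  ultimately have "(\<nu> - \<mu>) * (\<integral>\<theta>. fst \<psi> \<theta> * efun s j n a \<theta> \<partial>?M) = 0"
    by (simp add: left_diff_distrib)
  then show ?case using \<mu>[of "j + n"] by (simp add: \<nu>_def)
qed

lemma eigenvalue_cases:
  assumes s: "0 < s" "s < 1" and "\<mu> \<in> eigenvalues TYPE('m::finite) s"
  obtains k :: nat where "\<mu> = (real k + s) * (real k + real CARD('m) + 1 - s)"
proof (rule ccontr)
  assume "\<not> thesis"
  then have \<mu>: "\<mu> \<noteq> (real k + s) * (real k + real CARD('m) + 1 - s)" for k :: nat using that by blast
  let ?M = "weighted_measure s :: 'm pt measure"
  from assms(3) obtain \<psi> :: "'m jet" where ef: "eigenfunction s \<mu> \<psi>" by (auto simp: eigenvalues_def)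
  have \<psi>: "\<psi> \<in> H0 s" "sq_dist s \<psi> (\<lambda>_. 0, \<lambda>_. 0) \<noteq> 0" using ef by (auto simp: eigenfunction_def)
  have L: "L2_jet s \<psi>" by (rule H1_L2[OF s H0_H1[OF \<psi>(1)]])
  note m [measurable] = L2_jet_parts(1,2)[OF L]
  \<comment> \<open>The factor w^s moves into the density; what remains of each explicit solution is
    then continuous on the closed half-sphere.\<close>
  define \<omega> where "\<omega> \<theta> = fst \<psi> \<theta> * wfun \<theta> powr s" for \<theta>
  \<comment> \<open>\<open>efun s 0 0 0\<close> is w^s itself. Its membership in \<open>H0\<close>
    makes it square integrable, so its product with \<psi> is integrable.\<close>
  obtain G where G: "(efun s 0 0 (0::'m pt), G) \<in> H0 s"
    by (rule efun_weak_equation[OF s, of "0::'m pt" 0 0]) auto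
  have "integrable ?M (\<lambda>\<theta>. fst \<psi> \<theta> * fst (efun s 0 0 (0::'m pt), G) \<theta>)"
    by (rule L2_jet_integrable(2)[OF L H1_L2[OF s H0_H1[OF G]]])
  then have \<omega>: "integrable ?M \<omega>" by (simp add: \<omega>_def[abs_def] efun_def hpoly_def)
  have "AE \<theta> in ?M. \<omega> \<theta> = 0"
  proof (rule annihilator_AE_zero[OF s \<omega>])
    fix P :: "'m pt \<Rightarrow> real" assume P: "continuous_on UNIV P"
    show "(\<integral>\<theta>. \<omega> \<theta> * P \<theta> \<partial>?M) = 0"
    proof (rule annihilator_continuous[OF s \<omega>])
      fix j n and a :: "'m pt" assume "snd a = 0"
      from eigenfunction_orthogonal[OF s ef \<mu> this, of j n]
      show "(\<integral>\<theta>. \<omega> \<theta> * (hpoly s j \<theta> * (\<theta> \<bullet> a) ^ n) \<partial>?M) = 0"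
        by (simp add: \<omega>_def efun_def mult.assoc)
    qed (use P continuous_on_subset in blast)
  qed
  moreover have "AE \<theta> in ?M. \<theta> \<in> hemi" by (rule AE_I2) simp
  ultimately have f0: "AE \<theta> in ?M. fst \<psi> \<theta> = 0"
  proof eventually_elim
    case (elim \<theta>)
    then show ?case using hemi_wfun[OF elim(2)] by (simp add: \<omega>_def)
  qed
  \<comment> \<open>A vanishing first component does not yet make the jet zero. Testing the equation
    with \<psi> itself shows that the gradient component vanishes too.\<close>
  have "(\<integral>\<theta>. snd \<psi> \<theta> \<bullet> snd \<psi> \<theta> \<partial>?M) = \<mu> * (\<integral>\<theta>. fst \<psi> \<theta> * fst \<psi> \<theta> \<partial>?M)"
    using ef unfolding eigenfunction_def by blast
  also have "(\<integral>\<theta>. fst \<psi> \<theta> * fst \<psi> \<theta> \<partial>?M) = 0"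
    by (rule integral_eq_zero_AE) (use f0 in eventually_elim, simp)
  finally have "(\<integral>\<theta>. snd \<psi> \<theta> \<bullet> snd \<psi> \<theta> \<partial>?M) = 0" by simp
  then have g0: "AE \<theta> in ?M. snd \<psi> \<theta> \<bullet> snd \<psi> \<theta> = 0"
    using integral_nonneg_eq_0_iff_AE[OF L2_jet_integrable(1)[OF L L]] by simp
  have "AE \<theta> in ?M. ennreal ((norm (snd \<psi> \<theta> - 0))\<^sup>2 + (fst \<psi> \<theta> - 0)\<^sup>2) = 0"
    using f0 g0 by eventually_elim simp
  then have "sq_dist s \<psi> (\<lambda>_. 0, \<lambda>_. 0) = 0"
    unfolding sq_dist_def by (subst nn_integral_0_iff_AE) simp_all
  then show False using \<psi>(2) by simp
qed

theorem mainTheorem4: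
  fixes N :: nat and s :: real
  assumes "N \<ge> 2" and "CARD('m::finite) = N - 1"
    and "0 < s" and "s < 1"
  shows "eigenvalues TYPE('m) s = {(real j + s) * (real j + real N - s) | j :: nat. True} \<and>
    strict_mono (\<lambda>k :: nat. (real k + s) * (real k + real N - s))"
proof
  have N: "real CARD('m) + 1 = real N" using assms(1,2) by simp
  show "eigenvalues TYPE('m) s = {(real j + s) * (real j + real N - s) | j :: nat. True}"
  proof (intro equalityI subsetI)
    fix \<mu> assume "\<mu> \<in> eigenvalues TYPE('m) s"
    then obtain k :: nat where "\<mu> = (real k + s) * (real k + real CARD('m) + 1 - s)"
      by (rule eigenvalue_cases[OF assms(3,4)])
    then show "\<mu> \<in> {(real j + s) * (real j + real N - s) | j :: nat. True}"
      using N by (auto simp: add.assoc)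
  next
    fix \<mu> assume "\<mu> \<in> {(real j + s) * (real j + real N - s) | j :: nat. True}"
    then obtain j :: nat where "\<mu> = (real j + s) * (real j + real N - s)" by blast
    then show "\<mu> \<in> eigenvalues TYPE('m) s"
      using eigenvalue_exists[OF assms(3,4), of j, where 'm = 'm] N by (simp add: add.assoc)
  qed
  show "strict_mono (\<lambda>k :: nat. (real k + s) * (real k + real N - s))"
  proof (rule strict_monoI)
    fix i k :: nat assume "i < k"
    then show "(real i + s) * (real i + real N - s) < (real k + s) * (real k + real N - s)"
      using assms by (intro mult_strict_mono) auto
  qed
qed

end
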